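(* Let $\gamma_+>\gamma_->0$ be constants, and let $D$, $B$, $\Phi_\tau(x,y)$, $l_{x,y}$, $l(x,y)$, $z'(x,y)$, $\tilde z'(x,y)$ be as described in the context. Then for $k=0,1$ there are functions $\Phi^{(k)}_j(x,y)$ ($j=0,1,2,\dots$), $C^\infty$ in $\overline D\times\overline B$ (scalar-valued if $k=0$, vector-valued with three components if $k=1$), such that for any integer $N\ge0$ and all $x\in\overline D$, $y\in\overline B$, $\tau\ge1$, $$\nabla_x^k\Phi_\tau(x,y)=\frac{e^{-\tau l(x,y)}}{8\pi\gamma_+\gamma_-\sqrt{\det H(x,y)}}\Big(\frac{-\tau}{\sqrt{\gamma_-}}\Big)^k\Big(\sum_{j=0}^N\tau^{-j}\Phi^{(k)}_j(x,y)+Q^{(k)}_{N,\tau}(x,y)\Big),$$ where $H(x,y)=\mathrm{Hess}(l_{x,y})(z'(x,y))$ is the Hessian of $z'\mapsto l_{x,y}(z')$ at $z'=z'(x,y)$, and where $Q^{(k)}_{N,\tau}$ ($k=0,1$) are continuous in $\overline D\times\overline B$ and there is a constant $C_N>0$ with $$|Q^{(0)}_{N,\tau}(x,y)|+|Q^{(1)}_{N,\tau}(x,y)|\le C_N\tau^{-(N+1)}\qquad(x\in\overline D,\ y\in\overline B,\ \tau\ge1).$$ Moreover, $$\Phi^{(0)}_0(x,y)=\frac{E_0(x-\tilde z'(x,y))}{|x-\tilde z'(x,y)|\,|\tilde z'(x,y)-y|},\qquad \Phi^{(1)}_0(x,y)=\Phi^{(0)}_0(x,y)\,\frac{x-\tilde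 z'(x,y)}{|x-\tilde z'(x,y)|},$$ where, with $a_0=\sqrt{\gamma_-/\gamma_+}$, $$E_0(x-\tilde z')=\frac{4\sqrt{\gamma_-}\,|x_3|\sqrt{a_0^2|x-\tilde z'|^2-|x'-z'|^2}}{|x-\tilde z'|\Big(\sqrt{a_0^2|x-\tilde z'|^2-|x'-z'|^2}+a_0^2|x_3|\Big)}.$$
   Context: Write $\mathbb R^3_\pm=\{x=(x_1,x_2,x_3)\in\mathbb R^3 : \pm x_3>0\}$, $x'=(x_1,x_2)$, and for $z'=(z_1,z_2)\in\mathbb R^2$ put $\tilde z'=(z_1,z_2,0)$. $D$ is a bounded open set with $C^2$ boundary and $\overline D\subset\mathbb R^3_-$; $B$ is an open ball with $\overline B\subset\mathbb R^3_+$. Here $\nabla_x^0\Phi=\Phi$ and $\nabla_x^1\Phi=\nabla_x\Phi$. For $x\in\mathbb R^3_-$, $y\in\mathbb R^3_+$: $l_{x,y}(z')=\frac1{\sqrt{\gamma_-}}|\tilde z'-x|+\frac1{\sqrt{\gamma_+}}|\tilde z'-y|$ ($z'\in\mathbb R^2$) and $l(x,y)=\inf_{z'\in\mathbb R^2}l_{x,y}(z')$. It is known that there is a unique point $z'(x,y)\in\mathbb R^2$ with $l(x,y)=l_{x,y}(z'(x,y))$, and that it depends in a $C^\infty$ way on $(x,y)\in\mathbb R^3_-\times\mathbb R^3_+$; $\tilde z'(x,y)=(z'(x,y),0)$. In the formula for $E_0(x-\tilde z'(x,y))$ one takes $z'=z'(x,y)$. $\Phi_\tau(x,y)$ is the fundamental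 solution of the two-layer problem: with $\gamma_0(x)=\gamma_\pm$ for $\pm x_3>0$, $\nabla_x\cdot(\gamma_0(x)\nabla_x\Phi_\tau(x,y))-\tau^2\Phi_\tau(x,y)+\delta(x-y)=0$ in $\mathbb R^3$. For $x\in\mathbb R^3_-$, $y\in\mathbb R^3_+$, $\tau>0$ it is given by $$\Phi_\tau(x,y)=\frac{\tau}{4\pi\gamma_+}\int_{\mathbb R^2}E^{\gamma_-}_\tau(x,z')\frac{e^{-\tau|\tilde z'-y|/\sqrt{\gamma_+}}}{|\tilde z'-y|}\,dz',$$ $$E^{\gamma_-}_\tau(x,z')=\frac{\tau}{(2\pi)^3}\int_{\mathbb R^3}e^{i\tau\xi\cdot(x-\tilde z')}\frac{R(\sqrt{\gamma_-}|\xi'|)}{\gamma_-|\xi|^2+1}\,d\xi,\qquad R(\rho)=\frac{4\sqrt{\gamma_-}\sqrt{a_0^2+\rho^2}\sqrt{1+\rho^2}}{\sqrt{a_0^2+\rho^2}+a_0^2\sqrt{1+\rho^2}}\quad(\rho\ge0),$$ where $\xi=(\xi',\xi_3)$, $a_0=\sqrt{\gamma_-/\gamma_+}$, and the $\xi$-integral is taken first in $\xi_3$ and then in $\xi'$; equivalently $E^{\gamma_-}_\tau(x,z')=\frac{\tau}{2(2\pi)^2\gamma_-^{3/2}}\int_{\mathbb R^2}e^{\frac{\tau}{\sqrt{\gamma_-}}(i\eta\cdot(x'-z')-|x_3|\sqrt{1+|\eta|^2})}\frac{R(|\eta|)}{\sqrt{1+|\eta|^2}}\,d\eta$ for $x_3<0$.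 *)

theory Defs
  imports "HOL-Analysis.Analysis"
begin

section \<open>Geometry of the two half spaces\<close>

definition lower_half :: "(real^3) set" where
  "lower_half = {x. x $ 3 < 0}"

definition upper_half :: "(real^3) set" where
  "upper_half = {x. x $ 3 > 0}"

definition join :: "real^2 \<Rightarrow> real \<Rightarrow> real^3" where
  "join z t = vector [z $ 1, z $ 2, t]"

definition hor :: "real^3 \<Rightarrow> real^2" where
  "hor x = vector [x $ 1, x $ 2]"

abbreviation lift0 :: "real^2 \<Rightarrow> real^3" where
  "lift0 z \<equiv> join z 0"

section \<open>Differentiability classes\<close>

text \<open>For open \<open>U\<close> in a finite-dimensional space this is the class of \<open>n\<close> times continuously
  differentiable functions: all iterated directional derivatives of order at most \<open>n\<close> exist in the
  Frechet sense and are continuous.\<close>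

fun Ck_on :: "nat \<Rightarrow> ('a::real_normed_vector \<Rightarrow> 'b::real_normed_vector) \<Rightarrow> 'a set \<Rightarrow> bool" where
  "Ck_on 0 f U \<longleftrightarrow> continuous_on U f"
| "Ck_on (Suc n) f U \<longleftrightarrow>
     (\<forall>x\<in>U. f differentiable (at x)) \<and> (\<forall>v. Ck_on n (\<lambda>x. frechet_derivative f (at x) v) U)"

text \<open>Smoothness on a set that need not be open: \<open>f\<close> agrees on \<open>S\<close> with a function that is
  smooth on an open neighbourhood of \<open>S\<close>.\<close>

definition smooth_on :: "'a::real_normed_vector set \<Rightarrow> ('a \<Rightarrow> 'b::real_normed_vector) \<Rightarrow> bool" where
  "smooth_on S f \<longleftrightarrow>
     (\<exists>U g. open U \<and> S \<subseteq> U \<and> (\<forall>n. Ck_on n g U) \<and> (\<forall>x\<in>S. g x = f x))"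

text \<open>Near each boundary point, after a linear isometry of the coordinates, \<open>D\<close> is the region
  strictly above the graph of a \<open>C\<^sup>2\<close> function of two variables.\<close>

definition C2_boundary :: "(real^3) set \<Rightarrow> bool" where
  "C2_boundary D \<longleftrightarrow>
     (\<forall>p\<in>frontier D. \<exists>r>0. \<exists>T g. orthogonal_transformation T \<and>
        Ck_on 2 (g :: real^2 \<Rightarrow> real) UNIV \<and>
        D \<inter> ball p r = {x \<in> ball p r. T x $ 3 > g (hor (T x))})"

definition Hess :: "(real^2 \<Rightarrow> real) \<Rightarrow> real^2 \<Rightarrow> real^2^2" where
  "Hess f z = (\<chi> i j. frechet_derivative
                 (\<lambda>w. frechet_derivative f (at w) (axis j 1)) (at z) (axis i 1))"

section \<open>Travel time\<close>

text \<open>The arguments \<open>gm\<close> and \<open>gp\<close> are the constants $\gamma_-$ and $\gamma_+$.\<close>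

definition lpath :: "real \<Rightarrow> real \<Rightarrow> real^3 \<Rightarrow> real^3 \<Rightarrow> real^2 \<Rightarrow> real" where
  "lpath gm gp x y z = norm (lift0 z - x) / sqrt gm + norm (lift0 z - y) / sqrt gp"

definition lmin :: "real \<Rightarrow> real \<Rightarrow> real^3 \<Rightarrow> real^3 \<Rightarrow> real" where
  "lmin gm gp x y = (INF z. lpath gm gp x y z)"

definition zmin :: "real \<Rightarrow> real \<Rightarrow> real^3 \<Rightarrow> real^3 \<Rightarrow> real^2" where
  "zmin gm gp x y = (THE z. lpath gm gp x y z = lmin gm gp x y)"

definition Hmat :: "real \<Rightarrow> real \<Rightarrow> real^3 \<Rightarrow> real^3 \<Rightarrow> real^2^2" where
  "Hmat gm gp x y = Hess (lpath gm gp x y) (zmin gm gp x y)"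

section \<open>Fundamental solution of the two-layer problem\<close>

definition a0 :: "real \<Rightarrow> real \<Rightarrow> real" where
  "a0 gm gp = sqrt (gm / gp)"

definition Rfun :: "real \<Rightarrow> real \<Rightarrow> real \<Rightarrow> real" where
  "Rfun gm gp r =
     4 * sqrt gm * sqrt ((a0 gm gp)\<^sup>2 + r\<^sup>2) * sqrt (1 + r\<^sup>2) /
     (sqrt ((a0 gm gp)\<^sup>2 + r\<^sup>2) + (a0 gm gp)\<^sup>2 * sqrt (1 + r\<^sup>2))"

text \<open>The integral over $\xi = (\xi', \xi_3)$ is iterated, first in $\xi_3$ and then in $\xi'$; it is
  not absolutely convergent as an integral over the whole space.\<close>

definition Etau :: "real \<Rightarrow> real \<Rightarrow> real \<Rightarrow> real^3 \<Rightarrow> real^2 \<Rightarrow> complex" where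
  "Etau gm gp \<tau> x z = complex_of_real (\<tau> / (2 * pi)^3) *
     (LINT \<xi>|lborel. LINT t|lborel.
        exp (\<i> * complex_of_real (\<tau> * (join \<xi> t \<bullet> (x - lift0 z)))) *
        complex_of_real (Rfun gm gp (sqrt gm * norm \<xi>) / (gm * (norm (join \<xi> t))\<^sup>2 + 1)))"

definition Phi_formula :: "real \<Rightarrow> real \<Rightarrow> real \<Rightarrow> real^3 \<Rightarrow> real^3 \<Rightarrow> complex" where
  "Phi_formula gm gp \<tau> x y = complex_of_real (\<tau> / (4 * pi * gp)) *
     (LINT z|lborel. Etau gm gp \<tau> x z *
        complex_of_real (exp (- \<tau> * norm (lift0 z - y) / sqrt gp) / norm (lift0 z - y)))"

text \<open>The fundamental solution for \<open>x \<in> lower_half\<close>, \<open>y \<in> upper_half\<close>. The integral formula has a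
  real value (lemma \<open>Phi_formula_eq_Phi\<close>), so \<open>Re\<close> only changes the type.\<close>

definition Phi :: "real \<Rightarrow> real \<Rightarrow> real \<Rightarrow> real^3 \<Rightarrow> real^3 \<Rightarrow> real" where
  "Phi gm gp \<tau> x y = Re (Phi_formula gm gp \<tau> x y)"

lemma lborel_integral_minus:
  fixes f :: "'a::euclidean_space \<Rightarrow> complex"
  shows "(LINT x|lborel. f (- x)) = (LINT x|lborel. f x)"
proof -
  have d: "(lborel :: 'a measure) = distr lborel borel uminus"
    using lborel_affine[of "-1" "0::'a"] by (simp add: density_1)
  show ?thesis
  proof (cases "f \<in> borel_measurable borel")
    case True
    then show ?thesis
      by (subst (2) d, subst integral_distr) simp_all
  next
    case False
    have "(\<lambda>x. f (- x)) \<notin> borel_measurable borel"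
    proof
      assume "(\<lambda>x. f (- x)) \<in> borel_measurable borel"
      then have "(\<lambda>x. f (- (- x))) \<in> borel_measurable borel"
        by (rule measurable_compose[rotated]) simp
      with False show False by simp
    qed
    with False have "\<not> integrable lborel f" "\<not> integrable lborel (\<lambda>x. f (- x))"
      using borel_measurable_integrable by fastforce+
    then show ?thesis
      by (simp add: not_integrable_integral_eq)
  qed
qed

lemma join_minus: "join (- z) (- t) = - join z t"
  by (simp add: join_def vec_eq_iff forall_3)

lemma cnj_Etau: "cnj (Etau gm gp \<tau> x z) = Etau gm gp \<tau> x z"
proof -
  define F where "F \<xi> t = exp (\<i> * complex_of_real (\<tau> * (join \<xi> t \<bullet> (x - lift0 z)))) *
      complex_of_real (Rfun gm gp (sqrt gm * norm \<xi>) / (gm * (norm (join \<xi> t))\<^sup>2 + 1))" for \<xi> t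
  have F: "cnj (F \<xi> t) = F (- \<xi>) (- t)" for \<xi> t
    by (simp add: F_def join_minus exp_cnj)
  have "cnj (LINT \<xi>|lborel. LINT t|lborel. F \<xi> t) = (LINT \<xi>|lborel. LINT t|lborel. F (- \<xi>) (- t))"
    unfolding Bochner_Integration.integral_cnj[symmetric] F ..
  also have "\<dots> = (LINT \<xi>|lborel. LINT t|lborel. F (- \<xi>) t)"
    by (simp add: lborel_integral_minus[of "F _"])
  also have "\<dots> = (LINT \<xi>|lborel. LINT t|lborel. F \<xi> t)"
    by (rule lborel_integral_minus)
  finally show ?thesis
    by (simp add: Etau_def F_def)
qed

lemma Phi_formula_eq_Phi: "Phi_formula gm gp \<tau> x y = complex_of_real (Phi gm gp \<tau> x y)"
proof -
  have "cnj (Phi_formula gm gp \<tau> x y) = Phi_formula gm gp \<tau> x y"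
    unfolding Phi_formula_def complex_cnj_mult Bochner_Integration.integral_cnj[symmetric] cnj_Etau
      complex_cnj_complex_of_real ..
  then show ?thesis
    by (simp add: Phi_def complex_eq_iff)
qed

section \<open>Leading amplitude\<close>

text \<open>$E_0$ as a function of the vector $v = x - \tilde z'$, whose components are
  $v' = x' - z'$ and $v_3 = x_3$.\<close>

definition E0 :: "real \<Rightarrow> real \<Rightarrow> real^3 \<Rightarrow> real" where
  "E0 gm gp v =
     4 * sqrt gm * \<bar>v $ 3\<bar> * sqrt ((a0 gm gp)\<^sup>2 * (norm v)\<^sup>2 - (norm (hor v))\<^sup>2) /
     (norm v * (sqrt ((a0 gm gp)\<^sup>2 * (norm v)\<^sup>2 - (norm (hor v))\<^sup>2) + (a0 gm gp)\<^sup>2 * \<bar>v $ 3\<bar>))"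

end

theory Submission
  imports Defs "HOL-Probability.Characteristic_Functions" "HOL-Real_Asymp.Real_Asymp"
begin

text \<open>Carrying out the \<open>z'\<close>-integral turns \<open>\<Phi>\<^sub>\<tau>\<close> into one integral over the horizontal slowness
  \<open>\<xi> \<in> \<real>\<^sup>2\<close>, with phase \<open>\<i>\<tau> \<xi> \<bullet> (x' - y') - \<tau> |x\<^sub>3| S\<^sub>-(\<xi>) - \<tau> y\<^sub>3 S\<^sub>+(\<xi>)\<close>, where
  \<open>S\<^sub>\<plusminus> = sqrt (|\<xi>|\<^sup>2 + 1/\<gamma>\<^sub>\<plusminus>)\<close>, and amplitude \<open>1 / (S\<^sub>+/\<gamma>\<^sub>- + S\<^sub>-/\<gamma>\<^sub>+)\<close>. The saddle point is \<open>\<i> p\<close>,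
  where \<open>p\<close> is the horizontal slowness of the minimal path (Snell's law). On the shifted plane
  \<open>\<real>\<^sup>2 + \<i> p\<close> the real part of the phase is maximal at \<open>\<i> p\<close>, so no further deformation is needed.
  After the rescaling \<open>\<xi> = \<i> p + \<epsilon> \<eta>\<close> with \<open>\<epsilon> = \<tau>\<^sup>-\<^sup>1\<^sup>/\<^sup>2\<close>, the integral is \<open>e\<^sup>-\<^sup>\<tau>\<^sup>l\<close> times a function
  of \<open>(\<epsilon>, x, y)\<close> that is smooth up to \<open>\<epsilon> = 0\<close> and even in \<open>\<epsilon>\<close>. Its Taylor expansion in \<open>\<epsilon>\<close> at \<open>0\<close> is
  the asymptotic expansion, and the gradient in \<open>x\<close> is again \<open>\<tau> e\<^sup>-\<^sup>\<tau>\<^sup>l\<close> times such a function.\<close>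


section \<open>Integrands with smooth parameters\<close>

text \<open>Expanding the z'-integral as it stands would need the asymptotics of \<open>Etau\<close>
  first, uniformly in z', and then a second Laplace expansion on top. Exchanging the integrals
  removes this nesting: for fixed \<xi> the z'-integral is the Fourier transform of a shifted
  two-dimensional Yukawa function and is known exactly. The formulas for \<open>Phi\<close> and its
  gradient stay exact until the final Taylor expansion, so no asymptotic series is ever
  differentiated, and the error bound is a Taylor remainder on a compact set. The price is joint
  smoothness in (\<epsilon>, x, y) across \<epsilon> = 0. Each derivative brings factors that grow
  polynomially in \<eta>, while for \<epsilon> different from 0 the real part of the phase grows
  only linearly; locally uniform polynomial bounds are stable under this. The inequality gm < gp
  enters through |p|^2 < 1/gp < 1/gm, which keeps the shift clear of the branch points of both
  square roots.\<close>

definition poly_bdd :: "'a::real_normed_vector set \<Rightarrow> ('a \<Rightarrow> 'e::real_normed_vector \<Rightarrow> 'b::real_normed_vector) \<Rightarrow> bool" where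
  "poly_bdd U f \<longleftrightarrow>
     (\<forall>u\<in>U. \<exists>C m. \<forall>\<^sub>F v in nhds u. \<forall>\<eta>. norm (f v \<eta>) \<le> C * (1 + norm \<eta>) ^ m)"

text \<open>Continuity and nonvanishing would not bound the reciprocal, because \<eta> runs over a
  non-compact space; the lower bound has to be uniform in \<eta> and locally uniform in the
  parameter.\<close>

definition away_zero :: "'a::real_normed_vector set \<Rightarrow> ('a \<Rightarrow> 'e::real_normed_vector \<Rightarrow> 'b::real_normed_vector) \<Rightarrow> bool" where
  "away_zero U f \<longleftrightarrow> (\<forall>u\<in>U. \<exists>c>0. \<forall>\<^sub>F v in nhds u. \<forall>\<eta>. c \<le> norm (f v \<eta>))"

text \<open>This class is stable under algebraic operations and under differentiation in \<open>u\<close>, so that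
  differentiation under an integral with exponentially decaying weight can be iterated.\<close>

fun moderate :: "nat \<Rightarrow> 'a::euclidean_space set \<Rightarrow> ('a \<Rightarrow> 'e::euclidean_space \<Rightarrow> 'b::real_normed_vector) \<Rightarrow> bool" where
  "moderate 0 U f \<longleftrightarrow> continuous_on (U \<times> UNIV) (\<lambda>(u, \<eta>). f u \<eta>) \<and> poly_bdd U f"
| "moderate (Suc n) U f \<longleftrightarrow>
     (continuous_on (U \<times> UNIV) (\<lambda>(u, \<eta>). f u \<eta>) \<and> poly_bdd U f) \<and>
     (\<forall>u\<in>U. \<forall>\<eta>. (\<lambda>u. f u \<eta>) differentiable (at u)) \<and>
     (\<forall>v. moderate n U (\<lambda>u \<eta>. frechet_derivative (\<lambda>u. f u \<eta>) (at u) v))"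

lemma poly_bddI:
  assumes "\<And>u. u \<in> U \<Longrightarrow> \<exists>C m. C \<ge> 0 \<and> (\<forall>\<^sub>F v in nhds u. \<forall>\<eta>. norm (f v \<eta>) \<le> C * (1 + norm \<eta>) ^ m)"
  shows "poly_bdd U f"
  using assms unfolding poly_bdd_def by blast

lemma poly_bddE:
  assumes "poly_bdd U f" "u \<in> U"
  obtains C m where "C \<ge> 0" "\<forall>\<^sub>F v in nhds u. \<forall>\<eta>. norm (f v \<eta>) \<le> C * (1 + norm \<eta>) ^ m"
proof -
  obtain C m where *: "\<forall>\<^sub>F v in nhds u. \<forall>\<eta>. norm (f v \<eta>) \<le> C * (1 + norm \<eta>) ^ m"
    using assms unfolding poly_bdd_def by blast
  have "\<forall>\<^sub>F v in nhds u. \<forall>\<eta>. norm (f v \<eta>) \<le> \<bar>C\<bar> * (1 + norm \<eta>) ^ m"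
    using *
  proof eventually_elim
    case (elim v)
    show ?case
    proof
      fix \<eta>
      have "norm (f v \<eta>) \<le> C * (1 + norm \<eta>) ^ m" using elim by blast
      also have "\<dots> \<le> \<bar>C\<bar> * (1 + norm \<eta>) ^ m" by (rule mult_right_mono) auto
      finally show "norm (f v \<eta>) \<le> \<bar>C\<bar> * (1 + norm \<eta>) ^ m" .
    qed
  qed
  then show ?thesis using that[of "\<bar>C\<bar>" m] by simp
qed

lemma poly_bdd_const_bound:
  assumes "\<And>u. u \<in> U \<Longrightarrow> \<exists>C. \<forall>\<^sub>F v in nhds u. \<forall>\<eta>. norm (f v \<eta>) \<le> C"
  shows "poly_bdd U f"
  unfolding poly_bdd_def
proof
  fix u assume "u \<in> U"
  then obtain C where "\<forall>\<^sub>F v in nhds u. \<forall>\<eta>. norm (f v \<eta>) \<le> C" using assms by blast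
  then have "\<forall>\<^sub>F v in nhds u. \<forall>\<eta>. norm (f v \<eta>) \<le> C * (1 + norm \<eta>) ^ 0" by simp
  then show "\<exists>C m. \<forall>\<^sub>F v in nhds u. \<forall>\<eta>. norm (f v \<eta>) \<le> C * (1 + norm \<eta>) ^ m" by blast
qed

lemma poly_bdd_const: "poly_bdd U (\<lambda>u \<eta>. c)"
  by (rule poly_bdd_const_bound) (auto intro!: exI[of _ "norm c"])

text \<open>Carries growth bounds through nonlinear maps of at most linear growth, such as the
  square root and the norm.\<close>

lemma poly_bdd_bounded:
  assumes f: "poly_bdd U f" and K: "K \<ge> 0" and "open U"
    and le: "\<And>u \<eta>. u \<in> U \<Longrightarrow> norm (g u \<eta>) \<le> K * (1 + norm (f u \<eta>))"
  shows "poly_bdd U g"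
proof (rule poly_bddI)
  fix u assume u: "u \<in> U"
  obtain C m where C: "C \<ge> 0" and 1: "\<forall>\<^sub>F v in nhds u. \<forall>\<eta>. norm (f v \<eta>) \<le> C * (1 + norm \<eta>) ^ m"
    using poly_bddE[OF f u] .
  have 2: "\<forall>\<^sub>F v in nhds u. v \<in> U" using \<open>open U\<close> u by (rule eventually_nhds_in_open)
  have "\<forall>\<^sub>F v in nhds u. \<forall>\<eta>. norm (g v \<eta>) \<le> (K * (1 + C)) * (1 + norm \<eta>) ^ m"
    using 1 2
  proof eventually_elim
    case (elim v)
    show ?case
    proof
      fix \<eta>
      have "1 + norm (f v \<eta>) \<le> (1 + norm \<eta>) ^ m + C * (1 + norm \<eta>) ^ m"
        using elim(1) by (intro add_mono) auto
      then have "K * (1 + norm (f v \<eta>)) \<le> K * ((1 + norm \<eta>) ^ m + C * (1 + norm \<eta>) ^ m)"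
        using K by (rule mult_left_mono)
      then show "norm (g v \<eta>) \<le> (K * (1 + C)) * (1 + norm \<eta>) ^ m"
        using le[OF elim(2), of \<eta>] by (simp add: algebra_simps)
    qed
  qed
  then show "\<exists>C m. 0 \<le> C \<and> (\<forall>\<^sub>F v in nhds u. \<forall>\<eta>. norm (g v \<eta>) \<le> C * (1 + norm \<eta>) ^ m)"
    using K C by (intro exI[of _ "K * (1 + C)"] exI[of _ m]) auto
qed

lemma poly_bdd_bilinear:
  assumes "bounded_bilinear P" and f: "poly_bdd U f" and g: "poly_bdd U g"
  shows "poly_bdd U (\<lambda>u \<eta>. P (f u \<eta>) (g u \<eta>))"
proof (rule poly_bddI)
  fix u assume u: "u \<in> U"
  obtain K where K: "K \<ge> 0" "\<And>a b. norm (P a b) \<le> norm a * norm b * K"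
    using bounded_bilinear.nonneg_bounded[OF assms(1)] by blast
  obtain C m where C: "C \<ge> 0" and 1: "\<forall>\<^sub>F v in nhds u. \<forall>\<eta>. norm (f v \<eta>) \<le> C * (1 + norm \<eta>) ^ m"
    using poly_bddE[OF f u] .
  obtain D l where D: "D \<ge> 0" and 2: "\<forall>\<^sub>F v in nhds u. \<forall>\<eta>. norm (g v \<eta>) \<le> D * (1 + norm \<eta>) ^ l"
    using poly_bddE[OF g u] .
  have "\<forall>\<^sub>F v in nhds u. \<forall>\<eta>. norm (P (f v \<eta>) (g v \<eta>)) \<le> (C * D * K) * (1 + norm \<eta>) ^ (m + l)"
    using 1 2
  proof eventually_elim
    case (elim v)
    show ?case
    proof
      fix \<eta>
      have "norm (P (f v \<eta>) (g v \<eta>)) \<le> norm (f v \<eta>) * norm (g v \<eta>) * K" by (rule K)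
      also have "\<dots> \<le> (C * (1 + norm \<eta>) ^ m) * (D * (1 + norm \<eta>) ^ l) * K"
        using elim K C D by (intro mult_right_mono mult_mono) auto
      also have "\<dots> = (C * D * K) * (1 + norm \<eta>) ^ (m + l)" by (simp add: power_add algebra_simps)
      finally show "norm (P (f v \<eta>) (g v \<eta>)) \<le> (C * D * K) * (1 + norm \<eta>) ^ (m + l)" .
    qed
  qed
  then show "\<exists>C m. 0 \<le> C \<and> (\<forall>\<^sub>F v in nhds u. \<forall>\<eta>. norm (P (f v \<eta>) (g v \<eta>)) \<le> C * (1 + norm \<eta>) ^ m)"
    using K C D by (intro exI[of _ "C * D * K"] exI[of _ "m + l"]) auto
qed

lemma poly_bdd_add:
  assumes f: "poly_bdd U f" and g: "poly_bdd U g"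
  shows "poly_bdd U (\<lambda>u \<eta>. f u \<eta> + g u \<eta>)"
proof (rule poly_bddI)
  fix u assume u: "u \<in> U"
  obtain C m where C: "C \<ge> 0" and 1: "\<forall>\<^sub>F v in nhds u. \<forall>\<eta>. norm (f v \<eta>) \<le> C * (1 + norm \<eta>) ^ m"
    using poly_bddE[OF f u] .
  obtain D l where D: "D \<ge> 0" and 2: "\<forall>\<^sub>F v in nhds u. \<forall>\<eta>. norm (g v \<eta>) \<le> D * (1 + norm \<eta>) ^ l"
    using poly_bddE[OF g u] .
  have "\<forall>\<^sub>F v in nhds u. \<forall>\<eta>. norm (f v \<eta> + g v \<eta>) \<le> (C + D) * (1 + norm \<eta>) ^ (m + l)"
    using 1 2
  proof eventually_elim
    case (elim v)
    show ?case
    proof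
      fix \<eta>
      have "norm (f v \<eta> + g v \<eta>) \<le> norm (f v \<eta>) + norm (g v \<eta>)" by (rule norm_triangle_ineq)
      also have "\<dots> \<le> C * (1 + norm \<eta>) ^ m + D * (1 + norm \<eta>) ^ l"
        using elim by (intro add_mono) auto
      also have "\<dots> \<le> C * (1 + norm \<eta>) ^ (m + l) + D * (1 + norm \<eta>) ^ (m + l)"
        using C D by (intro add_mono mult_left_mono power_increasing) auto
      finally show "norm (f v \<eta> + g v \<eta>) \<le> (C + D) * (1 + norm \<eta>) ^ (m + l)" by (simp add: algebra_simps)
    qed
  qed
  then show "\<exists>C m. 0 \<le> C \<and> (\<forall>\<^sub>F v in nhds u. \<forall>\<eta>. norm (f v \<eta> + g v \<eta>) \<le> C * (1 + norm \<eta>) ^ m)"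
    using C D by (intro exI[of _ "C + D"] exI[of _ "m + l"]) auto
qed

lemma poly_bdd_cong:
  assumes "open U" "poly_bdd U f" "\<And>u \<eta>. u \<in> U \<Longrightarrow> f u \<eta> = g u \<eta>"
  shows "poly_bdd U g"
  unfolding poly_bdd_def
proof
  fix u assume u: "u \<in> U"
  obtain C m where 1: "\<forall>\<^sub>F v in nhds u. \<forall>\<eta>. norm (f v \<eta>) \<le> C * (1 + norm \<eta>) ^ m"
    using assms u unfolding poly_bdd_def by blast
  have 2: "\<forall>\<^sub>F v in nhds u. v \<in> U" using \<open>open U\<close> u by (rule eventually_nhds_in_open)
  have "\<forall>\<^sub>F v in nhds u. \<forall>\<eta>. norm (g v \<eta>) \<le> C * (1 + norm \<eta>) ^ m"
    using 1 2 by eventually_elim (metis assms(3))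
  then show "\<exists>C m. \<forall>\<^sub>F v in nhds u. \<forall>\<eta>. norm (g v \<eta>) \<le> C * (1 + norm \<eta>) ^ m" by blast
qed

lemma moderate_0:
  assumes "moderate n U f" shows "continuous_on (U \<times> UNIV) (\<lambda>(u, \<eta>). f u \<eta>)" "poly_bdd U f" "moderate 0 U f"
  using assms by (cases n; simp)+

lemma frechet_derivative_cong_open:
  assumes "open U" "u \<in> U" "\<And>u. u \<in> U \<Longrightarrow> f u = g u"
  shows "frechet_derivative f (at u) = frechet_derivative g (at u)"
proof -
  have "(f has_derivative D) (at u) \<longleftrightarrow> (g has_derivative D) (at u)" for D
    using has_derivative_transform_within_open[of f D u UNIV U g] 
      has_derivative_transform_within_open[of g D u UNIV U f] assms by auto
  then show ?thesis unfolding frechet_derivative_def by simp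
qed

lemma moderate_cong:
  assumes "open U" "moderate n U f" "\<And>u \<eta>. u \<in> U \<Longrightarrow> f u \<eta> = g u \<eta>"
  shows "moderate n U g"
  using assms(2,3)
proof (induction n arbitrary: f g)
  case 0
  have c: "continuous_on (U \<times> UNIV) (\<lambda>(u, \<eta>). g u \<eta>)"
    using moderate_0(1)[OF "0.prems"(1)] "0.prems"(2)
    by (elim continuous_on_cong[THEN iffD1, rotated 2]) auto
  have p: "poly_bdd U g" using poly_bdd_cong[OF \<open>open U\<close> moderate_0(2)[OF "0.prems"(1)] "0.prems"(2)] .
  show ?case using c p by simp
next
  case (Suc n)
  have fr: "frechet_derivative (\<lambda>u. f u \<eta>) (at u) = frechet_derivative (\<lambda>u. g u \<eta>) (at u)" if "u \<in> U" for u \<eta>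
    by (rule frechet_derivative_cong_open[OF \<open>open U\<close> that]) (rule Suc.prems(2))
  have c: "continuous_on (U \<times> UNIV) (\<lambda>(u, \<eta>). g u \<eta>)"
    using moderate_0(1)[OF Suc.prems(1)] Suc.prems(2)
    by (elim continuous_on_cong[THEN iffD1, rotated 2]) auto
  have p: "poly_bdd U g" using poly_bdd_cong[OF \<open>open U\<close> moderate_0(2)[OF Suc.prems(1)] Suc.prems(2)] .
  have "(\<lambda>u. g u \<eta>) differentiable (at u)" if "u \<in> U" for u \<eta>
  proof -
    have "(\<lambda>u. f u \<eta>) differentiable (at u)" using Suc.prems(1) that by simp
    then obtain D where "((\<lambda>u. f u \<eta>) has_derivative D) (at u)" unfolding differentiable_def by blast
    then have "((\<lambda>u. g u \<eta>) has_derivative D) (at u)"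
      using \<open>open U\<close> that Suc.prems(2) by (rule has_derivative_transform_within_open)
    then show ?thesis unfolding differentiable_def by blast
  qed
  moreover have "moderate n U (\<lambda>u \<eta>. frechet_derivative (\<lambda>u. g u \<eta>) (at u) v)" for v
    by (rule Suc.IH[of "\<lambda>u \<eta>. frechet_derivative (\<lambda>u. f u \<eta>) (at u) v"]) (use Suc.prems(1) fr in auto)
  ultimately show ?case using c p by simp
qed

text \<open>Lets the derivative be supplied as an explicit formula \<open>D\<close>, to which the
  closure lemmas can be applied, instead of as \<open>frechet_derivative\<close>.\<close>

lemma moderate_SucI:
  assumes "open U" "moderate 0 U f"
    and D: "\<And>u \<eta>. u \<in> U \<Longrightarrow> ((\<lambda>u. f u \<eta>) has_derivative D u \<eta>) (at u)"
    and m: "\<And>v. moderate n U (\<lambda>u \<eta>. D u \<eta> v)"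
  shows "moderate (Suc n) U f"
proof -
  have "moderate n U (\<lambda>u \<eta>. frechet_derivative (\<lambda>u. f u \<eta>) (at u) v)" for v
    by (rule moderate_cong[OF \<open>open U\<close> m[of v]]) (use frechet_derivative_at[OF D] in metis)
  moreover have "\<forall>u\<in>U. \<forall>\<eta>. (\<lambda>u. f u \<eta>) differentiable (at u)" using D unfolding differentiable_def by blast
  ultimately show ?thesis using assms(2) by simp
qed

lemma moderate_SucD:
  assumes "moderate (Suc n) U f" "u \<in> U"
  shows "((\<lambda>u. f u \<eta>) has_derivative frechet_derivative (\<lambda>u. f u \<eta>) (at u)) (at u)"
  using assms frechet_derivative_works by (simp add: frechet_derivative_works[symmetric])

lemma moderate_SucD2:
  "moderate (Suc n) U f \<Longrightarrow> moderate n U (\<lambda>u \<eta>. frechet_derivative (\<lambda>u. f u \<eta>) (at u) v)"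
  by simp

lemma moderate_Suc_imp: "moderate (Suc n) U f \<Longrightarrow> moderate n U f"
  by (induction n arbitrary: f) auto

lemma moderate_mono: "moderate n U f \<Longrightarrow> m \<le> n \<Longrightarrow> moderate m U f"
  by (induction n rule: nat_induct) (auto simp: le_Suc_eq simp del: moderate.simps dest: moderate_Suc_imp)

declare moderate.simps(2) [simp del]

text \<open>For functions whose derivative is expressed through themselves: inverses, square roots and the
  implicitly defined saddle point.\<close>

lemma moderate_bootstrap:
  assumes "open U" "moderate 0 U g"
    and "\<And>u \<eta>. u \<in> U \<Longrightarrow> ((\<lambda>u. g u \<eta>) has_derivative D u \<eta>) (at u)"
    and "\<And>n v. Suc n \<le> N \<Longrightarrow> moderate n U g \<Longrightarrow> moderate n U (\<lambda>u \<eta>. D u \<eta> v)"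
  shows "n \<le> N \<Longrightarrow> moderate n U g"
proof (induction n)
  case (Suc n)
  then have "moderate n U g" by simp
  from moderate_SucI[OF assms(1-3) assms(4)[OF Suc.prems this]] show ?case by blast
qed (use assms(2) in simp)

lemma moderate_const_param:
  assumes "open U" "continuous_on UNIV g" "poly_bdd U (\<lambda>u \<eta>. g \<eta>)"
  shows "moderate n U (\<lambda>u \<eta>. g \<eta>)"
proof -
  \<comment> \<open>The zero function comes first, being the derivative of every function that does
    not depend on the parameter.\<close>
  have z: "moderate n U (\<lambda>u \<eta>. 0 :: 'c)" for n
  proof (induction n)
    case 0 then show ?case by (simp add: case_prod_unfold poly_bdd_const)
  next
    case (Suc n)
    show ?case by (rule moderate_SucI[OF \<open>open U\<close>, where D = "\<lambda>_ _ _. 0"]) (use Suc moderate_0(3)[OF Suc] in auto)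
  qed
  have "continuous_on (U \<times> UNIV) (\<lambda>(u, \<eta>). g \<eta>)"
    using assms(2) by (auto simp: case_prod_unfold intro!: continuous_intros continuous_on_compose2[OF assms(2)])
  then have "moderate 0 U (\<lambda>u \<eta>. g \<eta>)" using assms(3) by simp
  then show ?thesis
    by (cases n) (auto intro: moderate_SucI[OF \<open>open U\<close>, where D = "\<lambda>_ _ _. 0"] z simp del: moderate.simps)
qed

lemma moderate_const: "open U \<Longrightarrow> moderate n U (\<lambda>u \<eta>. c)"
  by (rule moderate_const_param) (auto intro: poly_bdd_const)

lemma moderate_bounded_linear_param:
  assumes "open U" "bounded_linear L"
  shows "moderate n U (\<lambda>u \<eta>. L \<eta>)"
proof (rule moderate_const_param[OF \<open>open U\<close>])
  show "continuous_on UNIV L" using assms(2) by (simp add: linear_continuous_on)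
  obtain K where K: "K > 0" "\<And>x. norm (L x) \<le> norm x * K"
    using bounded_linear.pos_bounded[OF assms(2)] by blast
  show "poly_bdd U (\<lambda>u. L)"
  proof (rule poly_bddI)
    have "norm (L \<eta>) \<le> K * (1 + norm \<eta>) ^ 1" for \<eta>
      using K(2)[of \<eta>] K(1) by (simp add: algebra_simps)
    then show "\<exists>C m. 0 \<le> C \<and> (\<forall>\<^sub>F v in nhds u. \<forall>\<eta>. norm (L \<eta>) \<le> C * (1 + norm \<eta>) ^ m)" for u :: 'a
      using K(1) by (intro exI[of _ K] exI[of _ 1]) auto
  qed
qed

lemma moderate_0_indep:
  assumes "open U" "continuous_on U g"
  shows "moderate 0 U (\<lambda>u (\<eta>::'e::euclidean_space). g u)"
proof -
  have "continuous_on (U \<times> UNIV) (\<lambda>(u, \<eta>::'e). g u)"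
    by (auto simp: case_prod_unfold intro!: continuous_on_compose2[OF assms(2)] continuous_intros)
  moreover have "poly_bdd U (\<lambda>u (\<eta>::'e). g u)"
  proof (rule poly_bdd_const_bound)
    fix u assume u: "u \<in> U"
    have "isCont g u" using assms u by (simp add: continuous_on_eq_continuous_at)
    then have "((\<lambda>v. norm (g v)) \<longlongrightarrow> norm (g u)) (nhds u)"
      by (simp add: continuous_at tendsto_norm tendsto_at_iff_tendsto_nhds)
    then have "\<forall>\<^sub>F v in nhds u. norm (g v) < norm (g u) + 1"
      by (rule order_tendstoD) simp
    then show "\<exists>C. \<forall>\<^sub>F v in nhds u. \<forall>\<eta>::'e. norm (g v) \<le> C"
      by (intro exI[of _ "norm (g u) + 1"]) (auto elim: eventually_mono)
  qed
  ultimately show ?thesis by simp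
qed

lemma moderate_bounded_linear_var:
  assumes "open U" "bounded_linear L"
  shows "moderate n U (\<lambda>u \<eta>. L u)"
proof -
  have 0: "moderate 0 U (\<lambda>u \<eta>. L u)"
    by (rule moderate_0_indep[OF \<open>open U\<close> linear_continuous_on[OF assms(2)]])
  show ?thesis
    by (cases n) (auto simp del: moderate.simps intro!: 0 moderate_SucI[OF \<open>open U\<close> 0, where D = "\<lambda>u \<eta>. L"]
        moderate_const[OF \<open>open U\<close>] bounded_linear_imp_has_derivative assms)
qed

lemma moderate_add:
  assumes "open U" "moderate n U f" "moderate n U g"
  shows "moderate n U (\<lambda>u \<eta>. f u \<eta> + g u \<eta>)"
  using assms(2,3)
proof (induction n arbitrary: f g)
  case 0
  then show ?case by (simp add: case_prod_unfold continuous_on_add poly_bdd_add)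
next
  case (Suc n)
  have 0: "moderate 0 U (\<lambda>u \<eta>. f u \<eta> + g u \<eta>)"
    using moderate_0(3)[OF Suc.prems(1)] moderate_0(3)[OF Suc.prems(2)]
    by (simp add: case_prod_unfold continuous_on_add poly_bdd_add)
  show ?case
  proof (rule moderate_SucI[OF \<open>open U\<close> 0, where D = "\<lambda>u \<eta> v. frechet_derivative (\<lambda>u. f u \<eta>) (at u) v + frechet_derivative (\<lambda>u. g u \<eta>) (at u) v"])
    show "moderate n U (\<lambda>u \<eta>. frechet_derivative (\<lambda>u. f u \<eta>) (at u) v + frechet_derivative (\<lambda>u. g u \<eta>) (at u) v)" for v
      by (intro Suc.IH moderate_SucD2 Suc.prems)
  qed (intro has_derivative_add moderate_SucD[OF Suc.prems(1)] moderate_SucD[OF Suc.prems(2)])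
qed

lemma moderate_bilinear:
  assumes "open U" and P: "bounded_bilinear P" and "moderate n U f" "moderate n U g"
  shows "moderate n U (\<lambda>u \<eta>. P (f u \<eta>) (g u \<eta>))"
  using assms(3,4)
proof (induction n arbitrary: f g)
  case 0
  then show ?case
    by (simp add: case_prod_unfold bounded_bilinear.continuous_on[OF P] poly_bdd_bilinear[OF P])
next
  case (Suc n)
  have 0: "moderate 0 U (\<lambda>u \<eta>. P (f u \<eta>) (g u \<eta>))"
    using moderate_0(3)[OF Suc.prems(1)] moderate_0(3)[OF Suc.prems(2)]
    by (simp add: case_prod_unfold bounded_bilinear.continuous_on[OF P] poly_bdd_bilinear[OF P])
  let ?D = "\<lambda>u \<eta> v. P (f u \<eta>) (frechet_derivative (\<lambda>u. g u \<eta>) (at u) v) +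
        P (frechet_derivative (\<lambda>u. f u \<eta>) (at u) v) (g u \<eta>)"
  show ?case
  proof (rule moderate_SucI[OF \<open>open U\<close> 0, where D = ?D])
    show "moderate n U (\<lambda>u \<eta>. ?D u \<eta> v)" for v
      by (intro Suc.IH moderate_add \<open>open U\<close> moderate_SucD2 Suc.prems
          moderate_Suc_imp[OF Suc.prems(1)] moderate_Suc_imp[OF Suc.prems(2)])
  qed (intro bounded_bilinear.FDERIV[OF P] moderate_SucD[OF Suc.prems(1)] moderate_SucD[OF Suc.prems(2)])
qed

lemmas moderate_mult = moderate_bilinear[OF _ bounded_bilinear_mult]
lemmas moderate_scaleR = moderate_bilinear[OF _ bounded_bilinear_scaleR]
lemmas moderate_inner = moderate_bilinear[OF _ bounded_bilinear_inner]

lemma moderate_bounded_linear: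
  assumes "open U" and L: "bounded_linear L" and f: "moderate n U f"
  shows "moderate n U (\<lambda>u \<eta>. L (f u \<eta>))"
proof -
  \<comment> \<open>A linear map is the bilinear map (r, x) -> r L x at the constant r = 1, so the
    product rule covers it.\<close>
  have "bounded_bilinear (\<lambda>(r::real) x. r *\<^sub>R L x)"
    using bounded_bilinear.comp [OF bounded_bilinear_scaleR bounded_linear_ident L] .
  from moderate_bilinear[OF \<open>open U\<close> this moderate_const[OF \<open>open U\<close>, of n 1] f]
  show ?thesis by simp
qed

lemmas moderate_of_real = moderate_bounded_linear[OF _ bounded_linear_of_real]
lemmas moderate_minus = moderate_bounded_linear[OF _ bounded_linear_minus[OF bounded_linear_ident]]

lemma moderate_diff:
  assumes "open U" "moderate n U f" "moderate n U g"
  shows "moderate n U (\<lambda>u \<eta>. f u \<eta> - g u \<eta>)"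
  using moderate_add[OF assms(1,2) moderate_minus[OF assms(1,3)]] by simp

lemma moderate_power:
  fixes f :: "'a::euclidean_space \<Rightarrow> 'e::euclidean_space \<Rightarrow> 'b::real_normed_algebra_1"
  assumes "open U" "moderate n U f"
  shows "moderate n U (\<lambda>u \<eta>. f u \<eta> ^ k)"
  by (induction k) (auto intro: moderate_const moderate_mult assms)

lemma moderate_sum:
  assumes "open U" "finite I" "\<And>i. i \<in> I \<Longrightarrow> moderate n U (f i)"
  shows "moderate n U (\<lambda>u \<eta>. \<Sum>i\<in>I. f i u \<eta>)"
  using assms(2,3) by (induction I) (auto intro: moderate_const moderate_add assms)

lemma away_zeroE:
  assumes "away_zero U f" "u \<in> U"
  obtains c where "c > 0" "\<forall>\<^sub>F v in nhds u. \<forall>\<eta>. c \<le> norm (f v \<eta>)"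
  using assms unfolding away_zero_def by blast

lemma away_zero_nonzero:
  assumes "away_zero U f" "u \<in> U" shows "f u \<eta> \<noteq> 0"
proof -
  obtain c where c: "c > 0" and ev: "\<forall>\<^sub>F v in nhds u. \<forall>\<eta>. c \<le> norm (f v \<eta>)"
    using away_zeroE[OF assms] .
  have "c \<le> norm (f u \<eta>)" using eventually_nhds_x_imp_x[OF ev] by blast
  then show ?thesis using c by auto
qed

text \<open>The lower bound on |f| makes the reciprocal bounded. Its derivative is a product of f'
  with two copies of the reciprocal, so each order of the reciprocal yields the next.\<close>

lemma moderate_inverse:
  fixes f :: "'a::euclidean_space \<Rightarrow> 'e::euclidean_space \<Rightarrow> 'b::real_normed_field"
  assumes "open U" and f: "moderate n U f" and az: "away_zero U f"
  shows "moderate n U (\<lambda>u \<eta>. inverse (f u \<eta>))"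
proof -
  note nz = away_zero_nonzero[OF az]
  have "poly_bdd U (\<lambda>u \<eta>. inverse (f u \<eta>))"
  proof (rule poly_bdd_const_bound)
    fix u assume "u \<in> U"
    then obtain c where c: "c > 0" "\<forall>\<^sub>F v in nhds u. \<forall>\<eta>. c \<le> norm (f v \<eta>)"
      using az unfolding away_zero_def by blast
    show "\<exists>C. \<forall>\<^sub>F v in nhds u. \<forall>\<eta>. norm (inverse (f v \<eta>)) \<le> C"
      using c(2) by (intro exI[of _ "inverse c"], elim eventually_mono)
        (use c(1) in \<open>auto simp: norm_inverse intro!: le_imp_inverse_le\<close>)
  qed
  moreover have "continuous_on (U \<times> UNIV) (\<lambda>(u, \<eta>). inverse (f u \<eta>))"
    using moderate_0(1)[OF f] nz by (auto simp: case_prod_unfold intro!: continuous_intros)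
  ultimately have 0: "moderate 0 U (\<lambda>u \<eta>. inverse (f u \<eta>))" by simp
  show ?thesis
  proof (cases n)
    case (Suc N)
    show ?thesis
    proof (rule moderate_bootstrap[OF \<open>open U\<close> 0, where N = n and
          D = "\<lambda>u \<eta> v. - (inverse (f u \<eta>) * frechet_derivative (\<lambda>u. f u \<eta>) (at u) v * inverse (f u \<eta>))"])
      show "((\<lambda>u. inverse (f u \<eta>)) has_derivative (\<lambda>v. - (inverse (f u \<eta>) * frechet_derivative (\<lambda>u. f u \<eta>) (at u) v * inverse (f u \<eta>)))) (at u)"
        if "u \<in> U" for u \<eta>
        by (rule Deriv.has_derivative_inverse[OF nz[OF that] moderate_SucD[OF f[unfolded Suc] that]])
      show "moderate m U (\<lambda>u \<eta>. - (inverse (f u \<eta>) * frechet_derivative (\<lambda>u. f u \<eta>) (at u) v * inverse (f u \<eta>)))"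
        if "Suc m \<le> n" "moderate m U (\<lambda>u \<eta>. inverse (f u \<eta>))" for m v
      proof -
        have "moderate (Suc m) U f" using f that(1) by (rule moderate_mono)
        then show ?thesis using that(2)
          by (intro moderate_minus moderate_mult \<open>open U\<close> moderate_SucD2)
      qed
    qed simp
  qed (use 0 in simp)
qed

lemma away_zero_csqrt:
  assumes "away_zero U f" shows "away_zero U (\<lambda>u \<eta>. csqrt (f u \<eta>))"
  unfolding away_zero_def
proof
  fix u assume "u \<in> U"
  then obtain c where c: "c > 0" "\<forall>\<^sub>F v in nhds u. \<forall>\<eta>. c \<le> norm (f v \<eta>)"
    using assms unfolding away_zero_def by blast
  show "\<exists>c>0. \<forall>\<^sub>F v in nhds u. \<forall>\<eta>. c \<le> norm (csqrt (f v \<eta>))"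
    using c by (intro exI[of _ "sqrt c"]) (auto elim!: eventually_mono)
qed

text \<open>Positive real part keeps the values of f off the branch cut. The derivative f' / (2
  csqrt f) contains only f' and the reciprocal of the root itself, and that reciprocal is tame
  because |f| stays away from zero.\<close>

lemma moderate_csqrt:
  assumes "open U" and f: "moderate n U f" and az: "away_zero U f"
    and re: "\<And>u \<eta>. u \<in> U \<Longrightarrow> Re (f u \<eta>) > 0"
  shows "moderate n U (\<lambda>u \<eta>. csqrt (f u \<eta>))"
proof -
  have nn: "f u \<eta> \<notin> \<real>\<^sub>\<le>\<^sub>0" if "u \<in> U" for u \<eta>
    using re[OF that, of \<eta>] by (auto simp: complex_nonpos_Reals_iff)
  have p: "poly_bdd U (\<lambda>u \<eta>. csqrt (f u \<eta>))"
  proof (rule poly_bdd_bounded[OF moderate_0(2)[OF f], of 1])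
    fix u \<eta> assume "u \<in> U"
    have "sqrt x \<le> 1 + x" if "x \<ge> 0" for x :: real
      using that by (intro real_le_lsqrt) (auto simp: power2_eq_square algebra_simps)
    then show "norm (csqrt (f u \<eta>)) \<le> 1 * (1 + norm (f u \<eta>))" by simp
  qed (use assms in auto)
  have "continuous_on (U \<times> UNIV) (\<lambda>x. csqrt (case x of (u, \<eta>) \<Rightarrow> f u \<eta>))"
  proof (rule continuous_on_compose2[OF continuous_on_csqrt moderate_0(1)[OF f]])
  qed (use nn in auto)
  then have "moderate 0 U (\<lambda>u \<eta>. csqrt (f u \<eta>))" using p by (simp add: case_prod_unfold)
  note 0 = this
  show ?thesis
  proof (cases n)
    case (Suc N)
    show ?thesis
    proof (rule moderate_bootstrap[OF \<open>open U\<close> 0, where N = n and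
          D = "\<lambda>u \<eta> v. frechet_derivative (\<lambda>u. f u \<eta>) (at u) v * inverse (csqrt (f u \<eta>)) * inverse 2"])
      show "((\<lambda>u. csqrt (f u \<eta>)) has_derivative (\<lambda>v. frechet_derivative (\<lambda>u. f u \<eta>) (at u) v * inverse (csqrt (f u \<eta>)) * inverse 2)) (at u)"
        if "u \<in> U" for u \<eta>
      proof -
        have d: "((\<lambda>u. f u \<eta>) has_derivative frechet_derivative (\<lambda>u. f u \<eta>) (at u)) (at u)"
          using moderate_SucD[OF f[unfolded Suc] that] .
        have "(csqrt has_derivative (*) (inverse (csqrt (f u \<eta>)) * inverse 2)) (at (f u \<eta>))"
          using has_field_derivative_csqrt[OF nn[OF that, of \<eta>]] by (simp add: has_field_derivative_def field_simps)
        from has_derivative_compose[OF d this] show ?thesis by (simp add: mult_ac)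
      qed
      show "moderate m U (\<lambda>u \<eta>. frechet_derivative (\<lambda>u. f u \<eta>) (at u) v * inverse (csqrt (f u \<eta>)) * inverse 2)"
        if "Suc m \<le> n" "moderate m U (\<lambda>u \<eta>. csqrt (f u \<eta>))" for m v
      proof -
        have "moderate (Suc m) U f" using f that(1) by (rule moderate_mono)
        then show ?thesis using that(2)
          by (intro moderate_mult moderate_inverse moderate_const moderate_SucD2 \<open>open U\<close> away_zero_csqrt[OF az])
      qed
    qed simp
  qed (use 0 in simp)
qed

text \<open>A dummy variable \<eta> makes \<open>Ck_on\<close> a special case, so the algebra proved
  for \<open>moderate\<close> also serves functions of the parameter alone, including the finished
  integrals.\<close>

lemma moderate_iff_Ck_on:
  assumes "open U"
  shows "moderate n U (\<lambda>u (\<eta>::'e::euclidean_space). f u) \<longleftrightarrow> Ck_on n f U"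
proof (induction n arbitrary: f)
  case 0
  have "continuous_on U f" if "continuous_on (U \<times> (UNIV::'e set)) (\<lambda>(u, \<eta>). f u)"
    using continuous_on_compose2[OF that, of U "\<lambda>u. (u, 0)"] by (auto simp: continuous_intros)
  then show ?case using moderate_0_indep[OF assms, of f] by auto
next
  case (Suc n)
  show ?case
  proof
    assume L: "moderate (Suc n) U (\<lambda>u (\<eta>::'e). f u)"
    then show "Ck_on (Suc n) f U" using Suc by (auto simp: moderate.simps(2))
  next
    assume R: "Ck_on (Suc n) f U"
    then have "\<forall>u\<in>U. f differentiable (at u)" by simp
    then have "continuous_on U f"
      by (meson continuous_at_imp_continuous_on differentiable_imp_continuous_within)
    then have "moderate 0 U (\<lambda>u (\<eta>::'e). f u)" by (rule moderate_0_indep[OF assms])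
    then show "moderate (Suc n) U (\<lambda>u (\<eta>::'e). f u)"
      using R Suc by (simp add: moderate.simps(2))
  qed
qed

section \<open>Differentiation under the integral sign\<close>

lemma Ck_on_cong:
  assumes "open U" "Ck_on n f U" "\<And>u. u \<in> U \<Longrightarrow> f u = g u"
  shows "Ck_on n g (U::'a::euclidean_space set)"
  using assms(2,3) moderate_cong[OF assms(1), where f = "\<lambda>u (\<eta>::real). f u" and g = "\<lambda>u \<eta>. g u" and n = n]
  by (simp add: moderate_iff_Ck_on assms(1))

lemma Ck_on_SucI:
  assumes "open U" and D: "\<And>u. u \<in> U \<Longrightarrow> (f has_derivative D u) (at u)"
    and m: "\<And>v. Ck_on n (\<lambda>u. D u v) U"
  shows "Ck_on (Suc n) f (U::'a::euclidean_space set)"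
proof -
  have "Ck_on n (\<lambda>u. frechet_derivative f (at u) v) U" for v
    by (rule Ck_on_cong[OF \<open>open U\<close> m[of v]]) (use frechet_derivative_at[OF D] in metis)
  then show ?thesis using differentiableI[OF D] by simp
qed

lemma polynomial_times_exp_le:
  assumes "c > (0::real)"
  obtains K :: real where "K \<ge> 0" "\<And>t. t \<ge> 0 \<Longrightarrow> (1 + t) ^ m * exp (- c * t) \<le> K * exp (- (c / 2) * t)"
proof
  \<comment> \<open>With x = c (1 + t) / 2 a single term of the exponential series gives x^m <= m!
    exp x. \<open>K\<close> collects m!, the rescaling (2 / c)^m and the factor exp (c / 2).\<close>
  define K where "K = fact m * (2 / c) ^ m * exp (c / 2)"
  show "K \<ge> 0" using assms by (simp add: K_def)
  fix t :: real assume t: "t \<ge> 0"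
  define x where "x = c / 2 * (1 + t)"
  have x: "x \<ge> 0" using assms t by (simp add: x_def)
  have "(\<Sum>n\<in>{m}. x ^ n /\<^sub>R fact n) \<le> (\<Sum>n. x ^ n /\<^sub>R fact n)"
    by (rule sum_le_suminf[OF summable_exp_generic]) (use x in auto)
  then have "x ^ m \<le> fact m * exp x" by (simp add: exp_def field_simps)
  then have "(2 / c) ^ m * x ^ m \<le> (2 / c) ^ m * (fact m * exp x)"
    using assms by (intro mult_left_mono) auto
  also have "(2 / c) ^ m * x ^ m = (1 + t) ^ m"
  proof -
    have "2 / c * x = 1 + t" using assms by (simp add: x_def field_simps)
    then show ?thesis unfolding power_mult_distrib[symmetric] by simp
  qed
  finally have "(1 + t) ^ m * exp (- c * t) \<le> (2 / c) ^ m * (fact m * exp x) * exp (- c * t)"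
    by (rule mult_right_mono) simp
  also have "\<dots> = K * exp (- (c / 2) * t)"
    by (simp add: K_def x_def exp_add[symmetric] mult_ac) (simp add: mult_exp_exp field_simps)
  finally show "(1 + t) ^ m * exp (- c * t) \<le> K * exp (- (c / 2) * t)" .
qed

text \<open>On the half line this is the exponential density up to the factor 1 / c; evenness
  supplies the other half.\<close>

lemma integrable_exp_neg_abs:
  assumes "c > (0::real)" shows "integrable lborel (\<lambda>t::real. exp (- c * \<bar>t\<bar>))"
proof -
  have "(\<integral>\<^sup>+t. ennreal (indicator {0..} t *\<^sub>R exp (- c * \<bar>t\<bar>)) \<partial>lborel) =
      (\<integral>\<^sup>+t. ennreal (exponential_density c t) * ennreal (1 / c) \<partial>lborel)"
    using assms by (intro nn_integral_cong) (auto simp: exponential_density_def ennreal_mult'[symmetric] indicator_def mult.commute)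
  also have "\<dots> = ennreal (1 / c)"
    using prob_space.emeasure_space_1[OF prob_space_exponential_density[OF assms]] assms
    by (simp add: nn_integral_multc emeasure_density)
  finally have "has_bochner_integral lborel (\<lambda>t::real. indicator {0..} t *\<^sub>R exp (- c * \<bar>t\<bar>)) (1 / c)"
    using assms by (intro has_bochner_integral_nn_integral) auto
  from has_bochner_integral_even_function[OF this] show ?thesis
    by (simp add: has_bochner_integral_iff)
qed

lemma integrable_exp_neg_norm:
  assumes "c > (0::real)" shows "integrable lborel (\<lambda>t::'e::euclidean_space. exp (- c * norm t))"
proof -
  \<comment> \<open>The rate is split equally among the coordinates: the sum of |t . b| over the
    basis is at most DIM times the norm, so the exponential lies below a product of one-dimensional
    ones.\<close>
  define d where "d = c / DIM('e)"
  have d: "d > 0" using assms by (simp add: d_def)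
  have le: "exp (- c * norm t) \<le> (\<Prod>b\<in>Basis. exp (- d * \<bar>t \<bullet> b\<bar>))" for t :: 'e
  proof -
    have "(\<Sum>b\<in>Basis. \<bar>t \<bullet> b\<bar>) \<le> (\<Sum>b\<in>(Basis::'e set). norm t)"
      by (intro sum_mono Basis_le_norm)
    then have "d * (\<Sum>b\<in>Basis. \<bar>t \<bullet> b\<bar>) \<le> d * (DIM('e) * norm t)"
      using d by (intro mult_left_mono) auto
    also have "\<dots> = c * norm t" by (simp add: d_def)
    finally show ?thesis by (simp add: exp_sum[symmetric] sum_distrib_left sum_negf)
  qed
  have fin: "(\<integral>\<^sup>+t. ennreal (exp (- d * \<bar>t\<bar>)) \<partial>lborel) < \<infinity>"
    using integrable_exp_neg_abs[OF d] by (simp add: integrable_iff_bounded)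
  have "(\<integral>\<^sup>+(t::'e). ennreal (exp (- c * norm t)) \<partial>lborel) \<le>
      (\<integral>\<^sup>+(t::'e). (\<Prod>b\<in>Basis. ennreal (exp (- d * \<bar>t \<bullet> b\<bar>))) \<partial>lborel)"
    using le by (intro nn_integral_mono) (simp add: prod_ennreal ennreal_leI)
  also have "\<dots> = (\<Prod>b\<in>(Basis::'e set). (\<integral>\<^sup>+t. ennreal (exp (- d * \<bar>t\<bar>)) \<partial>lborel))"
    by (rule nn_integral_lborel_prod) auto
  also have "\<dots> < \<infinity>" using fin by (simp add: power_less_top_ennreal)
  finally show ?thesis by (simp add: integrable_iff_bounded)
qed

text \<open>The mean value inequality turns the bound on the derivatives into a Lipschitz bound with
  the same majorant g. This gives integrability of F u near u0 from the bound at u0 alone, and it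
  dominates the difference quotients, so dominated convergence applies along every sequence.\<close>

lemma has_derivative_integral_dominated:
  fixes F :: "'a::euclidean_space \<Rightarrow> 'e::euclidean_space \<Rightarrow> complex"
  assumes r: "r > 0"
    and meas: "\<And>u. u \<in> ball u0 r \<Longrightarrow> F u \<in> borel_measurable borel"
    and measD: "\<And>v. (\<lambda>\<eta>. D u0 \<eta> v) \<in> borel_measurable borel"
    and D: "\<And>u \<eta>. u \<in> ball u0 r \<Longrightarrow> ((\<lambda>u. F u \<eta>) has_derivative D u \<eta>) (at u)"
    and g: "integrable lborel g"
    and F0: "\<And>\<eta>. norm (F u0 \<eta>) \<le> g \<eta>"
    and Dg: "\<And>u \<eta> v. u \<in> ball u0 r \<Longrightarrow> norm (D u \<eta> v) \<le> g \<eta> * norm v"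
  shows "((\<lambda>u. LINT \<eta>|lborel. F u \<eta>) has_derivative (\<lambda>v. LINT \<eta>|lborel. D u0 \<eta> v)) (at u0)"
proof -
  have u0: "u0 \<in> ball u0 r" using r by simp
  have g0: "g \<eta> \<ge> 0" for \<eta> using F0[of \<eta>] norm_ge_zero order_trans by blast
  have lip: "norm (F u \<eta> - F u0 \<eta>) \<le> g \<eta> * norm (u - u0)" if u: "u \<in> ball u0 r" for u \<eta>
  proof (rule differentiable_bound[where S = "ball u0 r" and f' = "\<lambda>u. D u \<eta>"])
    show "((\<lambda>u. F u \<eta>) has_derivative D x \<eta>) (at x within ball u0 r)" if "x \<in> ball u0 r" for x
      using D[OF that] by (rule has_derivative_at_withinI)
    show "onorm (D x \<eta>) \<le> g \<eta>" if "x \<in> ball u0 r" for x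
      by (rule onorm_bound[OF g0 Dg[OF that]])
  qed (use u u0 in auto)
  have intF: "integrable lborel (F u)" if u: "u \<in> ball u0 r" for u
  proof (rule Bochner_Integration.integrable_bound[where f = "\<lambda>\<eta>. (1 + norm (u - u0)) * g \<eta>"])
    show "AE x in lborel. norm (F u x) \<le> norm ((1 + norm (u - u0)) * g x)"
    proof (intro AE_I2)
      fix \<eta>
      have "norm (F u \<eta>) \<le> norm (F u0 \<eta>) + norm (F u \<eta> - F u0 \<eta>)" 
        by (metis add.commute diff_add_cancel norm_triangle_ineq)
      also have "\<dots> \<le> g \<eta> + g \<eta> * norm (u - u0)" using F0 lip[OF u] by (intro add_mono) auto
      also have "\<dots> = norm ((1 + norm (u - u0)) * g \<eta>)" using g0[of \<eta>] by (simp add: algebra_simps abs_mult)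
      finally show "norm (F u \<eta>) \<le> norm ((1 + norm (u - u0)) * g \<eta>)" .
    qed
  qed (use g meas[OF u] in auto)
  have intD: "integrable lborel (\<lambda>\<eta>. D u0 \<eta> v)" for v
  proof (rule Bochner_Integration.integrable_bound[where f = "\<lambda>\<eta>. g \<eta> * norm v"])
    show "AE \<eta> in lborel. norm (D u0 \<eta> v) \<le> norm (g \<eta> * norm v)"
      using Dg[OF u0] g0 by (simp add: abs_mult)
  qed (use g measD in auto)
  have linD: "linear (D u0 \<eta>)" for \<eta> using has_derivative_linear[OF D[OF u0]] .
  have bl: "bounded_linear (\<lambda>v. LINT \<eta>|lborel. D u0 \<eta> v)"
  proof (rule bounded_linear_intro[where K = "LINT \<eta>|lborel. g \<eta>"])
    show "(LINT \<eta>|lborel. D u0 \<eta> (x + y)) = (LINT \<eta>|lborel. D u0 \<eta> x) + (LINT \<eta>|lborel. D u0 \<eta> y)" for x y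
      using linear_add[OF linD] intD by simp
    show "(LINT \<eta>|lborel. D u0 \<eta> (s *\<^sub>R x)) = s *\<^sub>R (LINT \<eta>|lborel. D u0 \<eta> x)" for s x
      using linear_scale[OF linD] by simp
    show "norm (LINT \<eta>|lborel. D u0 \<eta> x) \<le> norm x * (LINT \<eta>|lborel. g \<eta>)" for x
    proof -
      have "norm (LINT \<eta>|lborel. D u0 \<eta> x) \<le> (LINT \<eta>|lborel. g \<eta> * norm x)"
        by (rule Bochner_Integration.integral_norm_bound_integral[OF intD]) (use g Dg[OF u0] in auto)
      then show ?thesis by (simp add: mult.commute)
    qed
  qed
  show ?thesis
    unfolding has_derivative_at
  proof (intro conjI bl)
    show "(\<lambda>h. norm ((LINT \<eta>|lborel. F (u0 + h) \<eta>) - (LINT \<eta>|lborel. F u0 \<eta>) - (LINT \<eta>|lborel. D u0 \<eta> h)) / norm h) \<midarrow>0\<rightarrow> 0"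
      unfolding tendsto_at_iff_sequentially comp_def
    proof (intro allI impI)
      fix X :: "nat \<Rightarrow> 'a" assume X0: "\<forall>i. X i \<in> UNIV - {0}" and X: "X \<longlonglongrightarrow> 0"
      \<comment> \<open>Set to zero while u0 + X n lies outside the ball, so that the majorant 2 g
        holds for all n and not only eventually.\<close>
      define s where "s n \<eta> = (if norm (X n) < r then inverse (norm (X n)) *\<^sub>R (F (u0 + X n) \<eta> - F u0 \<eta> - D u0 \<eta> (X n)) else 0)" for n \<eta>
      have ev: "\<forall>\<^sub>F n in sequentially. norm (X n) < r"
        using X r by (metis (mono_tags) eventually_mono tendsto_norm_zero order_tendstoD(2))
      have lim: "(\<lambda>n. s n \<eta>) \<longlonglongrightarrow> 0" for \<eta>
      proof -
        have "(\<lambda>h. norm (F (u0 + h) \<eta> - F u0 \<eta> - D u0 \<eta> h) / norm h) \<midarrow>0\<rightarrow> 0"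
          using D[OF u0, of \<eta>] unfolding has_derivative_at by blast
        then have "(\<lambda>n. norm (F (u0 + X n) \<eta> - F u0 \<eta> - D u0 \<eta> (X n)) / norm (X n)) \<longlonglongrightarrow> 0"
          using X X0 unfolding tendsto_at_iff_sequentially comp_def by blast
        then show ?thesis
          by (rule Lim_null_comparison[rotated]) (auto simp: s_def divide_inverse mult.commute)
      qed
      have "(\<lambda>n. LINT \<eta>|lborel. s n \<eta>) \<longlonglongrightarrow> (LINT (\<eta>::'e)|lborel. (0::complex))"
      proof (rule integral_dominated_convergence[where w = "\<lambda>\<eta>. 2 * g \<eta>"])
        show "s n \<in> borel_measurable lborel" for n
          using meas[of "u0 + X n"] meas[OF u0] measD[of "X n"]
          by (cases "norm (X n) < r") (simp_all add: s_def[abs_def] dist_norm)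
        show "AE x in lborel. norm (s n x) \<le> 2 * g x" for n
        proof (intro AE_I2)
          fix \<eta>
          show "norm (s n \<eta>) \<le> 2 * g \<eta>"
          proof (cases "norm (X n) < r")
            case True
            have "norm (F (u0 + X n) \<eta> - F u0 \<eta> - D u0 \<eta> (X n)) \<le> g \<eta> * norm (X n) + g \<eta> * norm (X n)"
              using lip[of "u0 + X n" \<eta>] Dg[OF u0, of \<eta> "X n"] True
                norm_triangle_ineq4[of "F (u0 + X n) \<eta> - F u0 \<eta>" "D u0 \<eta> (X n)"]
              by (simp add: dist_norm)
            moreover have "norm (s n \<eta>) = norm (F (u0 + X n) \<eta> - F u0 \<eta> - D u0 \<eta> (X n)) / norm (X n)"
              using True by (simp add: s_def divide_inverse mult.commute)
            ultimately show ?thesis using X0 by (simp add: divide_le_eq algebra_simps)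
          qed (use g0 in \<open>simp add: s_def\<close>)
        qed
      qed (use g lim in auto)
      then have "(\<lambda>n. norm (LINT \<eta>|lborel. s n \<eta>)) \<longlonglongrightarrow> 0"
        by (simp add: tendsto_norm_zero)
      then show "(\<lambda>n. norm ((LINT \<eta>|lborel. F (u0 + X n) \<eta>) - (LINT \<eta>|lborel. F u0 \<eta>) - (LINT \<eta>|lborel. D u0 \<eta> (X n))) / norm (X n)) \<longlonglongrightarrow> 0"
      proof (rule Lim_transform_eventually)
        show "\<forall>\<^sub>F n in sequentially. norm (LINT \<eta>|lborel. s n \<eta>) = norm ((LINT \<eta>|lborel. F (u0 + X n) \<eta>) - (LINT \<eta>|lborel. F u0 \<eta>) - (LINT \<eta>|lborel. D u0 \<eta> (X n))) / norm (X n)"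
          using ev
        proof eventually_elim
          case (elim n)
          then have "(LINT \<eta>|lborel. s n \<eta>) = inverse (norm (X n)) *\<^sub>R ((LINT \<eta>|lborel. F (u0 + X n) \<eta>) - (LINT \<eta>|lborel. F u0 \<eta>) - (LINT \<eta>|lborel. D u0 \<eta> (X n)))"
            using intF[of "u0 + X n"] intF[OF u0] intD[of "X n"]
            by (simp add: s_def dist_norm)
          then show ?case by (simp add: divide_inverse mult.commute)
        qed
      qed
    qed
  qed
qed

text \<open>Linear growth is what remains on the shifted plane and, for \<epsilon> different from 0,
  in the rescaled phase; it is enough against polynomial factors.\<close>

definition coercive :: "'a::real_normed_vector set \<Rightarrow> ('a \<Rightarrow> 'e::real_normed_vector \<Rightarrow> complex) \<Rightarrow> bool" where
  "coercive U \<Psi> \<longleftrightarrow> (\<forall>u\<in>U. \<exists>c>0. \<exists>C. \<forall>\<^sub>F v in nhds u. \<forall>\<eta>. Re (\<Psi> v \<eta>) \<ge> c * norm \<eta> - C)"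

text \<open>Half of the exponential rate is spent on the polynomial factor.\<close>

lemma coercive_dominated:
  fixes f :: "'a::real_normed_vector \<Rightarrow> 'e::real_normed_vector \<Rightarrow> 'b::real_normed_vector"
  assumes "coercive U \<Psi>" "poly_bdd U f" "u \<in> U"
  obtains c K where "c > 0" "K \<ge> 0"
    "\<forall>\<^sub>F v in nhds u. \<forall>\<eta>. norm (exp (- \<Psi> v \<eta>)) * norm (f v \<eta>) \<le> K * exp (- c * norm \<eta>)"
proof -
  obtain c C where c: "c > 0" and 1: "\<forall>\<^sub>F v in nhds u. \<forall>\<eta>. Re (\<Psi> v \<eta>) \<ge> c * norm \<eta> - C"
    using assms(1,3) unfolding coercive_def by blast
  obtain B m where B: "B \<ge> 0" and 2: "\<forall>\<^sub>F v in nhds u. \<forall>\<eta>. norm (f v \<eta>) \<le> B * (1 + norm \<eta>) ^ m"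
    using poly_bddE[OF assms(2,3)] .
  obtain K :: real where K: "K \<ge> 0" "\<And>t. t \<ge> 0 \<Longrightarrow> (1 + t) ^ m * exp (- c * t) \<le> K * exp (- (c / 2) * t)"
    using polynomial_times_exp_le[OF c, where m = m] by blast
  have "\<forall>\<^sub>F v in nhds u. \<forall>\<eta>. norm (exp (- \<Psi> v \<eta>)) * norm (f v \<eta>) \<le> (B * K * exp C) * exp (- (c / 2) * norm \<eta>)"
    using 1 2
  proof eventually_elim
    case (elim v)
    show ?case
    proof
      fix \<eta>
      have "norm (exp (- \<Psi> v \<eta>)) * norm (f v \<eta>) \<le> exp (C - c * norm \<eta>) * (B * (1 + norm \<eta>) ^ m)"
        using elim(2) spec[OF elim(1), of \<eta>] by (intro mult_mono) (auto simp: norm_exp_eq_Re)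
      also have "\<dots> = (B * exp C) * ((1 + norm \<eta>) ^ m * exp (- c * norm \<eta>))"
        by (simp add: exp_diff exp_minus field_simps)
      also have "\<dots> \<le> (B * exp C) * (K * exp (- (c / 2) * norm \<eta>))"
        using B K(2)[of "norm \<eta>"] by (intro mult_left_mono) auto
      finally show "norm (exp (- \<Psi> v \<eta>)) * norm (f v \<eta>) \<le> (B * K * exp C) * exp (- (c / 2) * norm \<eta>)"
        by (simp add: mult_ac)
    qed
  qed
  then show ?thesis using that[of "c / 2" "B * K * exp C"] c B K(1) by simp
qed

lemma continuous_on_section:
  assumes "continuous_on (U \<times> UNIV) (\<lambda>(u, \<eta>). f u \<eta>)" "u \<in> U"
  shows "continuous_on UNIV (f u)"
  using continuous_on_compose2[OF assms(1), of UNIV "\<lambda>\<eta>. (u, \<eta>)"] assms(2) by (auto simp: continuous_intros)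

lemma moderate_measurable:
  assumes "moderate n U f" "u \<in> U"
  shows "f u \<in> borel_measurable borel"
  using continuous_on_section[OF moderate_0(1)[OF assms(1)] assms(2)]
  by (rule borel_measurable_continuous_onI)

lemma poly_bdd_sum:
  assumes "finite I" "\<And>i. i \<in> I \<Longrightarrow> poly_bdd U (f i)"
  shows "poly_bdd U (\<lambda>u \<eta>. \<Sum>i\<in>I. f i u \<eta>)"
  using assms by (induction I) (auto intro: poly_bdd_const poly_bdd_add)

lemma has_derivative_laplace:
  fixes f :: "'a::euclidean_space \<Rightarrow> 'e::euclidean_space \<Rightarrow> complex"
  assumes U: "open U" and \<Psi>: "moderate (Suc 0) U \<Psi>" and co: "coercive U \<Psi>" and f: "moderate (Suc 0) U f" and u: "u \<in> U"
  shows "((\<lambda>u. LINT \<eta>|lborel. exp (- \<Psi> u \<eta>) * f u \<eta>) has_derivative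
     (\<lambda>v. LINT \<eta>|lborel. exp (- \<Psi> u \<eta>) *
        (frechet_derivative (\<lambda>u. f u \<eta>) (at u) v - f u \<eta> * frechet_derivative (\<lambda>u. \<Psi> u \<eta>) (at u) v))) (at u)"
proof -
  define G where "G v = (\<lambda>u \<eta>. frechet_derivative (\<lambda>u. f u \<eta>) (at u) v - f u \<eta> * frechet_derivative (\<lambda>u. \<Psi> u \<eta>) (at u) v)" for v
  define D where "D = (\<lambda>u \<eta> v. exp (- \<Psi> u \<eta>) * G v u \<eta>)"
  have G: "moderate 0 U (G v)" for v
    unfolding G_def by (intro moderate_diff moderate_mult U moderate_SucD2 \<Psi> f moderate_Suc_imp[OF f])
  have FD: "((\<lambda>u. exp (- \<Psi> u \<eta>) * f u \<eta>) has_derivative D u \<eta>) (at u)" if "u \<in> U" for u \<eta>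
  proof -
    have "(exp has_derivative (*) (exp (- \<Psi> u \<eta>))) (at (- \<Psi> u \<eta>))"
      using DERIV_exp by (simp add: has_field_derivative_def)
    from has_derivative_mult[OF has_derivative_compose[OF has_derivative_minus[OF moderate_SucD[OF \<Psi> that, of \<eta>]] this] moderate_SucD[OF f that, of \<eta>]]
    show ?thesis by (rule has_derivative_eq_rhs) (simp add: D_def G_def fun_eq_iff algebra_simps)
  qed
  \<comment> \<open>One majorant has to serve all directions v; linearity in v reduces this to the
    finitely many basis directions.\<close>
  define h where "h u \<eta> = norm (f u \<eta>) + (\<Sum>b\<in>Basis. norm (G b u \<eta>))" for u \<eta>
  have nm: "poly_bdd U (\<lambda>u \<eta>. norm (g u \<eta>))" if "poly_bdd U g" for g :: "'a \<Rightarrow> 'e \<Rightarrow> complex"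
    by (rule poly_bdd_bounded[OF that, of 1]) (use U in auto)
  have "poly_bdd U h"
    unfolding h_def
    by (intro poly_bdd_add poly_bdd_sum nm moderate_0(2)[OF f] moderate_0(2)[OF G] finite_Basis)
  from coercive_dominated[OF co this u] obtain c K where c: "c > 0" "K \<ge> 0" and 
    1: "\<forall>\<^sub>F v in nhds u. \<forall>\<eta>. norm (exp (- \<Psi> v \<eta>)) * norm (h v \<eta>) \<le> K * exp (- c * norm \<eta>)" .
  have "\<forall>\<^sub>F v in nhds u. v \<in> U" using U u by (rule eventually_nhds_in_open)
  with 1 have "\<forall>\<^sub>F v in nhds u. v \<in> U \<and> (\<forall>\<eta>. norm (exp (- \<Psi> v \<eta>)) * norm (h v \<eta>) \<le> K * exp (- c * norm \<eta>))"
    by eventually_elim blast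
  then obtain r where r: "r > 0" and
    rb: "\<And>v. v \<in> ball u r \<Longrightarrow> v \<in> U" "\<And>v \<eta>. v \<in> ball u r \<Longrightarrow> norm (exp (- \<Psi> v \<eta>)) * norm (h v \<eta>) \<le> K * exp (- c * norm \<eta>)"
    unfolding eventually_nhds_metric by (auto simp: dist_commute)
  have h0: "norm (h v \<eta>) = h v \<eta>" for v \<eta> unfolding h_def by (simp add: sum_nonneg)
  have "((\<lambda>u. LINT \<eta>|lborel. exp (- \<Psi> u \<eta>) * f u \<eta>) has_derivative (\<lambda>v. LINT \<eta>|lborel. D u \<eta> v)) (at u)"
  proof (rule has_derivative_integral_dominated[OF r, where g = "\<lambda>\<eta>. K * exp (- c * norm \<eta>)"])
    show "(\<lambda>\<eta>. exp (- \<Psi> v \<eta>) * f v \<eta>) \<in> borel_measurable borel" if "v \<in> ball u r" for v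
      using moderate_measurable[OF \<Psi> rb(1)[OF that]] moderate_measurable[OF f rb(1)[OF that]] by simp
    show "(\<lambda>\<eta>. D u \<eta> v) \<in> borel_measurable borel" for v
      using moderate_measurable[OF \<Psi> u] moderate_measurable[OF G u] by (simp add: D_def)
    show "((\<lambda>u. exp (- \<Psi> u \<eta>) * f u \<eta>) has_derivative D v \<eta>) (at v)" if "v \<in> ball u r" for v \<eta>
      using FD rb(1)[OF that] .
    show "integrable lborel (\<lambda>\<eta>::'e. K * exp (- c * norm \<eta>))" using integrable_exp_neg_norm[OF c(1)] by auto
    show "norm (exp (- \<Psi> u \<eta>) * f u \<eta>) \<le> K * exp (- c * norm \<eta>)" for \<eta>
    proof -
      have "norm (exp (- \<Psi> u \<eta>)) * norm (f u \<eta>) \<le> norm (exp (- \<Psi> u \<eta>)) * norm (h u \<eta>)"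
        unfolding h0 by (rule mult_left_mono) (auto simp: h_def sum_nonneg)
      also have "\<dots> \<le> K * exp (- c * norm \<eta>)" by (rule rb(2)) (use r in simp)
      finally show ?thesis by (simp add: norm_mult)
    qed
    show "norm (D w \<eta> v) \<le> K * exp (- c * norm \<eta>) * norm v" if w: "w \<in> ball u r" for w \<eta> v
    proof -
      have lin: "linear (D w \<eta>)" using has_derivative_linear[OF FD[OF rb(1)[OF w]]] .
      have "D w \<eta> v = D w \<eta> (\<Sum>b\<in>Basis. (v \<bullet> b) *\<^sub>R b)" by (simp add: euclidean_representation)
      also have "\<dots> = (\<Sum>b\<in>Basis. (v \<bullet> b) *\<^sub>R D w \<eta> b)" by (simp add: linear_sum[OF lin] linear_scale[OF lin])
      finally have "norm (D w \<eta> v) \<le> (\<Sum>b\<in>Basis. norm ((v \<bullet> b) *\<^sub>R D w \<eta> b))"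
        by (simp only: norm_sum)
      also have "\<dots> \<le> (\<Sum>b\<in>Basis. norm v * (norm (exp (- \<Psi> w \<eta>)) * norm (G b w \<eta>)))"
        by (intro sum_mono) (auto simp: D_def norm_mult intro!: mult_mono Basis_le_norm)
      also have "\<dots> = norm v * (norm (exp (- \<Psi> w \<eta>)) * (\<Sum>b\<in>Basis. norm (G b w \<eta>)))"
        by (simp add: sum_distrib_left)
      also have "\<dots> \<le> norm v * (norm (exp (- \<Psi> w \<eta>)) * norm (h w \<eta>))"
        unfolding h0 by (intro mult_left_mono) (auto simp: h_def)
      also have "\<dots> \<le> norm v * (K * exp (- c * norm \<eta>))"
        by (intro mult_left_mono rb(2) w) auto
      finally show ?thesis by (simp add: mult_ac)
    qed
  qed
  then show ?thesis unfolding D_def G_def .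
qed

text \<open>The derivative is an integral of the same shape with amplitude f' - f \<Psi>', which is
  moderate again; hence an induction on n with f arbitrary.\<close>

lemma Ck_on_laplace:
  fixes f :: "'a::euclidean_space \<Rightarrow> 'e::euclidean_space \<Rightarrow> complex"
  assumes U: "open U" and \<Psi>: "\<And>n. moderate n U \<Psi>" and co: "coercive U \<Psi>" and f: "\<And>n. moderate n U f"
  shows "Ck_on n (\<lambda>u. LINT \<eta>|lborel. exp (- \<Psi> u \<eta>) * f u \<eta>) U"
  using f
proof (induction n arbitrary: f)
  case 0
  have "continuous (at u) (\<lambda>u. LINT \<eta>|lborel. exp (- \<Psi> u \<eta>) * f u \<eta>)" if "u \<in> U" for u
    using has_derivative_continuous[OF has_derivative_laplace[OF U \<Psi> co 0 that]] .
  then show ?case using continuous_at_imp_continuous_on by auto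
next
  case (Suc n)
  show ?case
  proof (rule Ck_on_SucI[OF U has_derivative_laplace[OF U \<Psi> co Suc.prems]])
    show "Ck_on n (\<lambda>u. LINT \<eta>|lborel. exp (- \<Psi> u \<eta>) *
        (frechet_derivative (\<lambda>u. f u \<eta>) (at u) v - f u \<eta> * frechet_derivative (\<lambda>u. \<Psi> u \<eta>) (at u) v)) U" for v
      by (rule Suc.IH[of "\<lambda>u \<eta>. frechet_derivative (\<lambda>u. f u \<eta>) (at u) v - f u \<eta> * frechet_derivative (\<lambda>u. \<Psi> u \<eta>) (at u) v"])
        (intro moderate_diff moderate_mult U moderate_SucD2 \<Psi> Suc.prems)
  qed
qed

section \<open>Gaussian integrals\<close>

lemma gauss_antiderivative:
  obtains G :: "real \<Rightarrow> real" and L :: real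
  where "\<And>x. (G has_real_derivative exp (- x\<^sup>2)) (at x)" "(G \<longlongrightarrow> L + sqrt pi) at_top" "(G \<longlongrightarrow> L) at_bot"
proof -
  obtain G0 :: "real \<Rightarrow> real" where G0: "\<And>x. (G0 has_vector_derivative exp (- x\<^sup>2)) (at x)"
    using einterval_antiderivative[of "-\<infinity>" "\<infinity>" "\<lambda>x::real. exp (- x\<^sup>2)"] by (auto simp: continuous_intros)
  \<comment> \<open>Normalised to vanish at 0, so that G is odd and the half-line Gaussian integral
    gives both limits.\<close>
  define G where "G x = G0 x - G0 0" for x
  have G: "(G has_real_derivative exp (- x\<^sup>2)) (at x)" for x
    using G0[of x] unfolding G_def has_real_derivative_iff_has_vector_derivative
    by (auto intro!: derivative_eq_intros)
  have int: "(\<integral>x. indicator {..y} x *\<^sub>R (indicator {0..} x *\<^sub>R exp (- x\<^sup>2)) \<partial>lborel) = G y" if "y \<ge> 0" for y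
  proof -
    have "(\<integral>x. exp (- x\<^sup>2) * indicator {0..y} x \<partial>lborel) = G y - G 0"
      using that by (intro integral_FTC_Icc_real) (auto intro!: G)
    moreover have "(\<lambda>x. indicator {..y} x *\<^sub>R (indicator {0..} x *\<^sub>R exp (- x\<^sup>2))) = (\<lambda>x. exp (- x\<^sup>2) * indicator {0..y} x :: real)"
      by (auto simp: fun_eq_iff indicator_def)
    ultimately show ?thesis by (simp add: G_def)
  qed
  have top: "(G \<longlongrightarrow> sqrt pi / 2) at_top"
  proof (rule Lim_transform_eventually)
    show "((\<lambda>y. \<integral>x. indicator {..y} x *\<^sub>R (indicator {0..} x *\<^sub>R exp (- x\<^sup>2)) \<partial>lborel) \<longlongrightarrow> sqrt pi / 2) at_top"
      using tendsto_integral_at_top[of lborel "\<lambda>x. indicator {0..} x *\<^sub>R exp (- x\<^sup>2) :: real"] gaussian_moment_0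
      unfolding has_bochner_integral_iff by (simp del: real_scaleR_def)
    show "\<forall>\<^sub>F y in at_top. (\<integral>x. indicator {..y} x *\<^sub>R (indicator {0..} x *\<^sub>R exp (- x\<^sup>2)) \<partial>lborel) = G y"
      using eventually_ge_at_top[of 0] by eventually_elim (rule int)
  qed
  have odd: "G (- x) = - G x" for x
  proof -
    have "((\<lambda>x. G x + G (- x)) has_real_derivative 0) (at x)" for x
      by (rule derivative_eq_intros G DERIV_chain2[of G _ uminus] refl)+ simp
    then have "G x + G (- x) = G 0 + G (- 0)"
      using DERIV_isconst_all[of "\<lambda>x. G x + G (- x)" x 0] by auto
    then show ?thesis by (simp add: G_def)
  qed
  have "((\<lambda>x. - G (- x)) \<longlongrightarrow> - (sqrt pi / 2)) at_bot"
    by (intro tendsto_minus filterlim_compose[OF top] filterlim_uminus_at_top_at_bot)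
  then have "(G \<longlongrightarrow> - (sqrt pi / 2)) at_bot" using odd by simp
  then show ?thesis using that[of G "- (sqrt pi / 2)"] G top by (simp add: field_simps)
qed

text \<open>With \<open>G\<close> an antiderivative of \<open>exp (- x\<^sup>2)\<close>, both integrals are read off from the boundary values of
  \<open>G (\<alpha> s - \<beta> / s)\<close> and \<open>G (\<alpha> s + \<beta> / s)\<close>.\<close>

lemma schloemilch:
  fixes \<alpha> \<beta> :: real
  assumes \<alpha>: "\<alpha> > 0" and \<beta>: "\<beta> > 0"
  shows "has_bochner_integral lborel (\<lambda>s. indicator {0<..} s * exp (- (\<alpha>\<^sup>2 * s\<^sup>2) - \<beta>\<^sup>2 / s\<^sup>2)) (sqrt pi / (2 * \<alpha>) * exp (- 2 * \<alpha> * \<beta>))" (is ?A)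
    and "has_bochner_integral lborel (\<lambda>s. indicator {0<..} s * (exp (- (\<alpha>\<^sup>2 * s\<^sup>2) - \<beta>\<^sup>2 / s\<^sup>2) / s\<^sup>2)) (sqrt pi / (2 * \<beta>) * exp (- 2 * \<alpha> * \<beta>))" (is ?B)
proof -
  obtain G :: "real \<Rightarrow> real" and L :: real where G: "\<And>x. (G has_real_derivative exp (- x\<^sup>2)) (at x)"
    and top: "(G \<longlongrightarrow> L + sqrt pi) at_top" and bot: "(G \<longlongrightarrow> L) at_bot"
    using gauss_antiderivative by blast
  define e where "e s = exp (- (\<alpha> * s - \<beta> / s)\<^sup>2)" for s
  \<comment> \<open>(\<alpha> s + \<beta> / s)^2 and (\<alpha> s - \<beta> / s)^2 differ by the
    constant 4 \<alpha> \<beta>, so both substitutions involve the same function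
    \<open>e\<close>.\<close>
  have e_eq: "exp (- (\<alpha> * s + \<beta> / s)\<^sup>2) = exp (- 4 * \<alpha> * \<beta>) * e s" if "s > 0" for s
    using that unfolding e_def exp_add[symmetric] by (simp add: power2_eq_square field_simps)
  have pos: "0 < x" if "0 < ereal x" for x using that by simp
  have cont_e: "isCont e x" if "x > 0" for x unfolding e_def using that by (auto intro!: continuous_intros)
  define f1 where "f1 s = e s * (\<alpha> + \<beta> / s\<^sup>2)" for s
  define f2 where "f2 s = e s * (\<alpha> - \<beta> / s\<^sup>2)" for s
  have D1: "((\<lambda>s. G (\<alpha> * s - \<beta> / s)) has_real_derivative f1 s) (at s)" if "s > 0" for s
  proof -
    have "((\<lambda>s. \<alpha> * s - \<beta> / s) has_real_derivative \<alpha> + \<beta> / s\<^sup>2) (at s)"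
      using that by (auto intro!: derivative_eq_intros simp: power2_eq_square)
    from DERIV_chain2[OF G this] show ?thesis by (simp add: f1_def e_def)
  qed
  have D2: "((\<lambda>s. exp (4 * \<alpha> * \<beta>) * G (\<alpha> * s + \<beta> / s)) has_real_derivative f2 s) (at s)" if "s > 0" for s
  proof -
    have "((\<lambda>s. \<alpha> * s + \<beta> / s) has_real_derivative \<alpha> - \<beta> / s\<^sup>2) (at s)"
      using that by (auto intro!: derivative_eq_intros simp: power2_eq_square)
    from DERIV_cmult[OF DERIV_chain2[OF G this], of "exp (4 * \<alpha> * \<beta>)"] show ?thesis
      unfolding f2_def e_eq[OF that] by (simp add: exp_minus mult_ac)
  qed
  have l1: "filterlim (\<lambda>s. \<alpha> * s - \<beta> / s) at_bot (at_right 0)" using \<alpha> \<beta> by real_asymp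
  have l2: "filterlim (\<lambda>s. \<alpha> * s - \<beta> / s) at_top at_top" using \<alpha> \<beta> by real_asymp
  have l3: "filterlim (\<lambda>s. \<alpha> * s + \<beta> / s) at_top (at_right 0)" using \<alpha> \<beta> by real_asymp
  have l4: "filterlim (\<lambda>s. \<alpha> * s + \<beta> / s) at_top at_top" using \<alpha> \<beta> by real_asymp
  have ei: "einterval 0 \<infinity> = {0<..}" by (auto simp: einterval_def)
  note FTC = interval_integral_FTC_nonneg[where a = 0 and b = "\<infinity>" and F = "\<lambda>s. G (\<alpha> * s - \<beta> / s)" and f = f1 and A = L and B = "L + sqrt pi"]
  have c1: "(0::ereal) < \<infinity>" by simp
  have c2: "((\<lambda>s. G (\<alpha> * s - \<beta> / s)) has_real_derivative f1 x) (at x)" if "0 < ereal x" "ereal x < \<infinity>" for x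
    using D1[OF pos[OF that(1)]] .
  have c3: "isCont f1 x" if "0 < ereal x" "ereal x < \<infinity>" for x
    unfolding f1_def using pos[OF that(1)] cont_e by (auto intro!: continuous_intros)
  have c4: "AE x in lborel. 0 < ereal x \<longrightarrow> ereal x < \<infinity> \<longrightarrow> 0 \<le> f1 x"
    using \<alpha> \<beta> by (auto simp: f1_def e_def)
  have c5: "(((\<lambda>s. G (\<alpha> * s - \<beta> / s)) \<circ> real_of_ereal) \<longlongrightarrow> L) (at_right 0)"
    unfolding zero_ereal_def ereal_tendsto_simps by (rule filterlim_compose[OF bot l1])
  have c6: "(((\<lambda>s. G (\<alpha> * s - \<beta> / s)) \<circ> real_of_ereal) \<longlongrightarrow> L + sqrt pi) (at_left \<infinity>)"
    unfolding ereal_tendsto_simps by (rule filterlim_compose[OF top l2])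
  have I1: "set_integrable lborel {0<..} f1" and E1: "(LBINT x=0..\<infinity>. f1 x) = (L + sqrt pi) - L"
    using FTC[OF c1 c2 c3 c4 c5 c6] unfolding ei by blast+
  have meas: "e \<in> borel_measurable borel" unfolding e_def by measurable
  \<comment> \<open>Both summands of \<open>f1\<close> are nonnegative on the half line, so each is
    dominated by the integrable sum.\<close>
  have Ie: "set_integrable lborel {0<..} e"
  proof (rule set_integrable_bound[OF set_integrable_mult_right[OF I1, of "1 / \<alpha>"]])
    show "AE s in lborel. s \<in> {0<..} \<longrightarrow> norm (e s) \<le> norm (1 / \<alpha> * f1 s)"
      using \<alpha> \<beta> by (auto simp: f1_def e_def algebra_simps abs_mult)
  qed (use meas in \<open>auto simp: set_borel_measurable_def\<close>)
  have Iq: "set_integrable lborel {0<..} (\<lambda>s. e s / s\<^sup>2)"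
  proof (rule set_integrable_bound[OF set_integrable_mult_right[OF I1, of "1 / \<beta>"]])
    show "AE s in lborel. s \<in> {0<..} \<longrightarrow> norm (e s / s\<^sup>2) \<le> norm (1 / \<beta> * f1 s)"
      using \<alpha> \<beta> by (auto simp: f1_def e_def algebra_simps abs_mult)
  qed (use meas in \<open>auto simp: set_borel_measurable_def\<close>)
  have f1e: "f1 = (\<lambda>s. \<alpha> * e s + \<beta> * (e s / s\<^sup>2))" by (auto simp: f1_def algebra_simps)
  have f2e: "f2 = (\<lambda>s. \<alpha> * e s - \<beta> * (e s / s\<^sup>2))" by (auto simp: f2_def algebra_simps)
  have I2: "set_integrable lborel {0<..} f2"
    unfolding f2e by (intro set_integral_diff(1) set_integrable_mult_right Ie Iq)
  \<comment> \<open>\<alpha> s + \<beta> / s tends to infinity at both ends, so the boundary values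
    coincide and the integral is zero.\<close>
  have E2: "(LBINT x=0..\<infinity>. f2 x) = exp (4 * \<alpha> * \<beta>) * (L + sqrt pi) - exp (4 * \<alpha> * \<beta>) * (L + sqrt pi)"
  proof (rule interval_integral_FTC_integrable[where F = "\<lambda>s. exp (4 * \<alpha> * \<beta>) * G (\<alpha> * s + \<beta> / s)"])
    show "isCont f2 x" if "0 < ereal x" for x
      unfolding f2_def using pos[OF that] cont_e by (auto intro!: continuous_intros)
    show "set_integrable lborel (einterval 0 \<infinity>) f2" unfolding ei by (rule I2)
    show "(((\<lambda>s. exp (4 * \<alpha> * \<beta>) * G (\<alpha> * s + \<beta> / s)) \<circ> real_of_ereal) \<longlongrightarrow> exp (4 * \<alpha> * \<beta>) * (L + sqrt pi)) (at_right 0)"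
      unfolding zero_ereal_def ereal_tendsto_simps by (intro tendsto_intros filterlim_compose[OF top l3])
    show "(((\<lambda>s. exp (4 * \<alpha> * \<beta>) * G (\<alpha> * s + \<beta> / s)) \<circ> real_of_ereal) \<longlongrightarrow> exp (4 * \<alpha> * \<beta>) * (L + sqrt pi)) (at_left \<infinity>)"
      unfolding ereal_tendsto_simps by (intro tendsto_intros filterlim_compose[OF top l4])
    show "((\<lambda>s. exp (4 * \<alpha> * \<beta>) * G (\<alpha> * s + \<beta> / s)) has_vector_derivative f2 x) (at x)" if "0 < ereal x" for x
      using D2[OF pos[OF that]] by (simp add: has_real_derivative_iff_has_vector_derivative)
  qed auto
  \<comment> \<open>The two unknowns are found from \<alpha> P + \<beta> Q = sqrt pi and \<alpha> P
    - \<beta> Q = 0.\<close>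
  define P Q where "P = (LINT s:{0<..}|lborel. e s)" and "Q = (LINT s:{0<..}|lborel. e s / s\<^sup>2)"
  note iP = set_integrable_mult_right[OF Ie, of \<alpha>] and iQ = set_integrable_mult_right[OF Iq, of \<beta>]
  have "(LINT s:{0<..}|lborel. f1 s) = \<alpha> * P + \<beta> * Q"
    unfolding f1e P_def Q_def set_integral_add(2)[OF iP iQ] by (simp only: set_integral_mult_right)
  then have "\<alpha> * P + \<beta> * Q = sqrt pi"
    using E1 unfolding interval_lebesgue_integral_def ei by simp
  moreover have "(LINT s:{0<..}|lborel. f2 s) = \<alpha> * P - \<beta> * Q"
    unfolding f2e P_def Q_def set_integral_diff(2)[OF iP iQ] by (simp only: set_integral_mult_right)
  then have "\<alpha> * P - \<beta> * Q = 0"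
    using E2 unfolding interval_lebesgue_integral_def ei by simp
  ultimately have PQ: "P = sqrt pi / (2 * \<alpha>)" "Q = sqrt pi / (2 * \<beta>)" using \<alpha> \<beta> by (auto simp: field_simps)
  have ex: "exp (- (\<alpha>\<^sup>2 * s\<^sup>2) - \<beta>\<^sup>2 / s\<^sup>2) = exp (- 2 * \<alpha> * \<beta>) * e s" if "s > 0" for s
    using that unfolding e_def exp_add[symmetric] by (simp add: power2_eq_square field_simps)
  have "has_bochner_integral lborel (\<lambda>s. exp (- 2 * \<alpha> * \<beta>) * (indicator {0<..} s *\<^sub>R e s)) (exp (- 2 * \<alpha> * \<beta>) * P)"
    using Ie unfolding P_def set_integrable_def set_lebesgue_integral_def
    by (intro has_bochner_integral_mult_right) (simp add: has_bochner_integral_iff)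
  then show ?A unfolding PQ
    by (rule has_bochner_integral_cong[THEN iffD1, rotated -1]) (auto simp: indicator_def ex)
  have "has_bochner_integral lborel (\<lambda>s. exp (- 2 * \<alpha> * \<beta>) * (indicator {0<..} s *\<^sub>R (e s / s\<^sup>2))) (exp (- 2 * \<alpha> * \<beta>) * Q)"
    using Iq unfolding Q_def set_integrable_def set_lebesgue_integral_def
    by (intro has_bochner_integral_mult_right) (simp add: has_bochner_integral_iff)
  then show ?B unfolding PQ
    by (rule has_bochner_integral_cong[THEN iffD1, rotated -1]) (auto simp: indicator_def ex)
qed

lemma integral_gaussian_fourier_real:
  fixes s \<xi> :: real assumes s: "s > 0"
  shows "(LINT x|lborel. exp (\<i> * complex_of_real (\<xi> * x)) * complex_of_real (exp (- (s\<^sup>2 * x\<^sup>2)))) =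
    complex_of_real (sqrt pi / s * exp (- (\<xi>\<^sup>2 / (4 * s\<^sup>2))))"
    and "integrable lborel (\<lambda>x. exp (- (s\<^sup>2 * x\<^sup>2)))"
proof -
  \<comment> \<open>Rescaling by sqrt 2 s matches exp (- s^2 x^2) with the standard normal density,
    whose characteristic function is known.\<close>
  define c where "c = sqrt 2 * s"
  have c: "c > 0" "c\<^sup>2 = 2 * s\<^sup>2" using s by (auto simp: c_def power_mult_distrib)
  define F where "F x = exp (\<i> * complex_of_real (\<xi> / c * x)) * complex_of_real (std_normal_density x)" for x
  have "(LINT x|lborel. F x) = char std_normal_distribution (\<xi> / c)"
    unfolding char_def F_def by (subst integral_density) (auto simp: scaleR_conv_of_real mult_ac normal_density_nonneg)
  also have "\<dots> = complex_of_real (exp (- (\<xi>\<^sup>2 / (4 * s\<^sup>2))))"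
    using c by (simp add: char_std_normal_distribution power_divide)
  finally have A: "(LINT x|lborel. F x) = complex_of_real (exp (- (\<xi>\<^sup>2 / (4 * s\<^sup>2))))" .
  have B: "(LINT x|lborel. F x) = c *\<^sub>R (LINT x|lborel. F (0 + c * x))"
    using lborel_integral_real_affine[of c F 0] c by simp
  have Fc: "F (0 + c * x) = complex_of_real (1 / sqrt (2 * pi)) * (exp (\<i> * complex_of_real (\<xi> * x)) * complex_of_real (exp (- (s\<^sup>2 * x\<^sup>2))))" for x
    using c by (simp add: F_def std_normal_density_def power_mult_distrib)
  have k: "sqrt pi / s = sqrt (2 * pi) / c" using s by (simp add: c_def real_sqrt_mult field_simps)
  have "(LINT x|lborel. F x) = complex_of_real (c / sqrt (2 * pi)) * (LINT x|lborel. exp (\<i> * complex_of_real (\<xi> * x)) * complex_of_real (exp (- (s\<^sup>2 * x\<^sup>2))))"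
    unfolding B Fc by (simp add: scaleR_conv_of_real)
  then show "(LINT x|lborel. exp (\<i> * complex_of_real (\<xi> * x)) * complex_of_real (exp (- (s\<^sup>2 * x\<^sup>2)))) =
    complex_of_real (sqrt pi / s * exp (- (\<xi>\<^sup>2 / (4 * s\<^sup>2))))"
    unfolding A k using c by (simp add: field_simps)
  have "integrable lborel (\<lambda>x. sqrt (2 * pi) * std_normal_density (0 + c * x))"
    using c integrable_std_normal_moment[of 0] by (intro integrable_mult_right lborel_integrable_real_affine) auto
  then show "integrable lborel (\<lambda>x. exp (- (s\<^sup>2 * x\<^sup>2)))"
    using c by (simp add: std_normal_density_def power_mult_distrib)
qed

text \<open>\<open>lborel\<close> is the image, under the coordinate map, of the product of
  one-dimensional Lebesgue measures, and there the integral of a product factors.\<close>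

lemma lborel_integral_prod_Basis:
  fixes f :: "'e::euclidean_space \<Rightarrow> real \<Rightarrow> complex"
  assumes "\<And>b. b \<in> Basis \<Longrightarrow> integrable lborel (f b)"
  shows "(LINT x|lborel. (\<Prod>b\<in>Basis. f b (x \<bullet> b))) = (\<Prod>b\<in>Basis. (LINT t|lborel. f b t))"
    and "integrable lborel (\<lambda>x. (\<Prod>b\<in>Basis. f b (x \<bullet> b)))"
proof -
  interpret product_sigma_finite "\<lambda>b::'e. lborel :: real measure" ..
  have meas: "f b \<in> borel_measurable borel" if "b \<in> Basis" for b using assms[OF that] by auto
  have T: "(\<lambda>g. \<Sum>b\<in>Basis. g b *\<^sub>R b) \<in> (\<Pi>\<^sub>M b\<in>(Basis::'e set). (lborel::real measure)) \<rightarrow>\<^sub>M borel" by measurable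
  have m2: "(\<lambda>x::'e. \<Prod>b\<in>Basis. f b (x \<bullet> b)) \<in> borel_measurable borel"
    using meas by (intro borel_measurable_prod) (auto intro: measurable_compose)
  have eq: "(\<Prod>b\<in>Basis. f b ((\<Sum>b\<in>Basis. g b *\<^sub>R b) \<bullet> b)) = (\<Prod>b\<in>Basis. f b (g b))" for g :: "'e \<Rightarrow> real"
    by (intro prod.cong) auto
  have "(LINT x|lborel. (\<Prod>b\<in>Basis. f b (x \<bullet> b))) = (LINT g|(\<Pi>\<^sub>M b\<in>(Basis::'e set). lborel). (\<Prod>b\<in>Basis. f b (g b)))"
    by (subst lborel_eq, subst integral_distr[OF T m2]) (simp add: eq)
  also have "\<dots> = (\<Prod>b\<in>Basis. (LINT t|lborel. f b t))"
    by (rule product_integral_prod) (use assms in auto)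
  finally show "(LINT x|lborel. (\<Prod>b\<in>Basis. f b (x \<bullet> b))) = (\<Prod>b\<in>Basis. (LINT t|lborel. f b t))" .
  have "integrable (\<Pi>\<^sub>M b\<in>(Basis::'e set). lborel) (\<lambda>g. \<Prod>b\<in>Basis. f b (g b))"
    by (rule product_integrable_prod) (use assms in auto)
  then show "integrable lborel (\<lambda>x. (\<Prod>b\<in>Basis. f b (x \<bullet> b)))"
    by (subst lborel_eq, subst integrable_distr_eq[OF T m2]) (simp add: eq)
qed

lemma integral_gaussian_fourier:
  fixes \<xi> :: "'e::euclidean_space" assumes s: "s > 0"
  shows "(LINT x|lborel. exp (\<i> * complex_of_real (\<xi> \<bullet> x)) * complex_of_real (exp (- (s\<^sup>2 * (norm x)\<^sup>2)))) =
    complex_of_real ((sqrt pi / s) ^ DIM('e) * exp (- ((norm \<xi>)\<^sup>2 / (4 * s\<^sup>2))))"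
    and "integrable lborel (\<lambda>x::'e. exp (- (s\<^sup>2 * (norm x)\<^sup>2)))"
proof -
  define f where "f = (\<lambda>b x. exp (\<i> * complex_of_real (\<xi> \<bullet> b * x)) * complex_of_real (exp (- (s\<^sup>2 * x\<^sup>2))))"
  have f: "integrable lborel (f b)" for b
    by (rule Bochner_Integration.integrable_bound[OF integral_gaussian_fourier_real(2)[OF s]])
      (auto simp: f_def norm_mult)
  have nsq: "(norm x)\<^sup>2 = (\<Sum>b\<in>Basis. (x \<bullet> b)\<^sup>2)" for x :: 'e
    unfolding power2_norm_eq_inner by (subst euclidean_inner) (simp add: power2_eq_square)
  have eq: "(\<Prod>b\<in>Basis. f b (x \<bullet> b)) = exp (\<i> * complex_of_real (\<xi> \<bullet> x)) * complex_of_real (exp (- (s\<^sup>2 * (norm x)\<^sup>2)))" for x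
  proof -
    have "(\<Prod>b\<in>Basis. f b (x \<bullet> b)) = exp (\<Sum>b\<in>Basis. \<i> * complex_of_real (\<xi> \<bullet> b * (x \<bullet> b))) * complex_of_real (exp (\<Sum>b\<in>Basis. - (s\<^sup>2 * (x \<bullet> b)\<^sup>2)))"
      by (simp add: f_def prod.distrib exp_sum)
    moreover have "(\<Sum>b\<in>Basis. \<i> * complex_of_real (\<xi> \<bullet> b * (x \<bullet> b))) = \<i> * complex_of_real (\<xi> \<bullet> x)"
      by (subst euclidean_inner) (simp add: sum_distrib_left)
    moreover have "(\<Sum>b\<in>Basis. - (s\<^sup>2 * (x \<bullet> b)\<^sup>2)) = - (s\<^sup>2 * (norm x)\<^sup>2)"
      by (simp add: nsq sum_distrib_left sum_negf)
    ultimately show ?thesis by simp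
  qed
  have "(LINT x|lborel. exp (\<i> * complex_of_real (\<xi> \<bullet> x)) * complex_of_real (exp (- (s\<^sup>2 * (norm x)\<^sup>2)))) =
     (\<Prod>b\<in>Basis. (LINT t|lborel. f b t))"
    unfolding eq[symmetric] by (rule lborel_integral_prod_Basis(1)[OF f])
  also have "\<dots> = (\<Prod>b\<in>Basis. complex_of_real (sqrt pi / s * exp (- ((\<xi> \<bullet> b)\<^sup>2 / (4 * s\<^sup>2)))))"
    unfolding f_def integral_gaussian_fourier_real(1)[OF s] ..
  also have "\<dots> = complex_of_real ((sqrt pi / s) ^ DIM('e) * exp (\<Sum>b\<in>Basis. - ((\<xi> \<bullet> b)\<^sup>2 / (4 * s\<^sup>2))))"
    unfolding exp_sum[OF finite_Basis] of_real_prod[symmetric] by (simp only: prod.distrib prod_constant)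
  also have "(\<Sum>b\<in>Basis. - ((\<xi> \<bullet> b)\<^sup>2 / (4 * s\<^sup>2))) = - ((norm \<xi>)\<^sup>2 / (4 * s\<^sup>2))"
    by (simp add: nsq sum_divide_distrib sum_negf)
  finally show "(LINT x|lborel. exp (\<i> * complex_of_real (\<xi> \<bullet> x)) * complex_of_real (exp (- (s\<^sup>2 * (norm x)\<^sup>2)))) =
    complex_of_real ((sqrt pi / s) ^ DIM('e) * exp (- ((norm \<xi>)\<^sup>2 / (4 * s\<^sup>2))))" .
  have "integrable lborel (\<lambda>x. exp (\<i> * complex_of_real (\<xi> \<bullet> x)) * complex_of_real (exp (- (s\<^sup>2 * (norm x)\<^sup>2))))"
    unfolding eq[symmetric] by (rule lborel_integral_prod_Basis(2)[OF f])
  then show "integrable lborel (\<lambda>x::'e. exp (- (s\<^sup>2 * (norm x)\<^sup>2)))"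
    by (subst (asm) integrable_norm_iff[symmetric]) (auto simp: norm_mult)
qed

section \<open>Fourier transforms\<close>

lemma lborel_integral_swap:
  fixes f :: "'a::euclidean_space \<Rightarrow> 'b::euclidean_space \<Rightarrow> complex"
  assumes meas: "case_prod f \<in> borel_measurable (borel \<Otimes>\<^sub>M borel)"
    and i1: "\<And>x. integrable lborel (f x)"
    and i2: "integrable lborel (\<lambda>x. LINT y|lborel. norm (f x y))"
  shows "(LINT x|lborel. LINT y|lborel. f x y) = (LINT y|lborel. LINT x|lborel. f x y)"
proof -
  have "integrable (lborel \<Otimes>\<^sub>M lborel) (case_prod f)"
    by (rule lborel_pair.Fubini_integrable) (use assms in auto)
  from lborel_pair.Fubini_integral[OF this] show ?thesis ..
qed

lemma integrable_lorentzian: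
  assumes "c > (0::real)"
  shows "integrable lborel (\<lambda>t. 1 / (t\<^sup>2 + c\<^sup>2))"
proof -
  have "set_integrable lborel (einterval (-\<infinity>) \<infinity>) (\<lambda>t. 1 / (t\<^sup>2 + c\<^sup>2))"
  proof (rule interval_integral_FTC_nonneg[where F = "\<lambda>t. arctan (t / c) / c"])
    show "((\<lambda>t. arctan (t / c) / c) has_real_derivative 1 / (x\<^sup>2 + c\<^sup>2)) (at x)" for x
    proof -
      have "x\<^sup>2 + c\<^sup>2 > 0" using assms by (simp add: add_nonneg_pos)
      then show ?thesis using assms by (auto intro!: derivative_eq_intros simp: divide_simps) (simp add: power2_eq_square algebra_simps)
    qed
    show "isCont (\<lambda>t. 1 / (t\<^sup>2 + c\<^sup>2)) x" for x
      using assms by (auto intro!: continuous_intros simp: sum_power2_eq_zero_iff)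
    have "filterlim (\<lambda>t. t / c) at_top at_top" "filterlim (\<lambda>t. t / c) at_bot at_bot" using assms by real_asymp+
    then show "(((\<lambda>t. arctan (t / c) / c) \<circ> real_of_ereal) \<longlongrightarrow> (pi / 2) / c) (at_left \<infinity>)"
       "(((\<lambda>t. arctan (t / c) / c) \<circ> real_of_ereal) \<longlongrightarrow> (- (pi / 2)) / c) (at_right (- \<infinity>))"
      unfolding ereal_tendsto_simps using assms
      by (intro tendsto_divide[OF _ tendsto_const] filterlim_compose[OF tendsto_arctan_at_top] filterlim_compose[OF tendsto_arctan_at_bot]; simp)+
  qed auto
  then show ?thesis by (simp add: set_integrable_def einterval_def)
qed

text \<open>With A = t^2 + c^2 this writes the Lorentzian as an integral of Gaussians in t; the
  weight 2 s comes from substituting s^2 in the exponential integral.\<close>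

lemma integral_exp_neg_square:
  assumes "A > (0::real)"
  shows "has_bochner_integral lborel (\<lambda>s. indicator {0<..} s * (2 * s * exp (- (A * s\<^sup>2)))) (1 / A)"
proof -
  have ei: "einterval 0 \<infinity> = {0<..}" by (auto simp: einterval_def)
  note FTC = interval_integral_FTC_nonneg[where a = 0 and b = "\<infinity>" and F = "\<lambda>s. - (exp (- (A * s\<^sup>2)) / A)"
      and f = "\<lambda>s. 2 * s * exp (- (A * s\<^sup>2))" and A = "- (1 / A)" and B = 0]
  have c1: "(0::ereal) < \<infinity>" by simp
  have c2: "((\<lambda>s. - (exp (- (A * s\<^sup>2)) / A)) has_real_derivative 2 * x * exp (- (A * x\<^sup>2))) (at x)" for x
    using assms by (auto intro!: derivative_eq_intros)
  have c3: "isCont (\<lambda>s. 2 * s * exp (- (A * s\<^sup>2))) x" for x by (auto intro!: continuous_intros)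
  have c4: "AE x in lborel. 0 < ereal x \<longrightarrow> ereal x < \<infinity> \<longrightarrow> 0 \<le> 2 * x * exp (- (A * x\<^sup>2))" by auto
  have c5: "(((\<lambda>s. - (exp (- (A * s\<^sup>2)) / A)) \<circ> real_of_ereal) \<longlongrightarrow> - (1 / A)) (at_right 0)"
    unfolding zero_ereal_def ereal_tendsto_simps using assms by (auto intro!: tendsto_eq_intros)
  have "((\<lambda>s. - (exp (- (A * s\<^sup>2)) / A)) \<longlongrightarrow> 0) at_top"
    using assms by real_asymp
  then have c6: "(((\<lambda>s. - (exp (- (A * s\<^sup>2)) / A)) \<circ> real_of_ereal) \<longlongrightarrow> 0) (at_left \<infinity>)"
    unfolding ereal_tendsto_simps .
  have 1: "set_integrable lborel {0<..} (\<lambda>s. 2 * s * exp (- (A * s\<^sup>2)))"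
    and 2: "(LBINT s=0..\<infinity>. 2 * s * exp (- (A * s\<^sup>2))) = 0 - (- (1 / A))"
    using FTC[OF c1 c2 c3 c4 c5 c6] unfolding ei by blast+
  show ?thesis using 1 2
    by (simp add: has_bochner_integral_iff set_integrable_def interval_lebesgue_integral_def ei set_lebesgue_integral_def)
qed

text \<open>Here and for the Yukawa potential, the function is written as a superposition of Gaussians.\<close>

lemma fourier_lorentzian:
  fixes c s :: real assumes c: "c > 0" and s: "s \<noteq> 0"
  shows "(LINT t|lborel. exp (\<i> * complex_of_real (s * t)) * complex_of_real (1 / (t\<^sup>2 + c\<^sup>2))) =
    complex_of_real (pi / c * exp (- (c * \<bar>s\<bar>)))"
proof -
  define w where "w t \<sigma> = indicator {0<..} \<sigma> * (2 * \<sigma> * exp (- ((t\<^sup>2 + c\<^sup>2) * \<sigma>\<^sup>2)))" for t \<sigma> :: real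
  define f where "f t \<sigma> = exp (\<i> * complex_of_real (s * t)) * complex_of_real (w t \<sigma>)" for t \<sigma>
  have pos: "t\<^sup>2 + c\<^sup>2 > 0" for t using c by (simp add: sum_power2_gt_zero_iff)
  have w: "has_bochner_integral lborel (w t) (1 / (t\<^sup>2 + c\<^sup>2))" for t
    unfolding w_def by (rule integral_exp_neg_square[OF pos])
  have w0: "w t \<sigma> \<ge> 0" for t \<sigma> by (simp add: w_def indicator_def)
  have nf: "norm (f t \<sigma>) = w t \<sigma>" for t \<sigma> using w0 by (simp add: f_def norm_mult)
  have meas: "case_prod f \<in> borel_measurable (borel \<Otimes>\<^sub>M borel)"
    unfolding f_def w_def by (auto simp: case_prod_unfold)
  have meas1: "f t \<in> borel_measurable borel" for t
    unfolding f_def w_def by measurable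
  have "(LINT t|lborel. exp (\<i> * complex_of_real (s * t)) * complex_of_real (1 / (t\<^sup>2 + c\<^sup>2))) = (LINT t|lborel. LINT \<sigma>|lborel. f t \<sigma>)"
    using w by (simp add: f_def has_bochner_integral_iff)
  also have "\<dots> = (LINT \<sigma>|lborel. LINT t|lborel. f t \<sigma>)"
  proof (rule lborel_integral_swap[OF meas])
    show "integrable lborel (f t)" for t
      by (subst integrable_norm_iff[symmetric]) (use w[of t] meas1 in \<open>auto simp: nf has_bochner_integral_iff\<close>)
    show "integrable lborel (\<lambda>t. LINT \<sigma>|lborel. norm (f t \<sigma>))"
      using integrable_lorentzian[OF c] w by (simp add: nf has_bochner_integral_iff)
  qed
  \<comment> \<open>For fixed \<sigma> the t-integral is a Gaussian Fourier transform. Its factor 1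
    / \<sigma> cancels the weight and leaves the first integral of \<open>schloemilch\<close> with
    \<beta> = |s| / 2.\<close>
  also have "\<dots> = (LINT \<sigma>|lborel. complex_of_real (2 * sqrt pi * (indicator {0<..} \<sigma> * exp (- (c\<^sup>2 * \<sigma>\<^sup>2) - (\<bar>s\<bar> / 2)\<^sup>2 / \<sigma>\<^sup>2))))"
  proof (intro Bochner_Integration.integral_cong refl)
    fix \<sigma> :: real
    show "(LINT t|lborel. f t \<sigma>) = complex_of_real (2 * sqrt pi * (indicator {0<..} \<sigma> * exp (- (c\<^sup>2 * \<sigma>\<^sup>2) - (\<bar>s\<bar> / 2)\<^sup>2 / \<sigma>\<^sup>2)))"
    proof (cases "\<sigma> > 0")
      case True
      have "f t \<sigma> = complex_of_real (2 * \<sigma> * exp (- (c\<^sup>2 * \<sigma>\<^sup>2))) * (exp (\<i> * complex_of_real (s * t)) * complex_of_real (exp (- (\<sigma>\<^sup>2 * t\<^sup>2))))" for t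
        using True by (simp add: f_def w_def algebra_simps exp_add exp_diff exp_minus) (simp add: field_simps)
      then have "(LINT t|lborel. f t \<sigma>) = complex_of_real (2 * \<sigma> * exp (- (c\<^sup>2 * \<sigma>\<^sup>2))) * complex_of_real (sqrt pi / \<sigma> * exp (- (s\<^sup>2 / (4 * \<sigma>\<^sup>2))))"
        by (simp add: integral_gaussian_fourier_real(1)[OF True] del: of_real_mult)
      also have "\<dots> = complex_of_real (2 * sqrt pi * exp (- (c\<^sup>2 * \<sigma>\<^sup>2) - (\<bar>s\<bar> / 2)\<^sup>2 / \<sigma>\<^sup>2))"
      proof -
        have "(\<bar>s\<bar> / 2)\<^sup>2 / \<sigma>\<^sup>2 = s\<^sup>2 / (4 * \<sigma>\<^sup>2)" by (simp add: power_divide)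
        moreover have "exp (- X - Y) = exp (- X) * exp (- Y)" for X Y :: real by (simp add: mult_exp_exp)
        ultimately show ?thesis using True by simp
      qed
      finally show ?thesis using True by simp
    qed (simp add: f_def w_def)
  qed
  also have "\<dots> = complex_of_real (2 * sqrt pi * (sqrt pi / (2 * c) * exp (- 2 * c * (\<bar>s\<bar> / 2))))"
    using schloemilch(1)[OF c, of "\<bar>s\<bar> / 2"] s unfolding integral_complex_of_real by (simp add: has_bochner_integral_iff)
  also have "2 * sqrt pi * (sqrt pi / (2 * c) * exp (- 2 * c * (\<bar>s\<bar> / 2))) = pi / c * exp (- (c * \<bar>s\<bar>))"
    using c by (simp add: field_simps)
  finally show ?thesis .
qed

lemma integrable_yukawa:
  fixes b k :: real assumes b: "b > 0" and k: "k > 0"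
  shows "integrable lborel (\<lambda>z::'e::euclidean_space. exp (- (b * sqrt ((norm z)\<^sup>2 + k\<^sup>2))) / sqrt ((norm z)\<^sup>2 + k\<^sup>2))"
proof (rule Bochner_Integration.integrable_bound[where f = "\<lambda>z. 1 / k * exp (- b * norm z)"])
  show "AE z in lborel. norm (exp (- (b * sqrt ((norm z)\<^sup>2 + k\<^sup>2))) / sqrt ((norm z)\<^sup>2 + k\<^sup>2)) \<le> norm (1 / k * exp (- b * norm (z::'e)))"
  proof (intro AE_I2)
    fix z :: 'e
    have 1: "norm z \<le> sqrt ((norm z)\<^sup>2 + k\<^sup>2)" by (rule real_le_rsqrt) simp
    have 2: "k \<le> sqrt ((norm z)\<^sup>2 + k\<^sup>2)" by (rule real_le_rsqrt) simp
    have "exp (- (b * sqrt ((norm z)\<^sup>2 + k\<^sup>2))) / sqrt ((norm z)\<^sup>2 + k\<^sup>2) \<le> exp (- b * norm z) / k"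
      using 1 2 b k by (intro frac_le) (auto intro: mult_left_mono)
    then show "norm (exp (- (b * sqrt ((norm z)\<^sup>2 + k\<^sup>2))) / sqrt ((norm z)\<^sup>2 + k\<^sup>2)) \<le> norm (1 / k * exp (- b * norm z))"
      using k by simp
  qed
qed (use integrable_exp_neg_norm[OF b] in auto)

text \<open>In dimension two the Gaussian transform brings the factor pi / s^2, which carries the
  first integral of \<open>schloemilch\<close> over into the second. In the result b and k have
  changed places.\<close>

lemma fourier_yukawa:
  fixes b k :: real and \<xi> :: "'e::euclidean_space"
  assumes dim: "DIM('e) = 2" and b: "b > 0" and k: "k > 0"
  shows "(LINT z|lborel. exp (\<i> * complex_of_real (\<xi> \<bullet> z)) *
       complex_of_real (exp (- (b * sqrt ((norm z)\<^sup>2 + k\<^sup>2))) / sqrt ((norm z)\<^sup>2 + k\<^sup>2))) =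
     complex_of_real (2 * pi * exp (- (k * sqrt ((norm \<xi>)\<^sup>2 + b\<^sup>2))) / sqrt ((norm \<xi>)\<^sup>2 + b\<^sup>2))"
proof -
  define r where "r z = sqrt ((norm z)\<^sup>2 + k\<^sup>2)" for z :: 'e
  define C where "C = sqrt ((norm \<xi>)\<^sup>2 + b\<^sup>2)"
  have r: "r z > 0" "(r z)\<^sup>2 = (norm z)\<^sup>2 + k\<^sup>2" for z using k by (auto simp: r_def intro: add_nonneg_pos)
  have C: "C > 0" "C\<^sup>2 = (norm \<xi>)\<^sup>2 + b\<^sup>2" using b by (auto simp: C_def intro: add_nonneg_pos)
  define w where "w z s = indicator {0<..} s * exp (- ((r z)\<^sup>2 * s\<^sup>2) - (b / 2)\<^sup>2 / s\<^sup>2)" for z and s :: real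
  define f where "f z s = exp (\<i> * complex_of_real (\<xi> \<bullet> z)) * complex_of_real (w z s)" for z s
  have w: "has_bochner_integral lborel (w z) (sqrt pi / (2 * r z) * exp (- (b * r z)))" for z
    using schloemilch(1)[OF r(1), of "b / 2" z] b unfolding w_def by (simp add: mult_ac)
  have nf: "norm (f z s) = w z s" for z s by (simp add: f_def norm_mult w_def indicator_def)
  have meas: "case_prod f \<in> borel_measurable (borel \<Otimes>\<^sub>M borel)"
    unfolding f_def w_def r_def by (auto simp: case_prod_unfold)
  have meas1: "f t \<in> borel_measurable borel" for t
    unfolding f_def w_def by measurable
  have "(LINT z|lborel. exp (\<i> * complex_of_real (\<xi> \<bullet> z)) * complex_of_real (exp (- (b * r z)) / r z)) =
      (LINT z|lborel. complex_of_real (2 / sqrt pi) * (LINT s|lborel. f z s))"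
    using w by (intro Bochner_Integration.integral_cong) (simp_all add: f_def has_bochner_integral_iff field_simps)
  also have "\<dots> = complex_of_real (2 / sqrt pi) * (LINT z|lborel. LINT s|lborel. f z s)" by simp
  also have "(LINT z|lborel. LINT s|lborel. f z s) = (LINT s|lborel. LINT z|lborel. f z s)"
  proof (rule lborel_integral_swap[OF meas])
    show "integrable lborel (f t)" for t
      by (subst integrable_norm_iff[symmetric]) (use w[of t] meas1 in \<open>auto simp: nf has_bochner_integral_iff\<close>)
    have "integrable lborel (\<lambda>z. sqrt pi / 2 * (exp (- (b * r z)) / r z))"
      using integrable_yukawa[OF b k] unfolding r_def by (rule integrable_mult_right)
    then show "integrable lborel (\<lambda>z. LINT s|lborel. norm (f z s))"
      using w by (simp add: nf has_bochner_integral_iff mult_ac)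
  qed
  also have "\<dots> = (LINT s|lborel. complex_of_real (pi * (indicator {0<..} s * (exp (- (k\<^sup>2 * s\<^sup>2) - (C / 2)\<^sup>2 / s\<^sup>2) / s\<^sup>2))))"
  proof (intro Bochner_Integration.integral_cong refl)
    fix s :: real
    show "(LINT z|lborel. f z s) = complex_of_real (pi * (indicator {0<..} s * (exp (- (k\<^sup>2 * s\<^sup>2) - (C / 2)\<^sup>2 / s\<^sup>2) / s\<^sup>2)))"
    proof (cases "s > 0")
      case True
      have "f z s = complex_of_real (exp (- (k\<^sup>2 * s\<^sup>2) - (b / 2)\<^sup>2 / s\<^sup>2)) *
        (exp (\<i> * complex_of_real (\<xi> \<bullet> z)) * complex_of_real (exp (- (s\<^sup>2 * (norm z)\<^sup>2))))" for z
        using True by (simp add: f_def w_def r algebra_simps exp_add exp_diff exp_minus) (simp add: field_simps)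
      then have "(LINT z|lborel. f z s) = complex_of_real (exp (- (k\<^sup>2 * s\<^sup>2) - (b / 2)\<^sup>2 / s\<^sup>2)) *
         complex_of_real ((sqrt pi / s) ^ 2 * exp (- ((norm \<xi>)\<^sup>2 / (4 * s\<^sup>2))))"
        by (simp add: integral_gaussian_fourier(1)[OF True] dim del: of_real_mult of_real_power)
      also have "\<dots> = complex_of_real (pi * (exp (- (k\<^sup>2 * s\<^sup>2) - (C / 2)\<^sup>2 / s\<^sup>2) / s\<^sup>2))"
        using True by (simp add: C power_divide exp_diff exp_minus add_divide_distrib exp_add) (simp add: field_simps)
      finally show ?thesis using True by simp
    qed (simp add: f_def w_def)
  qed
  also have "\<dots> = complex_of_real (pi * (sqrt pi / (2 * (C / 2)) * exp (- 2 * k * (C / 2))))"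
    unfolding integral_complex_of_real
    using has_bochner_integral_integral_eq[OF has_bochner_integral_mult_right[OF schloemilch(2)[OF k, of "C / 2"], of pi]] C by simp
  also have "complex_of_real (2 / sqrt pi) * complex_of_real (pi * (sqrt pi / (2 * (C / 2)) * exp (- 2 * k * (C / 2)))) =
      complex_of_real (2 * pi * exp (- (k * C)) / C)"
    by (simp add: field_simps)
  finally show ?thesis unfolding r_def C_def .
qed

text \<open>The factor \<open>exp (- \<beta> (p \<bullet> \<eta>)\<^sup>2)\<close> is a Gaussian average of plane waves, which reduces the
  integral to isotropic Gaussians.\<close>

lemma integral_anisotropic_gaussian:
  fixes p :: "'e::euclidean_space"
  assumes dim: "DIM('e) = 2" and \<alpha>: "\<alpha> > 0" and \<beta>: "\<beta> > 0"
  shows "(LINT \<eta>|lborel. complex_of_real (exp (- (\<alpha> * (norm \<eta>)\<^sup>2 + \<beta> * (p \<bullet> \<eta>)\<^sup>2)))) =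
    complex_of_real (pi / sqrt (\<alpha> * (\<alpha> + \<beta> * (norm p)\<^sup>2)))"
proof -
  \<comment> \<open>Chosen so that 1 / (4 s^2) = \<beta>: the transform of exp (- s^2 t^2) at p .
    \<eta> is then the wanted factor.\<close>
  define s where "s = 1 / (2 * sqrt \<beta>)"
  have s: "s > 0" "4 * s\<^sup>2 = 1 / \<beta>" using \<beta> by (auto simp: s_def power_divide power_mult_distrib)
  define f where "f \<eta> t = exp (\<i> * complex_of_real ((p \<bullet> \<eta>) * t)) * complex_of_real (exp (- (\<alpha> * (norm \<eta>)\<^sup>2)) * exp (- (s\<^sup>2 * t\<^sup>2)))" for \<eta> :: 'e and t :: real
  have nf: "norm (f \<eta> t) = exp (- (\<alpha> * (norm \<eta>)\<^sup>2)) * exp (- (s\<^sup>2 * t\<^sup>2))" for \<eta> t by (simp add: f_def norm_mult)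
  have meas: "case_prod f \<in> borel_measurable (borel \<Otimes>\<^sub>M borel)"
    unfolding f_def by (auto simp: case_prod_unfold)
  have meas1: "f t \<in> borel_measurable borel" for t unfolding f_def by measurable
  have sa: "sqrt \<alpha> > 0" "(sqrt \<alpha>)\<^sup>2 = \<alpha>" using \<alpha> by auto
  have 1: "(LINT t|lborel. f \<eta> t) = complex_of_real (sqrt pi / s) * complex_of_real (exp (- (\<alpha> * (norm \<eta>)\<^sup>2 + \<beta> * (p \<bullet> \<eta>)\<^sup>2)))" for \<eta>
  proof -
    have "f \<eta> = (\<lambda>t. complex_of_real (exp (- (\<alpha> * (norm \<eta>)\<^sup>2))) * (exp (\<i> * complex_of_real ((p \<bullet> \<eta>) * t)) * complex_of_real (exp (- (s\<^sup>2 * t\<^sup>2)))))"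
      by (auto simp: f_def fun_eq_iff)
    then have "(LINT t|lborel. f \<eta> t) = complex_of_real (exp (- (\<alpha> * (norm \<eta>)\<^sup>2))) * complex_of_real (sqrt pi / s * exp (- ((p \<bullet> \<eta>)\<^sup>2 / (4 * s\<^sup>2))))"
      by (simp add: integral_gaussian_fourier_real(1)[OF s(1)] del: of_real_mult)
    then show ?thesis unfolding s(2) by (simp add: exp_add exp_minus exp_diff field_simps)
  qed
  \<comment> \<open>The rate of the Gaussian left in t after the \<eta>-integral is \<kappa>^2: s^2
    from the averaging weight plus |p|^2 / (4 \<alpha>) from the transform at frequency t p.\<close>
  define \<kappa> where "\<kappa> = sqrt (s\<^sup>2 + (norm p)\<^sup>2 / (4 * \<alpha>))"
  have \<kappa>: "\<kappa> > 0" "\<kappa>\<^sup>2 = s\<^sup>2 + (norm p)\<^sup>2 / (4 * \<alpha>)" using s \<alpha> by (auto simp: \<kappa>_def intro!: add_pos_nonneg add_nonneg_nonneg)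
  have 2: "(LINT \<eta>|lborel. f \<eta> t) = complex_of_real (pi / \<alpha>) * (exp (\<i> * complex_of_real (0 * t)) * complex_of_real (exp (- (\<kappa>\<^sup>2 * t\<^sup>2))))" for t
  proof -
    have "(\<lambda>\<eta>. f \<eta> t) = (\<lambda>\<eta>. complex_of_real (exp (- (s\<^sup>2 * t\<^sup>2))) * (exp (\<i> * complex_of_real ((t *\<^sub>R p) \<bullet> \<eta>)) * complex_of_real (exp (- ((sqrt \<alpha>)\<^sup>2 * (norm \<eta>)\<^sup>2)))))"
      unfolding sa by (auto simp: f_def fun_eq_iff mult_ac)
    then have "(LINT \<eta>|lborel. f \<eta> t) = complex_of_real (exp (- (s\<^sup>2 * t\<^sup>2))) * complex_of_real ((sqrt pi / sqrt \<alpha>) ^ 2 * exp (- ((norm (t *\<^sub>R p))\<^sup>2 / (4 * (sqrt \<alpha>)\<^sup>2))))"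
      using integral_gaussian_fourier(1)[OF sa(1), of "t *\<^sub>R p"] by (simp add: dim del: of_real_mult real_sqrt_pow2_iff real_sqrt_power)
    also have "\<dots> = complex_of_real (pi / \<alpha> * exp (- (\<kappa>\<^sup>2 * t\<^sup>2)))"
      using \<alpha> unfolding \<kappa>(2) by (simp add: power_divide power_mult_distrib algebra_simps exp_add exp_diff exp_minus) (simp add: field_simps)
    finally show ?thesis by simp
  qed
  have "complex_of_real (sqrt pi / s) * (LINT \<eta>|lborel. complex_of_real (exp (- (\<alpha> * (norm \<eta>)\<^sup>2 + \<beta> * (p \<bullet> \<eta>)\<^sup>2)))) = (LINT \<eta>|lborel. LINT t|lborel. f \<eta> t)"
    unfolding 1 by simp
  also have "\<dots> = (LINT t|lborel. LINT \<eta>|lborel. f \<eta> t)"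
  proof (rule lborel_integral_swap[OF meas])
    show "integrable lborel (f \<eta>)" for \<eta>
      by (subst integrable_norm_iff[symmetric]) (use integral_gaussian_fourier_real(2)[OF s(1)] meas1 in \<open>auto simp: nf\<close>)
    show "integrable lborel (\<lambda>\<eta>. LINT t|lborel. norm (f \<eta> t))"
      using integral_gaussian_fourier(2)[OF sa(1), where 'e = 'e] by (simp add: nf sa)
  qed
  also have "\<dots> = complex_of_real (pi / \<alpha>) * complex_of_real (sqrt pi / \<kappa> * exp (- (0\<^sup>2 / (4 * \<kappa>\<^sup>2))))"
    unfolding 2 using integral_gaussian_fourier_real(1)[OF \<kappa>(1), of 0] by simp
  finally have "(LINT \<eta>|lborel. complex_of_real (exp (- (\<alpha> * (norm \<eta>)\<^sup>2 + \<beta> * (p \<bullet> \<eta>)\<^sup>2)))) = complex_of_real (pi / \<alpha> * (s / \<kappa>))"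
    (is "?Z = _")
  proof -
    assume *: "complex_of_real (sqrt pi / s) * ?Z = complex_of_real (pi / \<alpha>) * complex_of_real (sqrt pi / \<kappa> * exp (- (0\<^sup>2 / (4 * \<kappa>\<^sup>2))))"
    have "?Z = complex_of_real (s / sqrt pi) * (complex_of_real (sqrt pi / s) * ?Z)"
      using s by simp
    also have "\<dots> = complex_of_real (s / sqrt pi * (pi / \<alpha> * (sqrt pi / \<kappa>)))"
      unfolding * by simp
    also have "s / sqrt pi * (pi / \<alpha> * (sqrt pi / \<kappa>)) = pi / \<alpha> * (s / \<kappa>)" by simp
    finally show ?thesis .
  qed
  moreover have "pi / \<alpha> * (s / \<kappa>) = pi / sqrt (\<alpha> * (\<alpha> + \<beta> * (norm p)\<^sup>2))"
  proof -
    have "sqrt (\<alpha> * (\<alpha> + \<beta> * (norm p)\<^sup>2)) = \<alpha> * \<kappa> / s"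
    proof (rule real_sqrt_unique)
      have s2: "s\<^sup>2 = 1 / (4 * \<beta>)" using s \<beta> by (simp add: field_simps)
      show "(\<alpha> * \<kappa> / s)\<^sup>2 = \<alpha> * (\<alpha> + \<beta> * (norm p)\<^sup>2)"
        unfolding power_divide power_mult_distrib \<kappa>(2) s2 using \<alpha> \<beta> by (simp add: field_simps power2_eq_square)
    qed (use \<alpha> \<kappa> s in auto)
    then show ?thesis using \<alpha> s \<kappa> by simp
  qed
  ultimately show ?thesis by (simp only:)
qed

section \<open>A spectral integral for the fundamental solution\<close>

lemma hor_component [simp]: "hor x $ 1 = x $ 1" "hor x $ 2 = x $ 2"
  by (simp_all add: hor_def)

lemma join_component [simp]: "Defs.join z t $ 1 = z $ 1" "Defs.join z t $ 2 = z $ 2" "Defs.join z t $ 3 = t"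
  by (simp_all add: Defs.join_def)

lemma inner_real2: "(u::real^2) \<bullet> v = u $ 1 * v $ 1 + u $ 2 * v $ 2"
  by (simp add: inner_vec_def sum_2)

lemma inner_real3: "(u::real^3) \<bullet> v = u $ 1 * v $ 1 + u $ 2 * v $ 2 + u $ 3 * v $ 3"
  by (simp add: inner_vec_def sum_3)

lemma inner_join: "Defs.join \<xi> t \<bullet> v = \<xi> \<bullet> hor v + t * v $ 3"
  by (simp add: inner_real2 inner_real3)

lemma norm_real3: "(norm (v::real^3))\<^sup>2 = (norm (hor v))\<^sup>2 + (v $ 3)\<^sup>2"
  by (simp add: power2_norm_eq_inner inner_real2 inner_real3) (simp add: power2_eq_square)

lemma hor_join [simp]: "hor (Defs.join z t) = z"
  by (simp add: vec_eq_iff forall_2)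

lemma hor_diff: "hor (x - y) = hor x - hor y"
  by (simp add: vec_eq_iff forall_2)

lemma norm_lift0_diff: "norm (lift0 z - y) = sqrt ((norm (z - hor y))\<^sup>2 + (y $ 3)\<^sup>2)"
  using norm_real3[of "lift0 z - y"] by (simp add: hor_diff real_sqrt_unique)

text \<open>\<open>vslow gm\<close> and \<open>vslow gp\<close> are the two functions S of the
  overview, on real \<xi>.\<close>

definition vslow :: "real \<Rightarrow> real^2 \<Rightarrow> real" where
  "vslow g \<xi> = sqrt ((norm \<xi>)\<^sup>2 + 1 / g)"

lemma vslow_pos: "g > 0 \<Longrightarrow> vslow g \<xi> > 0"
  by (simp add: vslow_def add_nonneg_pos)

lemma vslow_sq: "g > 0 \<Longrightarrow> (vslow g \<xi>)\<^sup>2 = (norm \<xi>)\<^sup>2 + 1 / g"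
  by (simp add: vslow_def)

lemma norm_le_vslow: "g > 0 \<Longrightarrow> norm \<xi> \<le> vslow g \<xi>"
  unfolding vslow_def by (rule real_le_rsqrt) simp

lemma vslow_measurable [measurable]: "vslow g \<in> borel_measurable borel"
  unfolding vslow_def by measurable

text \<open>In this form the numerator cancels against the denominators produced by the
  \<xi>_3-integral and by the z'-integral, which leaves the amplitude of the spectral
  integral.\<close>

lemma Rfun_vslow:
  assumes "gm > 0" "gp > 0"
  shows "Rfun gm gp (sqrt gm * norm \<xi>) =
    4 * vslow gm \<xi> * vslow gp \<xi> / (vslow gp \<xi> / gm + vslow gm \<xi> / gp)"
proof -
  have a: "(a0 gm gp)\<^sup>2 = gm / gp" using assms by (simp add: a0_def)
  have 1: "sqrt ((a0 gm gp)\<^sup>2 + (sqrt gm * norm \<xi>)\<^sup>2) = sqrt gm * vslow gp \<xi>"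
  proof -
    have "(a0 gm gp)\<^sup>2 + (sqrt gm * norm \<xi>)\<^sup>2 = gm * ((norm \<xi>)\<^sup>2 + 1 / gp)"
      using assms by (simp add: a power_mult_distrib field_simps)
    then show ?thesis by (simp add: vslow_def real_sqrt_mult)
  qed
  have 2: "sqrt (1 + (sqrt gm * norm \<xi>)\<^sup>2) = sqrt gm * vslow gm \<xi>"
  proof -
    have "1 + (sqrt gm * norm \<xi>)\<^sup>2 = gm * ((norm \<xi>)\<^sup>2 + 1 / gm)"
      using assms by (simp add: power_mult_distrib field_simps)
    then show ?thesis by (simp add: vslow_def real_sqrt_mult)
  qed
  define A B where "A = vslow gm \<xi>" and "B = vslow gp \<xi>"
  have AB: "A > 0" "B > 0" using vslow_pos assms by (auto simp: A_def B_def)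
  have s: "sqrt gm * (sqrt gm * t) = gm * t" for t using assms by simp
  have "Rfun gm gp (sqrt gm * norm \<xi>) = 4 * sqrt gm * (sqrt gm * B) * (sqrt gm * A) / (sqrt gm * B + gm / gp * (sqrt gm * A))"
    unfolding Rfun_def 1 2 unfolding a A_def B_def ..
  also have "\<dots> = sqrt gm * (4 * gm * A * B) / (sqrt gm * (B + gm / gp * A))"
    using assms by (simp add: algebra_simps s)
  also have "\<dots> = 4 * A * B / (B / gm + A / gp)"
    using assms AB by (simp add: divide_simps) (simp add: mult.commute)
  finally show ?thesis unfolding A_def B_def .
qed

text \<open>The denominator factors as gm (t^2 + c^2) with c = \<open>vslow gm \<xi>\<close>, so the
  inner integral is the transform of a Lorentzian at the nonzero frequency \<tau> x_3.\<close>

lemma Etau_eq: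
  assumes g: "gm > 0" "gp > 0" and x: "x $ 3 < 0" and \<tau>: "\<tau> > 0"
  shows "Etau gm gp \<tau> x z = complex_of_real (\<tau> / (2 * pi)^3 * (pi / gm)) *
     (LINT \<xi>|lborel. exp (\<i> * complex_of_real (\<tau> * (\<xi> \<bullet> (hor x - z)))) *
        complex_of_real (Rfun gm gp (sqrt gm * norm \<xi>) * exp (- (\<tau> * \<bar>x $ 3\<bar> * vslow gm \<xi>)) / vslow gm \<xi>))"
proof -
  have inner: "(LINT t|lborel. exp (\<i> * complex_of_real (\<tau> * (Defs.join \<xi> t \<bullet> (x - lift0 z)))) *
        complex_of_real (Rfun gm gp (sqrt gm * norm \<xi>) / (gm * (norm (Defs.join \<xi> t))\<^sup>2 + 1))) =
     complex_of_real (pi / gm) * (exp (\<i> * complex_of_real (\<tau> * (\<xi> \<bullet> (hor x - z)))) *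
        complex_of_real (Rfun gm gp (sqrt gm * norm \<xi>) * exp (- (\<tau> * \<bar>x $ 3\<bar> * vslow gm \<xi>)) / vslow gm \<xi>))" (is "?L = ?R") for \<xi>
  proof -
    define R where "R = Rfun gm gp (sqrt gm * norm \<xi>)"
    define w where "w = exp (\<i> * complex_of_real (\<tau> * (\<xi> \<bullet> (hor x - z))))"
    have e: "exp (\<i> * complex_of_real (\<tau> * (Defs.join \<xi> t \<bullet> (x - lift0 z)))) * complex_of_real (R / (gm * (norm (Defs.join \<xi> t))\<^sup>2 + 1)) =
      (w * complex_of_real (R / gm)) * (exp (\<i> * complex_of_real ((\<tau> * x $ 3) * t)) * complex_of_real (1 / (t\<^sup>2 + (vslow gm \<xi>)\<^sup>2)))" for t
    proof -
      have "gm * (norm (Defs.join \<xi> t))\<^sup>2 + 1 = gm * (t\<^sup>2 + (vslow gm \<xi>)\<^sup>2)"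
        using g by (simp add: norm_real3 vslow_sq algebra_simps)
      moreover have "exp (\<i> * complex_of_real (\<tau> * (Defs.join \<xi> t \<bullet> (x - lift0 z)))) = w * exp (\<i> * complex_of_real ((\<tau> * x $ 3) * t))"
        by (simp add: w_def inner_join hor_diff exp_add[symmetric] algebra_simps)
      ultimately show ?thesis by simp
    qed
    have "?L = (w * complex_of_real (R / gm)) * complex_of_real (pi / vslow gm \<xi> * exp (- (vslow gm \<xi> * \<bar>\<tau> * x $ 3\<bar>)))"
      unfolding R_def[symmetric] e integral_mult_right_zero
      by (subst fourier_lorentzian) (use g x \<tau> vslow_pos in auto)
    then show ?thesis using \<tau> by (simp add: R_def w_def abs_mult mult_ac)
  qed
  show ?thesis unfolding Etau_def inner integral_mult_right_zero by simp
qed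

lemma lborel_integral_shift:
  fixes f :: "'a::euclidean_space \<Rightarrow> complex"
  assumes [measurable]: "f \<in> borel_measurable borel"
  shows "(LINT z|lborel. f (c + z)) = (LINT z|lborel. f z)"
  by (subst (2) lborel_distr_plus[of c, symmetric], subst integral_distr) auto

text \<open>For fixed \<xi> the z'-integral is, once the origin is moved to y', the transform
  \<open>fourier_yukawa\<close> with b = \<tau> / sqrt gp and k = y_3 at the frequency - \<tau>
  \<xi>.\<close>

lemma Phi_formula_spectral:
  assumes g: "gm > 0" "gp > 0" and x: "x $ 3 < 0" and y: "y $ 3 > 0" and \<tau>: "\<tau> > 0"
  shows "Phi_formula gm gp \<tau> x y = complex_of_real (\<tau> / (4 * pi\<^sup>2 * gm * gp)) *
     (LINT \<xi>|lborel. exp (\<i> * complex_of_real (\<tau> * (\<xi> \<bullet> (hor x - hor y)))) *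
        complex_of_real (exp (- (\<tau> * (- x $ 3 * vslow gm \<xi> + y $ 3 * vslow gp \<xi>))) / (vslow gp \<xi> / gm + vslow gm \<xi> / gp)))"
proof -
  define r where "r \<xi> = Rfun gm gp (sqrt gm * norm \<xi>) * exp (- (\<tau> * \<bar>x $ 3\<bar> * vslow gm \<xi>)) / vslow gm \<xi>" for \<xi>
  define w where "w z = exp (- \<tau> * norm (lift0 z - y) / sqrt gp) / norm (lift0 z - y)" for z
  define v where "v z = exp (- (\<tau> / sqrt gp * sqrt ((norm z)\<^sup>2 + (y $ 3)\<^sup>2))) / sqrt ((norm z)\<^sup>2 + (y $ 3)\<^sup>2)" for z :: "real^2"
  have wv: "w z = v (z - hor y)" for z by (simp add: w_def v_def norm_lift0_diff)
  have Rm: "(\<lambda>\<xi>::real^2. Rfun gm gp (sqrt gm * norm \<xi>)) \<in> borel_measurable borel" unfolding Rfun_def by measurable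
  have rm[measurable]: "r \<in> borel_measurable borel" unfolding r_def using Rm by measurable
  have vm[measurable]: "v \<in> borel_measurable borel" unfolding v_def by measurable
  have wm[measurable]: "w \<in> borel_measurable borel" unfolding wv by measurable
  have vi: "integrable lborel v" unfolding v_def by (rule integrable_yukawa) (use g y \<tau> in auto)
  have wi: "integrable lborel w"
  proof -
    have "integrable (distr lborel borel ((+) (- hor y))) v" unfolding lborel_distr_plus by (rule vi)
    then have "integrable lborel (\<lambda>z. v (- hor y + z))" by (subst (asm) integrable_distr_eq) auto
    moreover have "w = (\<lambda>z. v (- hor y + z))" by (simp add: fun_eq_iff wv)
    ultimately show ?thesis by simp
  qed
  \<comment> \<open>Since x_3 < 0, integrating out \<xi>_3 has left exponential decay in \<xi>';
    this makes the double integral absolutely convergent and the exchange legitimate.\<close>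
  have rb: "\<bar>r \<xi>\<bar> \<le> 4 * gm * exp (- (\<tau> * \<bar>x $ 3\<bar>) * norm \<xi>)" for \<xi>
  proof -
    have p: "vslow gm \<xi> > 0" "vslow gp \<xi> > 0" using vslow_pos g by auto
    have "r \<xi> = 4 * vslow gp \<xi> / (vslow gp \<xi> / gm + vslow gm \<xi> / gp) * exp (- (\<tau> * \<bar>x $ 3\<bar> * vslow gm \<xi>))"
      using p unfolding r_def Rfun_vslow[OF g] by simp
    moreover have "4 * vslow gp \<xi> / (vslow gp \<xi> / gm + vslow gm \<xi> / gp) \<le> 4 * gm"
      using p g by (simp add: divide_le_eq add_pos_pos field_simps)
    moreover have "exp (- (\<tau> * \<bar>x $ 3\<bar> * vslow gm \<xi>)) \<le> exp (- (\<tau> * \<bar>x $ 3\<bar>) * norm \<xi>)"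
      using norm_le_vslow[OF g(1), of \<xi>] \<tau> by (auto intro!: mult_left_mono)
    moreover have "4 * vslow gp \<xi> / (vslow gp \<xi> / gm + vslow gm \<xi> / gp) \<ge> 0" using p g by simp
    ultimately have "r \<xi> \<le> 4 * gm * exp (- (\<tau> * \<bar>x $ 3\<bar>) * norm \<xi>)" "r \<xi> \<ge> 0"
      using g by (auto intro!: mult_mono mult_nonneg_nonneg simp del: times_divide_eq_left times_divide_eq_right)
    then show ?thesis by simp
  qed
  have ri: "integrable lborel r"
  proof (rule Bochner_Integration.integrable_bound)
    show "integrable lborel (\<lambda>\<xi>::real^2. 4 * gm * exp (- (\<tau> * \<bar>x $ 3\<bar>) * norm \<xi>))"
      by (intro integrable_mult_right integrable_exp_neg_norm) (use x \<tau> in \<open>simp add: mult_pos_neg\<close>)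
  qed (use rb g in \<open>auto simp del: mult_minus_left\<close>)
  define f where "f z \<xi> = exp (\<i> * complex_of_real (\<tau> * (\<xi> \<bullet> (hor x - z)))) * complex_of_real (r \<xi>) * complex_of_real (w z)" for z \<xi>
  have nf: "norm (f z \<xi>) = \<bar>w z\<bar> * \<bar>r \<xi>\<bar>" for z \<xi> by (simp add: f_def norm_mult)
  have fz: "(LINT \<xi>|lborel. f z \<xi>) = (LINT \<xi>|lborel. exp (\<i> * complex_of_real (\<tau> * (\<xi> \<bullet> (hor x - z)))) * complex_of_real (r \<xi>)) * complex_of_real (w z)" for z
    unfolding f_def by (rule integral_mult_left_zero)
  have "Phi_formula gm gp \<tau> x y = complex_of_real (\<tau> / (4 * pi * gp)) *
     (LINT z|lborel. complex_of_real (\<tau> / (2 * pi)^3 * (pi / gm)) * (LINT \<xi>|lborel. f z \<xi>))"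
    unfolding Phi_formula_def Etau_eq[OF g x \<tau>] fz r_def[symmetric] w_def[symmetric] by (simp only: mult.assoc)
  also have "\<dots> = complex_of_real (\<tau> / (4 * pi * gp) * (\<tau> / (2 * pi)^3 * (pi / gm))) * (LINT z|lborel. LINT \<xi>|lborel. f z \<xi>)"
    by simp
  also have "(LINT z|lborel. LINT \<xi>|lborel. f z \<xi>) = (LINT \<xi>|lborel. LINT z|lborel. f z \<xi>)"
  proof (rule lborel_integral_swap)
    show "case_prod f \<in> borel_measurable (borel \<Otimes>\<^sub>M borel)"
      unfolding f_def by (auto simp: case_prod_unfold)
    have mf: "f z \<in> borel_measurable borel" for z unfolding f_def by measurable
    show "integrable lborel (f z)" for z
      by (subst integrable_norm_iff[symmetric]) (use mf ri in \<open>auto simp: nf\<close>)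
    show "integrable lborel (\<lambda>z. LINT \<xi>|lborel. norm (f z \<xi>))"
      unfolding nf using wi by simp
  qed
  \<comment> \<open>The constant is 2 pi / \<tau> from the Yukawa transform times 4 from
    \<open>Rfun_vslow\<close>.\<close>
  also have "\<dots> = (LINT \<xi>|lborel. complex_of_real (2 * pi / \<tau> * 4) * (exp (\<i> * complex_of_real (\<tau> * (\<xi> \<bullet> (hor x - hor y)))) *
        complex_of_real (exp (- (\<tau> * (- x $ 3 * vslow gm \<xi> + y $ 3 * vslow gp \<xi>))) / (vslow gp \<xi> / gm + vslow gm \<xi> / gp))))"
  proof (intro Bochner_Integration.integral_cong refl)
    fix \<xi> :: "real^2"
    define S where "S = vslow gp \<xi>"
    have S: "S > 0" "vslow gm \<xi> > 0" using vslow_pos g by (auto simp: S_def)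
    have sq: "sqrt ((norm (- \<tau> *\<^sub>R \<xi>))\<^sup>2 + (\<tau> / sqrt gp)\<^sup>2) = \<tau> * S"
    proof -
      have "(norm (- \<tau> *\<^sub>R \<xi>))\<^sup>2 + (\<tau> / sqrt gp)\<^sup>2 = \<tau>\<^sup>2 * ((norm \<xi>)\<^sup>2 + 1 / gp)"
        using g by (simp add: power_mult_distrib power_divide algebra_simps)
      then show ?thesis using \<tau> by (simp add: S_def vslow_def real_sqrt_mult)
    qed
    have "(LINT z|lborel. f z \<xi>) = (LINT z|lborel. f (hor y + z) \<xi>)"
      by (rule lborel_integral_shift[symmetric]) (simp add: f_def)
    also have "\<dots> = (LINT z|lborel. exp (\<i> * complex_of_real (\<tau> * (\<xi> \<bullet> (hor x - hor y)))) * complex_of_real (r \<xi>) *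
        (exp (\<i> * complex_of_real ((- \<tau> *\<^sub>R \<xi>) \<bullet> z)) * complex_of_real (v z)))"
    proof (intro Bochner_Integration.integral_cong refl)
      fix z
      have "\<i> * complex_of_real (\<tau> * (\<xi> \<bullet> (hor x - (hor y + z)))) =
          \<i> * complex_of_real (\<tau> * (\<xi> \<bullet> (hor x - hor y))) + \<i> * complex_of_real ((- \<tau> *\<^sub>R \<xi>) \<bullet> z)"
        by (simp add: inner_diff_right inner_add_right algebra_simps)
      then show "f (hor y + z) \<xi> = exp (\<i> * complex_of_real (\<tau> * (\<xi> \<bullet> (hor x - hor y)))) * complex_of_real (r \<xi>) *
        (exp (\<i> * complex_of_real ((- \<tau> *\<^sub>R \<xi>) \<bullet> z)) * complex_of_real (v z))"
        by (simp only: f_def wv exp_add add_diff_cancel_left' mult_ac)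
    qed
    also have "\<dots> = exp (\<i> * complex_of_real (\<tau> * (\<xi> \<bullet> (hor x - hor y)))) * complex_of_real (r \<xi>) *
        complex_of_real (2 * pi * exp (- (y $ 3 * (\<tau> * S))) / (\<tau> * S))"
      unfolding integral_mult_right_zero v_def
      by (subst fourier_yukawa) (use g y \<tau> sq in auto)
    also have "\<dots> = exp (\<i> * complex_of_real (\<tau> * (\<xi> \<bullet> (hor x - hor y)))) * complex_of_real (r \<xi> * (2 * pi * exp (- (y $ 3 * (\<tau> * S))) / (\<tau> * S)))"
      by simp
    also have "r \<xi> * (2 * pi * exp (- (y $ 3 * (\<tau> * S))) / (\<tau> * S)) = 2 * pi / \<tau> * 4 * (exp (- (\<tau> * (- x $ 3 * vslow gm \<xi> + y $ 3 * vslow gp \<xi>))) / (vslow gp \<xi> / gm + vslow gm \<xi> / gp))"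
    proof -
      have "exp (- (\<tau> * (- x $ 3 * vslow gm \<xi> + y $ 3 * S))) = exp (- (\<tau> * \<bar>x $ 3\<bar> * vslow gm \<xi>)) * exp (- (y $ 3 * (\<tau> * S)))"
        using x by (simp add: exp_add[symmetric] algebra_simps)
      then show ?thesis
        using S unfolding r_def Rfun_vslow[OF g] S_def[symmetric] by simp (simp add: mult_ac)
    qed
    finally show "(LINT z|lborel. f z \<xi>) = complex_of_real (2 * pi / \<tau> * 4) * (exp (\<i> * complex_of_real (\<tau> * (\<xi> \<bullet> (hor x - hor y)))) *
        complex_of_real (exp (- (\<tau> * (- x $ 3 * vslow gm \<xi> + y $ 3 * vslow gp \<xi>))) / (vslow gp \<xi> / gm + vslow gm \<xi> / gp)))"
      by (simp add: mult_ac)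
  qed
  also have "\<dots> = complex_of_real (2 * pi / \<tau> * 4) * (LINT \<xi>|lborel. exp (\<i> * complex_of_real (\<tau> * (\<xi> \<bullet> (hor x - hor y)))) *
        complex_of_real (exp (- (\<tau> * (- x $ 3 * vslow gm \<xi> + y $ 3 * vslow gp \<xi>))) / (vslow gp \<xi> / gm + vslow gm \<xi> / gp)))"
    by (rule integral_mult_right_zero)
  finally have *: "Phi_formula gm gp \<tau> x y = complex_of_real (\<tau> / (4 * pi * gp) * (\<tau> / (2 * pi)^3 * (pi / gm))) * (complex_of_real (2 * pi / \<tau> * 4) *
     (LINT \<xi>|lborel. exp (\<i> * complex_of_real (\<tau> * (\<xi> \<bullet> (hor x - hor y)))) *
        complex_of_real (exp (- (\<tau> * (- x $ 3 * vslow gm \<xi> + y $ 3 * vslow gp \<xi>))) / (vslow gp \<xi> / gm + vslow gm \<xi> / gp))))" .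
  have c: "complex_of_real (\<tau> / (4 * pi * gp) * (\<tau> / (2 * pi)^3 * (pi / gm))) * complex_of_real (2 * pi / \<tau> * 4) = complex_of_real (\<tau> / (4 * pi\<^sup>2 * gm * gp))"
    unfolding of_real_mult[symmetric] using \<tau> g by (simp add: power3_eq_cube power2_eq_square)
  have "complex_of_real (\<tau> / (4 * pi * gp) * (\<tau> / (2 * pi)^3 * (pi / gm))) * (complex_of_real (2 * pi / \<tau> * 4) * J) =
      complex_of_real (\<tau> / (4 * pi\<^sup>2 * gm * gp)) * J" for J
    unfolding c[symmetric] by (rule mult.assoc[symmetric])
  then show ?thesis unfolding * .
qed

section \<open>The saddle point\<close>

lemma away_zero_indep:
  assumes "open U" "continuous_on U g" "\<And>u. u \<in> U \<Longrightarrow> g u \<noteq> 0"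
  shows "away_zero U (\<lambda>u \<eta>. g u)"
  unfolding away_zero_def
proof
  fix u assume u: "u \<in> U"
  have "isCont g u" using assms u by (simp add: continuous_on_eq_continuous_at)
  then have "((\<lambda>v. norm (g v)) \<longlongrightarrow> norm (g u)) (nhds u)"
    by (simp add: continuous_at tendsto_norm tendsto_at_iff_tendsto_nhds)
  moreover have "norm (g u) / 2 < norm (g u)" using assms(3)[OF u] by simp
  ultimately have "\<forall>\<^sub>F v in nhds u. norm (g u) / 2 < norm (g v)"
    by (rule order_tendstoD)
  then show "\<exists>c>0. \<forall>\<^sub>F v in nhds u. \<forall>\<eta>. c \<le> norm (g v)"
    using assms(3)[OF u] by (intro exI[of _ "norm (g u) / 2"]) (auto elim: eventually_mono)
qed

text \<open>Reduced to the complex root, so that the bootstrap is run only once.\<close>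

lemma moderate_sqrt:
  fixes f :: "'a::euclidean_space \<Rightarrow> 'e::euclidean_space \<Rightarrow> real"
  assumes "open U" and f: "moderate n U f" and az: "away_zero U f"
    and pos: "\<And>u \<eta>. u \<in> U \<Longrightarrow> f u \<eta> > 0"
  shows "moderate n U (\<lambda>u \<eta>. sqrt (f u \<eta>))"
proof -
  have "moderate n U (\<lambda>u \<eta>. csqrt (complex_of_real (f u \<eta>)))"
    by (rule moderate_csqrt[OF \<open>open U\<close> moderate_of_real[OF \<open>open U\<close> f]])
      (use az pos in \<open>auto simp: away_zero_def\<close>)
  from moderate_bounded_linear[OF \<open>open U\<close> bounded_linear_Re this] show ?thesis
    by (rule moderate_cong[OF \<open>open U\<close>]) (use pos in \<open>auto simp: less_imp_le\<close>)
qed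

text \<open>Continuity of q is known beforehand, which replaces a fixed point argument: the
  linearisation of F along (q v, v) is solved for q v - q w, after the error proportional to |q v -
  q w| has been absorbed.\<close>

lemma implicit_function_has_derivative:
  fixes F :: "real \<times> 'a::real_normed_vector \<Rightarrow> real" and q :: "'a \<Rightarrow> real"
  assumes F: "(F has_derivative F') (at (q w, w))" and c: "F' (1, 0) \<noteq> 0"
    and q: "isCont q w" and ev: "\<forall>\<^sub>F v in nhds w. F (q v, v) = 0"
  shows "(q has_derivative (\<lambda>v. - F' (0, v) / F' (1, 0))) (at w)"
proof -
  define c where "c = F' (1, 0)"
  have c0: "c \<noteq> 0" using assms(2) by (simp add: c_def)
  have bl: "bounded_linear F'" using F by (rule has_derivative_bounded_linear)
  interpret bounded_linear F' by (rule bl)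
  have split: "F' (s, v) = s * c + F' (0, v)" for s v
    using add[of "(s, 0)" "(0, v)"] scaleR[of s "(1, 0)"] by (simp add: c_def)
  have F0: "F (q w, w) = 0" using eventually_nhds_x_imp_x[OF ev] .
  obtain K where K: "K > 0" "\<And>z. norm (F' z) \<le> norm z * K" using pos_bounded by blast
  have K0: "\<bar>F' (0, v)\<bar> \<le> norm v * K" for v using K(2)[of "(0, v)"] by (simp add: norm_Pair)
  have bl0: "bounded_linear (\<lambda>v. - F' (0, v) / F' (1, 0))"
    by (intro bounded_linear_divide[THEN bounded_linear_compose] bounded_linear_minus bounded_linear_compose[OF bl] bounded_linear_Pair bounded_linear_zero bounded_linear_ident)
  show ?thesis
    unfolding has_derivative_at_alt
  proof (intro conjI bl0 allI impI)
    fix e :: real assume e: "e > 0"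
    \<comment> \<open>\<open>M\<close> is the constant in |s| + |v - w| <= M |v - w|. The first
      bound built into \<open>\<epsilon>\<close> lets half of |s| |c| be absorbed on the left, which
      yields this inequality; the second bound turns it into the error e.\<close>
    define M where "M = 1 + 2 * (K + \<bar>c\<bar>) / \<bar>c\<bar>"
    have M: "M > 0" using K c0 by (auto simp: M_def intro!: add_pos_nonneg divide_nonneg_nonneg)
    define \<epsilon> where "\<epsilon> = min (\<bar>c\<bar> / 2) (e * \<bar>c\<bar> / M)"
    have \<epsilon>: "\<epsilon> > 0" "\<epsilon> \<le> \<bar>c\<bar> / 2" "\<epsilon> * M \<le> e * \<bar>c\<bar>" using c0 e M by (auto simp: \<epsilon>_def min_def field_simps)
    obtain d where d: "d > 0" "\<And>z. norm (z - (q w, w)) < d \<Longrightarrow> norm (F z - F (q w, w) - F' (z - (q w, w))) \<le> \<epsilon> * norm (z - (q w, w))"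
      using F \<epsilon>(1) unfolding has_derivative_at_alt by blast
    have "((\<lambda>v. (q v, v)) \<longlongrightarrow> (q w, w)) (nhds w)"
      using q by (intro tendsto_intros) (auto simp: continuous_at tendsto_at_iff_tendsto_nhds filterlim_ident)
    then have "\<forall>\<^sub>F v in nhds w. dist (q v, v) (q w, w) < d" using d(1) by (rule tendstoD)
    with ev have "\<forall>\<^sub>F v in nhds w. norm (q v - q w - (- F' (0, v - w) / F' (1, 0))) \<le> e * norm (v - w)"
    proof eventually_elim
      case (elim v)
      define s where "s = q v - q w"
      have dif: "(q v, v) - (q w, w) = (s, v - w)" by (simp add: s_def)
      have "norm (F (q v, v) - F (q w, w) - F' ((q v, v) - (q w, w))) \<le> \<epsilon> * norm ((q v, v) - (q w, w))"
        by (rule d(2)) (use elim(2) in \<open>simp add: dist_norm\<close>)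
      then have 1: "\<bar>s * c + F' (0, v - w)\<bar> \<le> \<epsilon> * norm (s, v - w)"
        unfolding elim(1) F0 dif split[of s "v - w"] by simp
      have 2: "norm (s, v - w) \<le> \<bar>s\<bar> + norm (v - w)" using norm_Pair_le[of s "v - w"] by simp
      have nn: "0 \<le> \<bar>s\<bar> + norm (v - w)" by simp
      have 3: "\<bar>s * c + F' (0, v - w)\<bar> \<le> \<epsilon> * (\<bar>s\<bar> + norm (v - w))"
        using 1 mult_left_mono[OF 2 less_imp_le[OF \<epsilon>(1)]] by linarith
      have "\<bar>s\<bar> * \<bar>c\<bar> \<le> \<bar>F' (0, v - w)\<bar> + \<bar>s * c + F' (0, v - w)\<bar>" by (simp add: abs_mult[symmetric])
      also have "\<dots> \<le> norm (v - w) * K + (\<bar>c\<bar> / 2) * (\<bar>s\<bar> + norm (v - w))"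
        using K0[of "v - w"] 3 mult_right_mono[OF \<epsilon>(2) nn] by linarith
      finally have "\<bar>s\<bar> * \<bar>c\<bar> \<le> K * norm (v - w) + (\<bar>s\<bar> * \<bar>c\<bar>) / 2 + (\<bar>c\<bar> * norm (v - w)) / 2"
        by (simp add: algebra_simps)
      then have "\<bar>s\<bar> * \<bar>c\<bar> \<le> 2 * (K * norm (v - w)) + 2 * (\<bar>c\<bar> * norm (v - w))"
        using mult_nonneg_nonneg[OF abs_ge_zero[of c] norm_ge_zero[of "v - w"]] by linarith
      then have "\<bar>s\<bar> * \<bar>c\<bar> \<le> 2 * (K + \<bar>c\<bar>) * norm (v - w)" by (simp add: algebra_simps)
      then have "\<bar>s\<bar> \<le> 2 * (K + \<bar>c\<bar>) / \<bar>c\<bar> * norm (v - w)" using c0 by (simp add: field_simps)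
      then have 4: "\<bar>s\<bar> + norm (v - w) \<le> M * norm (v - w)" by (simp add: M_def algebra_simps)
      have "\<bar>s * c + F' (0, v - w)\<bar> \<le> \<epsilon> * (M * norm (v - w))"
        using 3 mult_left_mono[OF 4 less_imp_le[OF \<epsilon>(1)]] by linarith
      also have "\<dots> \<le> e * \<bar>c\<bar> * norm (v - w)"
        using mult_right_mono[OF \<epsilon>(3), of "norm (v - w)"] by (simp add: mult_ac)
      finally have 5: "\<bar>s * c + F' (0, v - w)\<bar> \<le> e * \<bar>c\<bar> * norm (v - w)" .
      have "q v - q w - (- F' (0, v - w) / F' (1, 0)) = (s * c + F' (0, v - w)) / c"
        using c0 by (simp add: s_def c_def field_simps)
      then have "norm (q v - q w - (- F' (0, v - w) / F' (1, 0))) = \<bar>s * c + F' (0, v - w)\<bar> / \<bar>c\<bar>" by simp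
      also have "\<dots> \<le> e * norm (v - w)" using 5 c0 by (simp add: divide_le_eq mult_ac)
      finally show ?case .
    qed
    then show "\<exists>d>0. \<forall>y. norm (y - w) < d \<longrightarrow> norm (q y - q w - (- F' (0, y - w) / F' (1, 0))) \<le> e * norm (y - w)"
      unfolding eventually_nhds_metric by (simp add: dist_norm)
  qed
qed

section \<open>Snell's law: existence, uniqueness and differentiability of the slowness\<close>

locale two_layers =
  fixes gm gp :: real
  assumes gm: "0 < gm" and gmp: "gm < gp"
begin

lemma gp: "0 < gp" using gm gmp by simp
lemma inv_less: "1 / gp < 1 / gm" using gm gmp by (simp add: frac_less2)

definition W :: "((real^3) \<times> (real^3)) set" where "W = lower_half \<times> upper_half"
definition depth :: "(real^3) \<times> (real^3) \<Rightarrow> real" where "depth w = - fst w $ 3"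
definition height :: "(real^3) \<times> (real^3) \<Rightarrow> real" where "height w = snd w $ 3"
definition offset :: "(real^3) \<times> (real^3) \<Rightarrow> real^2" where "offset w = hor (fst w) - hor (snd w)"

text \<open>A ray with horizontal slowness p, |p|^2 = q, covers the horizontal displacement
  \<open>spread q w\<close> times p between the two end heights; comparing it with the offset gives
  the equation for q.\<close>

definition spread :: "real \<Rightarrow> (real^3) \<times> (real^3) \<Rightarrow> real" where
  "spread q w = depth w / sqrt (1 / gm - q) + height w / sqrt (1 / gp - q)"

text \<open>The saddle point is \<open>\<i> p\<close> with \<open>p\<close> parallel to \<open>x' - y'\<close> (\<open>slow_hor\<close> below), and \<open>slow_sq\<close> is
  \<open>|p|\<^sup>2\<close>; \<open>slow_lo\<close> and \<open>slow_up\<close> are the vertical slownesses in the two half spaces. The equation is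
  Snell's law.\<close>

definition slow_sq :: "(real^3) \<times> (real^3) \<Rightarrow> real" where
  "slow_sq w = (THE q. 0 \<le> q \<and> q < 1 / gp \<and> q * (spread q w)\<^sup>2 = (norm (offset w))\<^sup>2)"

lemma open_W: "open W"
proof -
  have "open {x::real^3. x $ 3 < 0}" "open {x::real^3. x $ 3 > 0}"
    by (intro open_Collect_less continuous_intros)+
  then show ?thesis unfolding W_def lower_half_def upper_half_def by (rule open_Times)
qed

lemma hk_pos: "w \<in> W \<Longrightarrow> depth w > 0" "w \<in> W \<Longrightarrow> height w > 0"
  by (auto simp: W_def depth_def height_def lower_half_def upper_half_def)

lemma spread_pos:
  assumes "w \<in> W" "q < 1 / gp" shows "spread q w > 0"
  using assms hk_pos[OF assms(1)] inv_less by (auto simp: spread_def intro!: add_pos_pos)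

text \<open>The vertical slownesses decrease in q, so \<open>spread\<close> increases. Besides
  uniqueness of the root this gives a sign test: the value at a tells on which side of a the root
  lies.\<close>

lemma spread_strict_mono:
  assumes w: "w \<in> W" and q: "0 \<le> q1" "q1 < q2" "q2 < 1 / gp"
  shows "q1 * (spread q1 w)\<^sup>2 < q2 * (spread q2 w)\<^sup>2"
proof -
  have "spread q1 w \<le> spread q2 w"
    unfolding spread_def using q inv_less hk_pos[OF w] by (intro add_mono divide_left_mono mult_pos_pos) auto
  then have "(spread q1 w)\<^sup>2 \<le> (spread q2 w)\<^sup>2" using spread_pos[OF w, of q1] q by (intro power_mono) auto
  then have "q1 * (spread q1 w)\<^sup>2 \<le> q1 * (spread q2 w)\<^sup>2" using q by (intro mult_left_mono)
  also have "\<dots> < q2 * (spread q2 w)\<^sup>2" using spread_pos[OF w q(3)] q by (intro mult_strict_right_mono) auto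
  finally show ?thesis .
qed

lemma slow_sq_ex1:
  assumes w: "w \<in> W"
  shows "\<exists>!q. 0 \<le> q \<and> q < 1 / gp \<and> q * (spread q w)\<^sup>2 = (norm (offset w))\<^sup>2"
proof (rule ex_ex1I)
  define D where "D = (norm (offset w))\<^sup>2"
  \<comment> \<open>\<open>Q\<close> solves the equation with only the upper layer kept, Q height^2
    / (1 / gp - Q) = D. The lower layer can only increase the left side, so at \<open>Q\<close> it
    has reached \<open>D\<close>, and the intermediate value theorem applies on [0, Q], below the
    singularity at 1 / gp.\<close>
  define Q where "Q = 1 / gp * (D / ((height w)\<^sup>2 + D))"
  have k: "(height w)\<^sup>2 > 0" and D: "D \<ge> 0" using hk_pos[OF w] by (auto simp: D_def)
  have Q: "0 \<le> Q" "Q < 1 / gp"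
  proof -
    have "D / ((height w)\<^sup>2 + D) < 1" using add_pos_nonneg[OF k D] k by (intro divide_less_eq_1_pos[THEN iffD2]) linarith+
    then show "Q < 1 / gp" unfolding Q_def using gp mult_strict_left_mono[of "D / ((height w)\<^sup>2 + D)" 1 "1 / gp"] by simp
  qed (use k D gp in \<open>simp add: Q_def\<close>)
  have kD: "(height w)\<^sup>2 + D > 0" by (rule add_pos_nonneg[OF k D])
  have e: "1 / gp - Q = 1 / gp * ((height w)\<^sup>2 / ((height w)\<^sup>2 + D))" 
  proof -
    have "(height w)\<^sup>2 / ((height w)\<^sup>2 + D) + D / ((height w)\<^sup>2 + D) = 1" using kD by (simp add: add_divide_distrib[symmetric])
    then have "(height w)\<^sup>2 / ((height w)\<^sup>2 + D) = 1 - D / ((height w)\<^sup>2 + D)" by linarith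
    then show ?thesis by (simp only: Q_def) (simp add: right_diff_distrib)
  qed
  have "D = Q * (height w / sqrt (1 / gp - Q))\<^sup>2"
  proof -
    have "(height w / sqrt (1 / gp - Q))\<^sup>2 = (height w)\<^sup>2 / (1 / gp - Q)" using Q by (simp add: power_divide)
    also have "\<dots> = gp * ((height w)\<^sup>2 + D)" unfolding e using k kD gp by simp
    finally show ?thesis using kD gp by (simp add: Q_def)
  qed
  also have "\<dots> \<le> Q * (spread Q w)\<^sup>2"
    using Q hk_pos[OF w] inv_less by (intro mult_left_mono power_mono) (auto simp: spread_def)
  finally have le: "D \<le> Q * (spread Q w)\<^sup>2" .
  have "continuous_on {0..Q} (\<lambda>q. q * (spread q w)\<^sup>2)"
    unfolding spread_def using Q inv_less by (intro continuous_intros) auto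
  then have "\<exists>q. 0 \<le> q \<and> q \<le> Q \<and> q * (spread q w)\<^sup>2 = D"
    using IVT'[of "\<lambda>q. q * (spread q w)\<^sup>2" 0 D Q] le Q D by auto
  then show "\<exists>q. 0 \<le> q \<and> q < 1 / gp \<and> q * (spread q w)\<^sup>2 = (norm (offset w))\<^sup>2"
    using Q unfolding D_def by force
next
  fix q q' assume "0 \<le> q \<and> q < 1 / gp \<and> q * (spread q w)\<^sup>2 = (norm (offset w))\<^sup>2" "0 \<le> q' \<and> q' < 1 / gp \<and> q' * (spread q' w)\<^sup>2 = (norm (offset w))\<^sup>2"
  then show "q = q'" using spread_strict_mono[OF w, of q q'] spread_strict_mono[OF w, of q' q] by (cases q q' rule: linorder_cases) auto
qed

lemma slow_sq:
  assumes "w \<in> W" shows "0 \<le> slow_sq w" "slow_sq w < 1 / gp" "slow_sq w * (spread (slow_sq w) w)\<^sup>2 = (norm (offset w))\<^sup>2"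
  using theI'[OF slow_sq_ex1[OF assms]] unfolding slow_sq_def by auto

lemma offset_linear: "bounded_linear offset"
proof -
  have "linear offset" unfolding offset_def by (intro linearI) (auto simp: vec_eq_iff forall_2 algebra_simps)
  then show ?thesis by (simp add: linear_conv_bounded_linear)
qed

lemma depth_linear: "bounded_linear depth"
proof -
  have "linear depth" unfolding depth_def by (intro linearI) (auto simp: algebra_simps)
  then show ?thesis by (simp add: linear_conv_bounded_linear)
qed

lemma height_linear: "bounded_linear height"
proof -
  have "linear height" unfolding height_def by (intro linearI) (auto simp: algebra_simps)
  then show ?thesis by (simp add: linear_conv_bounded_linear)
qed

lemma continuous_spread:
  assumes "w \<in> W" shows "isCont (\<lambda>v. q * (spread q v)\<^sup>2 - (norm (offset v))\<^sup>2) w"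
  unfolding spread_def divide_inverse
  by (intro continuous_intros linear_continuous_at offset_linear depth_linear height_linear)

text \<open>The sign test of \<open>spread_strict_mono\<close> at a fixed a is a strict inequality
  between continuous functions of the end points, hence it persists nearby.\<close>

lemma isCont_slow_sq:
  assumes w: "w \<in> W" shows "isCont slow_sq w"
  unfolding continuous_at tendsto_at_iff_tendsto_nhds
proof (rule order_tendstoI)
  have evW: "\<forall>\<^sub>F v in nhds w. v \<in> W" using open_W w by (rule eventually_nhds_in_open)
  have lim: "((\<lambda>v. q * (spread q v)\<^sup>2 - (norm (offset v))\<^sup>2) \<longlongrightarrow> q * (spread q w)\<^sup>2 - (norm (offset w))\<^sup>2) (nhds w)" for q
    using continuous_spread[OF w, of q] tendsto_at_iff_tendsto_nhds[of "\<lambda>v. q * (spread q v)\<^sup>2 - (norm (offset v))\<^sup>2" w]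
    by (simp add: continuous_at)
  fix a assume a: "a < slow_sq w"
  show "\<forall>\<^sub>F v in nhds w. a < slow_sq v"
  proof (cases "a < 0")
    case True
    show ?thesis using evW by eventually_elim (use True slow_sq(1) in force)
  next
    case False
    have "a * (spread a w)\<^sup>2 - (norm (offset w))\<^sup>2 < 0" using spread_strict_mono[OF w _ a] slow_sq[OF w] False by simp
    from order_tendstoD(2)[OF lim this] evW show ?thesis
    proof eventually_elim
      case (elim v)
      have "a < 1 / gp" using a slow_sq(2)[OF w] by simp
      then show ?case using spread_strict_mono[OF elim(2) slow_sq(1)[OF elim(2)], of a] slow_sq(3)[OF elim(2)] elim(1)
        by (cases "slow_sq v" a rule: linorder_cases) auto
    qed
  qed
next
  have evW: "\<forall>\<^sub>F v in nhds w. v \<in> W" using open_W w by (rule eventually_nhds_in_open)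
  have lim: "((\<lambda>v. q * (spread q v)\<^sup>2 - (norm (offset v))\<^sup>2) \<longlongrightarrow> q * (spread q w)\<^sup>2 - (norm (offset w))\<^sup>2) (nhds w)" for q
    using continuous_spread[OF w, of q] tendsto_at_iff_tendsto_nhds[of "\<lambda>v. q * (spread q v)\<^sup>2 - (norm (offset v))\<^sup>2" w]
    by (simp add: continuous_at)
  fix a assume a: "slow_sq w < a"
  \<comment> \<open>\<open>a\<close> may lie beyond 1 / gp, out of reach of
    \<open>spread_strict_mono\<close>; \<open>b\<close> pulls it back between the root and 1 /
    gp.\<close>
  define b where "b = min a ((slow_sq w + 1 / gp) / 2)"
  have b: "slow_sq w < b" "b < 1 / gp" "b \<le> a" using a slow_sq(2)[OF w] by (auto simp: b_def min_def field_simps)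
  have "b * (spread b w)\<^sup>2 - (norm (offset w))\<^sup>2 > 0" using spread_strict_mono[OF w slow_sq(1)[OF w] b(1,2)] slow_sq[OF w] by simp
  from order_tendstoD(1)[OF lim this] evW show "\<forall>\<^sub>F v in nhds w. slow_sq v < a"
  proof eventually_elim
    case (elim v)
    have "0 \<le> b" using b slow_sq(1)[OF w] by simp
    then have "slow_sq v < b" using spread_strict_mono[OF elim(2) _ _ slow_sq(2)[OF elim(2)], of b] slow_sq(3)[OF elim(2)] elim(1)
      by (cases "slow_sq v" b rule: linorder_cases) auto
    then show ?case using b by simp
  qed
qed

definition slow_lo :: "(real^3) \<times> (real^3) \<Rightarrow> real" where "slow_lo w = sqrt (1 / gm - slow_sq w)"
definition slow_up :: "(real^3) \<times> (real^3) \<Rightarrow> real" where "slow_up w = sqrt (1 / gp - slow_sq w)"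
definition spread_saddle :: "(real^3) \<times> (real^3) \<Rightarrow> real" where "spread_saddle w = depth w / slow_lo w + height w / slow_up w"
definition slow_hor :: "(real^3) \<times> (real^3) \<Rightarrow> real^2" where "slow_hor w = inverse (spread_saddle w) *\<^sub>R offset w"

lemma slow_lo_pos: "w \<in> W \<Longrightarrow> slow_lo w > 0" and slow_up_pos: "w \<in> W \<Longrightarrow> slow_up w > 0"
  using slow_sq[of w] inv_less by (auto simp: slow_lo_def slow_up_def)

lemma slow_lo_sq: "w \<in> W \<Longrightarrow> (slow_lo w)\<^sup>2 = 1 / gm - slow_sq w" and slow_up_sq: "w \<in> W \<Longrightarrow> (slow_up w)\<^sup>2 = 1 / gp - slow_sq w"
  using slow_sq[of w] inv_less by (auto simp: slow_lo_def slow_up_def)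

lemma spread_saddle_eq: "spread_saddle w = spread (slow_sq w) w" by (simp add: spread_saddle_def spread_def slow_lo_def slow_up_def)

lemma spread_saddle_pos: "w \<in> W \<Longrightarrow> spread_saddle w > 0" using spread_pos slow_sq(2) by (simp add: spread_saddle_eq)

lemma slow_hor_offset: "w \<in> W \<Longrightarrow> offset w = spread_saddle w *\<^sub>R slow_hor w" using spread_saddle_pos[of w] by (simp add: slow_hor_def)

lemma norm_slow_hor: "w \<in> W \<Longrightarrow> (norm (slow_hor w))\<^sup>2 = slow_sq w"
  using slow_sq(3)[of w] spread_saddle_pos[of w] by (simp add: slow_hor_def spread_saddle_eq power_mult_distrib field_simps)

text \<open>The quotient from implicit differentiation of q spread^2 = |offset|^2, written with
  products and \<open>inverse\<close> so that the closure lemmas for \<open>moderate\<close> apply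
  to it.\<close>

definition dslow_sq :: "(real^3) \<times> (real^3) \<Rightarrow> (real^3) \<times> (real^3) \<Rightarrow> real" where
  "dslow_sq w v = (2 * (offset w \<bullet> offset v) - 2 * slow_sq w * spread_saddle w * (depth v * inverse (slow_lo w) + height v * inverse (slow_up w))) *
     inverse ((spread_saddle w)\<^sup>2 + slow_sq w * spread_saddle w * (depth w * inverse (slow_lo w) ^ 3 + height w * inverse (slow_up w) ^ 3))"

text \<open>This is the q-derivative of q spread^2, the number by which implicit differentiation
  divides.\<close>

lemma dslow_sq_denominator_pos:
  "w \<in> W \<Longrightarrow> (spread_saddle w)\<^sup>2 + slow_sq w * spread_saddle w * (depth w * inverse (slow_lo w) ^ 3 + height w * inverse (slow_up w) ^ 3) > 0"
  using spread_saddle_pos[of w] slow_sq(1)[of w] slow_lo_pos[of w] slow_up_pos[of w] hk_pos[of w]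
  by (intro add_pos_nonneg mult_nonneg_nonneg add_nonneg_nonneg) auto

lemma slow_sq_has_derivative:
  assumes w: "w \<in> W" shows "(slow_sq has_derivative dslow_sq w) (at w)"
proof -
  \<comment> \<open>Snell's equation as a function of (q, w), with reciprocals and inner products in
    place of quotients and norms to suit the derivative rules.\<close>
  define F where "F z = fst z * (depth (snd z) * inverse (sqrt (1 / gm - fst z)) + height (snd z) * inverse (sqrt (1 / gp - fst z)))\<^sup>2 - offset (snd z) \<bullet> offset (snd z)" for z :: "real \<times> ((real^3) \<times> (real^3))"
  define F' where "F' d = fst d * (spread_saddle w)\<^sup>2 + slow_sq w * (2 * spread_saddle w * (depth (snd d) * inverse (slow_lo w) + depth w * (fst d * inverse (slow_lo w) ^ 3 / 2)
      + (height (snd d) * inverse (slow_up w) + height w * (fst d * inverse (slow_up w) ^ 3 / 2)))) - 2 * (offset w \<bullet> offset (snd d))" for d :: "real \<times> ((real^3) \<times> (real^3))"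
  have inv: "((\<lambda>z. inverse (sqrt (c - fst z))) has_derivative (\<lambda>d. fst d * inverse (sqrt (c - slow_sq w)) ^ 3 / 2)) (at (slow_sq w, w))" if "c - slow_sq w > 0" for c
  proof -
    have "((\<lambda>q. inverse (sqrt (c - q))) has_real_derivative inverse (sqrt (c - slow_sq w)) ^ 3 / 2) (at (slow_sq w))"
      using that by (auto intro!: derivative_eq_intros simp: power3_eq_cube field_simps)
    then have "((\<lambda>q. inverse (sqrt (c - q))) has_derivative (*) (inverse (sqrt (c - slow_sq w)) ^ 3 / 2)) (at (fst (slow_sq w, w)))"
      by (simp add: has_field_derivative_def)
    from has_derivative_compose[OF has_derivative_fst[OF has_derivative_ident] this] show ?thesis
      by (simp add: mult.commute)
  qed
  have iA: "((\<lambda>z. inverse (sqrt (1 / gm - fst z))) has_derivative (\<lambda>d. fst d * inverse (slow_lo w) ^ 3 / 2)) (at (slow_sq w, w))"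
    unfolding slow_lo_def by (rule inv) (use slow_sq[OF w] inv_less in simp)
  have iB: "((\<lambda>z. inverse (sqrt (1 / gp - fst z))) has_derivative (\<lambda>d. fst d * inverse (slow_up w) ^ 3 / 2)) (at (slow_sq w, w))"
    unfolding slow_up_def by (rule inv) (use slow_sq[OF w] inv_less in simp)
  have L: "((\<lambda>z. f (snd z)) has_derivative (\<lambda>d. f (snd d))) (at (slow_sq w, w))" if "bounded_linear f" for f :: "(real^3) \<times> (real^3) \<Rightarrow> 'b::real_normed_vector"
    by (rule bounded_linear.has_derivative[OF that has_derivative_snd[OF has_derivative_ident]])
  have d1: "((\<lambda>z. depth (snd z) * inverse (sqrt (1 / gm - fst z))) has_derivative
      (\<lambda>d. depth w * (fst d * inverse (slow_lo w) ^ 3 / 2) + depth (snd d) * inverse (slow_lo w))) (at (slow_sq w, w))"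
    using has_derivative_mult[OF L[OF depth_linear] iA] by (simp add: slow_lo_def)
  have d2: "((\<lambda>z. height (snd z) * inverse (sqrt (1 / gp - fst z))) has_derivative
      (\<lambda>d. height w * (fst d * inverse (slow_up w) ^ 3 / 2) + height (snd d) * inverse (slow_up w))) (at (slow_sq w, w))"
    using has_derivative_mult[OF L[OF height_linear] iB] by (simp add: slow_up_def)
  define S where "S z = depth (snd z) * inverse (sqrt (1 / gm - fst z)) + height (snd z) * inverse (sqrt (1 / gp - fst z))" for z
  define S' where "S' d = (depth w * (fst d * inverse (slow_lo w) ^ 3 / 2) + depth (snd d) * inverse (slow_lo w)) +
      (height w * (fst d * inverse (slow_up w) ^ 3 / 2) + height (snd d) * inverse (slow_up w))" for d
  have S: "(S has_derivative S') (at (slow_sq w, w))"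
    unfolding S_def S'_def by (rule has_derivative_add[OF d1 d2])
  have Sw: "S (slow_sq w, w) = spread_saddle w" by (simp add: S_def spread_saddle_def slow_lo_def slow_up_def divide_inverse)
  have FS: "F = (\<lambda>z. fst z * (S z * S z) - offset (snd z) \<bullet> offset (snd z))"
    by (simp add: F_def S_def fun_eq_iff power2_eq_square)
  have d3: "((\<lambda>z. fst z * (S z * S z)) has_derivative (\<lambda>d. slow_sq w * (spread_saddle w * S' d + S' d * spread_saddle w) + fst d * (spread_saddle w * spread_saddle w))) (at (slow_sq w, w))"
    using has_derivative_mult[OF has_derivative_fst[OF has_derivative_ident] has_derivative_mult[OF S S]] by (simp add: Sw)
  have d4: "((\<lambda>z. offset (snd z) \<bullet> offset (snd z)) has_derivative (\<lambda>d. offset w \<bullet> offset (snd d) + offset (snd d) \<bullet> offset w)) (at (slow_sq w, w))"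
    using has_derivative_inner[OF L[OF offset_linear] L[OF offset_linear]] by simp
  have F: "(F has_derivative F') (at (slow_sq w, w))"
    unfolding FS using has_derivative_diff[OF d3 d4]
    by (rule has_derivative_eq_rhs) (simp add: F'_def S'_def fun_eq_iff inner_commute power2_eq_square algebra_simps)
  have F'1: "F' (1, 0) = (spread_saddle w)\<^sup>2 + slow_sq w * spread_saddle w * (depth w * inverse (slow_lo w) ^ 3 + height w * inverse (slow_up w) ^ 3)"
    using linear_0[OF bounded_linear.linear[OF depth_linear]] linear_0[OF bounded_linear.linear[OF height_linear]] linear_0[OF bounded_linear.linear[OF offset_linear]]
    by (simp add: F'_def algebra_simps)
  have "(slow_sq has_derivative (\<lambda>v. - F' (0, v) / F' (1, 0))) (at w)"
  proof (rule implicit_function_has_derivative[OF F _ isCont_slow_sq[OF w]])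
    show "F' (1, 0) \<noteq> 0" unfolding F'1 using dslow_sq_denominator_pos[OF w] by simp
    have "F (slow_sq v, v) = 0" if "v \<in> W" for v
      using slow_sq(3)[OF that] by (simp add: F_def spread_def divide_inverse power2_norm_eq_inner)
    then show "\<forall>\<^sub>F v in nhds w. F (slow_sq v, v) = 0"
      using eventually_nhds_in_open[OF open_W w] by (auto elim: eventually_mono)
  qed
  moreover have "(\<lambda>v. - F' (0, v) / F' (1, 0)) = dslow_sq w"
  proof
    fix v
    have "- F' (0, v) = 2 * (offset w \<bullet> offset v) - 2 * slow_sq w * spread_saddle w * (depth v * inverse (slow_lo w) + height v * inverse (slow_up w))"
      by (simp add: F'_def algebra_simps)
    then show "- F' (0, v) / F' (1, 0) = dslow_sq w v" unfolding F'1 dslow_sq_def divide_inverse by (simp only:)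
  qed
  ultimately show ?thesis by simp
qed

end

text \<open>Used with L = \<open>snd\<close>, to view functions of the end points as functions of
  (\<epsilon>, x, y).\<close>

lemma moderate_compose_linear:
  assumes "open W" "open U" and L: "bounded_linear L" and LU: "\<And>u. u \<in> U \<Longrightarrow> L u \<in> W"
    and f: "moderate n W f"
  shows "moderate n U (\<lambda>u \<eta>. f (L u) \<eta>)"
  using f
proof (induction n arbitrary: f)
  case 0
  have "continuous_on (U \<times> UNIV) (\<lambda>z. (\<lambda>(u, \<eta>). f u \<eta>) (L (fst z), snd z))"
    using LU by (intro continuous_on_compose2[OF moderate_0(1)[OF 0]] continuous_intros
        bounded_linear.continuous_on[OF L]) auto
  moreover have "poly_bdd U (\<lambda>u \<eta>. f (L u) \<eta>)"
  proof (rule poly_bddI)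
    fix u assume u: "u \<in> U"
    obtain C m where C: "C \<ge> 0" "\<forall>\<^sub>F v in nhds (L u). \<forall>\<eta>. norm (f v \<eta>) \<le> C * (1 + norm \<eta>) ^ m"
      using poly_bddE[OF moderate_0(2)[OF 0] LU[OF u]] .
    have "filterlim L (nhds (L u)) (nhds u)"
      using linear_continuous_at[OF L, of u] by (simp add: continuous_at tendsto_at_iff_tendsto_nhds)
    from eventually_compose_filterlim[OF C(2) this] C(1)
    show "\<exists>C m. 0 \<le> C \<and> (\<forall>\<^sub>F v in nhds u. \<forall>\<eta>. norm (f (L v) \<eta>) \<le> C * (1 + norm \<eta>) ^ m)" by blast
  qed
  ultimately show ?case by (simp add: case_prod_unfold)
next
  case (Suc n)
  have "moderate n W f" using Suc.prems by (rule moderate_Suc_imp)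
  then have 0: "moderate 0 U (\<lambda>u \<eta>. f (L u) \<eta>)" using Suc.IH moderate_0(3) by blast
  show ?case
  proof (rule moderate_SucI[OF \<open>open U\<close> 0])
    show "((\<lambda>u. f (L u) \<eta>) has_derivative (\<lambda>v. frechet_derivative (\<lambda>u. f u \<eta>) (at (L u)) (L v))) (at u)" if "u \<in> U" for u \<eta>
      by (rule has_derivative_compose[OF bounded_linear_imp_has_derivative[OF L] moderate_SucD[OF Suc.prems LU[OF that]]])
    show "moderate n U (\<lambda>u \<eta>. frechet_derivative (\<lambda>u. f u \<eta>) (at (L u)) (L v))" for v
      by (rule Suc.IH[of "\<lambda>w \<eta>. frechet_derivative (\<lambda>u. f u \<eta>) (at w) (L v)"]) (rule moderate_SucD2[OF Suc.prems])
  qed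
qed

section \<open>Hessian of the travel time along a broken path\<close>

lemma has_derivative_dist_plane:
  fixes c :: "'a::real_inner" assumes "s > 0"
  shows "((\<lambda>z. sqrt ((norm (z - c))\<^sup>2 + s)) has_derivative (\<lambda>v. ((z - c) \<bullet> v) / sqrt ((norm (z - c))\<^sup>2 + s))) (at z)"
proof -
  have p: "(norm (z - c))\<^sup>2 + s > 0" using assms by (simp add: add_nonneg_pos)
  have "((\<lambda>z. (z - c) \<bullet> (z - c) + s) has_derivative (\<lambda>v. 2 * ((z - c) \<bullet> v))) (at z)"
    by (rule has_derivative_eq_rhs) (auto intro!: derivative_eq_intros simp: inner_commute)
  then have d: "((\<lambda>z. (norm (z - c))\<^sup>2 + s) has_derivative (\<lambda>v. 2 * ((z - c) \<bullet> v))) (at z)"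
    by (simp add: power2_norm_eq_inner)
  have "(sqrt has_derivative (*) (inverse (sqrt ((norm (z - c))\<^sup>2 + s)) / 2)) (at ((norm (z - c))\<^sup>2 + s))"
    using DERIV_real_sqrt[OF p] by (simp add: has_field_derivative_def)
  from has_derivative_compose[OF d this] show ?thesis
    by (simp add: field_simps)
qed

lemma has_derivative_dist_plane2:
  fixes c :: "'a::real_inner" assumes "s > 0"
  shows "((\<lambda>z. ((z - c) \<bullet> v) / sqrt ((norm (z - c))\<^sup>2 + s)) has_derivative
    (\<lambda>u. (u \<bullet> v) / sqrt ((norm (z - c))\<^sup>2 + s) - ((z - c) \<bullet> v) * ((z - c) \<bullet> u) / sqrt ((norm (z - c))\<^sup>2 + s) ^ 3)) (at z)"
proof -
  have p: "sqrt ((norm (z - c))\<^sup>2 + s) \<noteq> 0" using assms by (simp add: add_nonneg_pos less_imp_neq[symmetric])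
  have d: "((\<lambda>z. (z - c) \<bullet> v) has_derivative (\<lambda>u. u \<bullet> v)) (at z)"
    by (auto intro!: derivative_eq_intros)
  have e: "(x * r - a * (b / r)) / (r * r) = x / r - a * b / r ^ 3" if "r \<noteq> 0" for x r a b :: real
    using that by (simp add: divide_simps power3_eq_cube)
  show ?thesis
    using has_derivative_divide'[OF d has_derivative_dist_plane[OF assms] p] unfolding e[OF p] .
qed

lemma Hess_lpath:
  fixes x y :: "real^3" and z :: "real^2"
  assumes "x $ 3 \<noteq> 0" "y $ 3 \<noteq> 0"
  defines "r \<equiv> sqrt ((norm (z - hor x))\<^sup>2 + (x $ 3)\<^sup>2)" and "s \<equiv> sqrt ((norm (z - hor y))\<^sup>2 + (y $ 3)\<^sup>2)"
  shows "Hess (lpath gm gp x y) z $ i $ j =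
    ((if i = j then 1 else 0) / r - (z - hor x) $ i * (z - hor x) $ j / r ^ 3) / sqrt gm +
    ((if i = j then 1 else 0) / s - (z - hor y) $ i * (z - hor y) $ j / s ^ 3) / sqrt gp"
proof -
  have x: "(x $ 3)\<^sup>2 > 0" and y: "(y $ 3)\<^sup>2 > 0" using assms by auto
  have l: "lpath gm gp x y = (\<lambda>z. sqrt ((norm (z - hor x))\<^sup>2 + (x $ 3)\<^sup>2) / sqrt gm + sqrt ((norm (z - hor y))\<^sup>2 + (y $ 3)\<^sup>2) / sqrt gp)"
    by (simp add: lpath_def norm_lift0_diff fun_eq_iff)
  have d1: "frechet_derivative (lpath gm gp x y) (at w) v =
      (w - hor x) \<bullet> v / sqrt ((norm (w - hor x))\<^sup>2 + (x $ 3)\<^sup>2) / sqrt gm + (w - hor y) \<bullet> v / sqrt ((norm (w - hor y))\<^sup>2 + (y $ 3)\<^sup>2) / sqrt gp" for w v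
    unfolding l by (subst frechet_derivative_at[OF has_derivative_add[OF
          bounded_linear.has_derivative[OF bounded_linear_divide has_derivative_dist_plane[OF x]]
          bounded_linear.has_derivative[OF bounded_linear_divide has_derivative_dist_plane[OF y]]], symmetric]) simp
  show ?thesis
    unfolding Hess_def vec_lambda_beta d1
    by (subst frechet_derivative_at[OF has_derivative_add[OF
          bounded_linear.has_derivative[OF bounded_linear_divide has_derivative_dist_plane2[OF x]]
          bounded_linear.has_derivative[OF bounded_linear_divide has_derivative_dist_plane2[OF y]]], symmetric])
      (simp add: r_def s_def inner_axis mult.commute, simp add: axis_def mult.commute)
qed

text \<open>The matrix c I - e p p^T has the eigenvalue c across p and c - e |p|^2 along p.\<close>

lemma det_rank_one_update:
  fixes M :: "real^2^2" and p :: "real^2"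
  assumes "\<And>i j. M $ i $ j = (if i = j then c else 0) - e * p $ i * p $ j"
  shows "det M = c * (c - e * (norm p)\<^sup>2)"
  unfolding det_2 assms power2_norm_eq_inner inner_real2 by (simp add: algebra_simps)

section \<open>Smoothness of the slowness and the shortest broken path\<close>

context two_layers
begin

lemma slow_lo_eq: "slow_lo w = sqrt (1 / gm - slow_sq w)" and slow_up_eq: "slow_up w = sqrt (1 / gp - slow_sq w)"
  by (simp_all add: slow_lo_def slow_up_def)

lemma continuous_on_slow_sq: "continuous_on W slow_sq"
  using isCont_slow_sq by (simp add: continuous_at_imp_continuous_on)

text \<open>Conditional on the order already known for \<open>slow_sq\<close>, so that it can be
  used inside the bootstrap for \<open>slow_sq\<close> itself.\<close>

lemma moderate_slow_lo_if:
  assumes "moderate n W (\<lambda>w (\<eta>::'e::euclidean_space). slow_sq w)"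
  shows "moderate n W (\<lambda>w (\<eta>::'e). slow_lo w)" "moderate n W (\<lambda>w (\<eta>::'e). slow_up w)"
    "moderate n W (\<lambda>w (\<eta>::'e). inverse (slow_lo w))" "moderate n W (\<lambda>w (\<eta>::'e). inverse (slow_up w))"
proof -
  have p: "1 / gm - slow_sq w > 0" "1 / gp - slow_sq w > 0" if "w \<in> W" for w using slow_sq[OF that] inv_less by auto
  have az: "away_zero W (\<lambda>w (\<eta>::'e). 1 / gm - slow_sq w)" "away_zero W (\<lambda>w (\<eta>::'e). 1 / gp - slow_sq w)"
    by (rule away_zero_indep[OF open_W]; use p continuous_on_slow_sq in \<open>force intro!: continuous_intros\<close>)+
  show 1: "moderate n W (\<lambda>w (\<eta>::'e). slow_lo w)"
    unfolding slow_lo_def by (intro moderate_sqrt open_W moderate_diff moderate_const assms az p)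
  show 2: "moderate n W (\<lambda>w (\<eta>::'e). slow_up w)"
    unfolding slow_up_def by (intro moderate_sqrt open_W moderate_diff moderate_const assms az p)
  have "continuous_on W slow_lo" "continuous_on W slow_up"
    unfolding slow_lo_eq slow_up_eq using continuous_on_slow_sq by (auto intro!: continuous_intros)
  then have az: "away_zero W (\<lambda>w (\<eta>::'e). slow_lo w)" "away_zero W (\<lambda>w (\<eta>::'e). slow_up w)"
    using slow_lo_pos slow_up_pos by (force intro!: away_zero_indep open_W)+
  show "moderate n W (\<lambda>w (\<eta>::'e). inverse (slow_lo w))" "moderate n W (\<lambda>w (\<eta>::'e). inverse (slow_up w))"
    by (intro moderate_inverse open_W 1 2 az)+
qed

lemmas moderate_W = moderate_bounded_linear_var[OF open_W depth_linear] moderate_bounded_linear_var[OF open_W height_linear]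
  moderate_bounded_linear_var[OF open_W offset_linear]

lemma spread_saddle_inverse: "spread_saddle w = depth w * inverse (slow_lo w) + height w * inverse (slow_up w)"
  by (simp add: spread_saddle_def divide_inverse)

lemma moderate_spread_saddle_if:
  assumes "moderate n W (\<lambda>w (\<eta>::'e::euclidean_space). slow_sq w)"
  shows "moderate n W (\<lambda>w (\<eta>::'e). spread_saddle w)"
  unfolding spread_saddle_inverse by (intro moderate_add moderate_mult open_W moderate_slow_lo_if[OF assms] moderate_W)

lemma continuous_on_moderate_indep:
  assumes "moderate n W (\<lambda>w (\<eta>::'e::euclidean_space). f w)"
  shows "continuous_on W f"
  using moderate_0(3)[OF assms] unfolding moderate_iff_Ck_on[OF open_W] by simp

text \<open>By \<open>dslow_sq\<close> the derivative is an algebraic expression in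
  \<open>slow_sq\<close>, the two vertical slownesses and linear functions, with positive
  denominator; so each order gives the next.\<close>

lemma moderate_slow_sq: "moderate n W (\<lambda>w (\<eta>::'e::euclidean_space). slow_sq w)"
proof (rule moderate_bootstrap[OF open_W _ slow_sq_has_derivative, where N = n])
  show "moderate 0 W (\<lambda>w (\<eta>::'e). slow_sq w)" by (rule moderate_0_indep[OF open_W continuous_on_slow_sq])
  fix m v assume q: "moderate m W (\<lambda>w (\<eta>::'e). slow_sq w)"
  note mods = q moderate_slow_lo_if[OF q] moderate_spread_saddle_if[OF q] moderate_W open_W
  have d: "moderate m W (\<lambda>w (\<eta>::'e). (spread_saddle w)\<^sup>2 + slow_sq w * spread_saddle w * (depth w * inverse (slow_lo w) ^ 3 + height w * inverse (slow_up w) ^ 3))"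
    by (intro moderate_add moderate_mult moderate_power mods)
  show "moderate m W (\<lambda>w (\<eta>::'e). dslow_sq w v)"
    unfolding dslow_sq_def
    by (intro moderate_mult moderate_diff moderate_add moderate_inner moderate_const mods moderate_inverse[OF open_W d]
        away_zero_indep[OF open_W continuous_on_moderate_indep[OF d]] less_imp_neq[THEN not_sym] dslow_sq_denominator_pos)
qed auto

lemmas moderate_slow_lo = moderate_slow_lo_if[OF moderate_slow_sq]
lemmas moderate_spread_saddle = moderate_spread_saddle_if[OF moderate_slow_sq]

lemma moderate_slow_hor: "moderate n W (\<lambda>w (\<eta>::'e::euclidean_space). slow_hor w)"
  unfolding slow_hor_def
  by (intro moderate_scaleR moderate_inverse moderate_spread_saddle moderate_W open_W
      away_zero_indep[OF open_W continuous_on_moderate_indep[OF moderate_spread_saddle]] less_imp_neq[THEN not_sym] spread_saddle_pos)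

text \<open>The candidate for \<open>lmin\<close>, written as slowness paired with displacement so
  that Cauchy-Schwarz can compare it with any broken path.\<close>

definition travel :: "(real^3) \<times> (real^3) \<Rightarrow> real" where
  "travel w = slow_hor w \<bullet> offset w + slow_lo w * depth w + slow_up w * height w"

text \<open>Envelope principle: the variations of the slowness cancel. The vertical slownesses vary
  by - dq / (2 A) and - dq / (2 B), which with the weights depth and height add up to - spread dq /
  2; since offset = spread p and dq = 2 p . dp, the horizontal term contributes + spread dq /
  2.\<close>

lemma travel_has_derivative:
  assumes w: "w \<in> W"
  shows "(travel has_derivative (\<lambda>v. slow_hor w \<bullet> offset v + slow_lo w * depth v + slow_up w * height v)) (at w)"
proof -
  define pp' where "pp' = frechet_derivative slow_hor (at w)"
  have p: "(slow_hor has_derivative pp') (at w)" 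
  proof -
    have "moderate (Suc 0) W (\<lambda>w (\<eta>::real). slow_hor w)" by (rule moderate_slow_hor)
    from moderate_SucD[OF this w] show ?thesis by (simp add: pp'_def)
  qed
  \<comment> \<open>\<open>slow_sq\<close> is also |p|^2 on the open set W; uniqueness of the
    derivative then relates dq to dp.\<close>
  have "((\<lambda>w. slow_hor w \<bullet> slow_hor w) has_derivative dslow_sq w) (at w)"
    using slow_sq_has_derivative[OF w] open_W w
    by (rule has_derivative_transform_within_open) (simp add: norm_slow_hor[symmetric] power2_norm_eq_inner)
  note u = has_derivative_unique[OF has_derivative_inner[OF p p] this]
  have dqp: "dslow_sq w v = 2 * (slow_hor w \<bullet> pp' v)" for v using fun_cong[OF u, of v] by (simp add: inner_commute)
  have sq: "((\<lambda>w. sqrt (c - slow_sq w)) has_derivative (\<lambda>v. - (dslow_sq w v * inverse (sqrt (c - slow_sq w)) / 2))) (at w)" if "c - slow_sq w > 0" for c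
  proof -
    have "(sqrt has_derivative (*) (inverse (sqrt (c - slow_sq w)) / 2)) (at (c - slow_sq w))"
      using DERIV_real_sqrt[OF that] by (simp add: has_field_derivative_def)
    from has_derivative_compose[OF has_derivative_diff[OF has_derivative_const slow_sq_has_derivative[OF w]] this]
    show ?thesis by (simp add: mult_ac)
  qed
  have A: "(slow_lo has_derivative (\<lambda>v. - (dslow_sq w v * inverse (slow_lo w) / 2))) (at w)"
    unfolding slow_lo_def by (rule sq) (use slow_sq[OF w] inv_less in simp)
  have B: "(slow_up has_derivative (\<lambda>v. - (dslow_sq w v * inverse (slow_up w) / 2))) (at w)"
    unfolding slow_up_def by (rule sq) (use slow_sq[OF w] inv_less in simp)
  have "(travel has_derivative (\<lambda>v. (slow_hor w \<bullet> offset v + pp' v \<bullet> offset w) + (slow_lo w * depth v + - (dslow_sq w v * inverse (slow_lo w) / 2) * depth w) +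
      (slow_up w * height v + - (dslow_sq w v * inverse (slow_up w) / 2) * height w))) (at w)"
    unfolding travel_def[abs_def]
    by (intro has_derivative_add has_derivative_inner has_derivative_mult p A B bounded_linear_imp_has_derivative offset_linear depth_linear height_linear)
  then show ?thesis
  proof (rule has_derivative_eq_rhs)
    have "pp' v \<bullet> offset w = spread_saddle w * (dslow_sq w v / 2)" for v
      unfolding slow_hor_offset[OF w] dqp by (simp add: inner_commute)
    then show "(\<lambda>v. (slow_hor w \<bullet> offset v + pp' v \<bullet> offset w) + (slow_lo w * depth v + - (dslow_sq w v * inverse (slow_lo w) / 2) * depth w) +
      (slow_up w * height v + - (dslow_sq w v * inverse (slow_up w) / 2) * height w)) = (\<lambda>v. slow_hor w \<bullet> offset v + slow_lo w * depth v + slow_up w * height v)"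
      by (simp add: fun_eq_iff spread_saddle_inverse algebra_simps)
  qed
qed

text \<open>Reached from x by going against (p, - A) up to the interface. That the ray from y
  arrives at the same point is \<open>crossing_upper\<close>, where Snell's law enters.\<close>

definition crossing :: "(real^3) \<times> (real^3) \<Rightarrow> real^2" where
  "crossing w = hor (fst w) - (depth w / slow_lo w) *\<^sub>R slow_hor w"

lemma crossing_upper: "w \<in> W \<Longrightarrow> crossing w = hor (snd w) + (height w / slow_up w) *\<^sub>R slow_hor w"
  using slow_hor_offset[of w] by (simp add: crossing_def spread_saddle_def offset_def algebra_simps)

text \<open>The vector (p, A) has length 1 / sqrt g, so the parallel segment of height h has length
  h / (A sqrt g).\<close>

lemma sqrt_saddle:
  assumes "h > 0" "A > 0" "g > 0" "A\<^sup>2 = 1 / g - (norm p)\<^sup>2"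
  shows "sqrt ((norm ((h / A) *\<^sub>R (p::real^2)))\<^sup>2 + h\<^sup>2) = h / (A * sqrt g)"
proof (rule real_sqrt_unique)
  have "(norm ((h / A) *\<^sub>R p))\<^sup>2 + h\<^sup>2 = h\<^sup>2 / A\<^sup>2 * ((norm p)\<^sup>2 + A\<^sup>2)"
    using assms(2) by (simp add: power_mult_distrib power_divide distrib_left)
  also have "(norm p)\<^sup>2 + A\<^sup>2 = 1 / g" using assms(4) by simp
  finally show "(h / (A * sqrt g))\<^sup>2 = (norm ((h / A) *\<^sub>R p))\<^sup>2 + h\<^sup>2"
    using assms(3) by (simp add: power_mult_distrib power_divide)
qed (use assms in auto)

lemma norm_saddle:
  assumes "w \<in> W"
  shows "norm (lift0 (crossing w) - fst w) = depth w / (slow_lo w * sqrt gm)" "norm (lift0 (crossing w) - snd w) = height w / (slow_up w * sqrt gp)"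
proof -
  have "norm (crossing w - hor (fst w)) = norm ((depth w / slow_lo w) *\<^sub>R slow_hor w)" by (simp add: crossing_def)
  then show "norm (lift0 (crossing w) - fst w) = depth w / (slow_lo w * sqrt gm)"
    using sqrt_saddle[OF hk_pos(1)[OF assms] slow_lo_pos[OF assms] gm, of "slow_hor w"] slow_lo_sq[OF assms] norm_slow_hor[OF assms]
    unfolding norm_lift0_diff by (simp add: depth_def)
  have "norm (crossing w - hor (snd w)) = norm ((height w / slow_up w) *\<^sub>R slow_hor w)" by (simp add: crossing_upper[OF assms])
  then show "norm (lift0 (crossing w) - snd w) = height w / (slow_up w * sqrt gp)"
    using sqrt_saddle[OF hk_pos(2)[OF assms] slow_up_pos[OF assms] gp, of "slow_hor w"] slow_up_sq[OF assms] norm_slow_hor[OF assms]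
    unfolding norm_lift0_diff by (simp add: height_def)
qed

text \<open>Cauchy--Schwarz for the slowness vector \<open>(p, A)\<close> and the ray \<open>(v, h)\<close>; adding the two
  layers bounds every broken path from below.\<close>

lemma cauchy_slowness:
  fixes p v :: "real^2"
  assumes "g > 0" "A\<^sup>2 = 1 / g - (norm p)\<^sup>2"
  shows "p \<bullet> v + A * h \<le> sqrt ((norm v)\<^sup>2 + h\<^sup>2) / sqrt g"
    and "A > 0 \<Longrightarrow> p \<bullet> v + A * h = sqrt ((norm v)\<^sup>2 + h\<^sup>2) / sqrt g \<Longrightarrow> v = (h / A) *\<^sub>R p"
proof -
  have n1: "norm (Defs.join p A) = 1 / sqrt g"
    using norm_real3[of "Defs.join p A"] assms by (simp add: real_sqrt_unique[symmetric] power_divide) (metis norm_ge_zero real_sqrt_divide real_sqrt_one real_sqrt_unique)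
  have n2: "norm (Defs.join v h) = sqrt ((norm v)\<^sup>2 + h\<^sup>2)"
    using norm_real3[of "Defs.join v h"] by (simp add: real_sqrt_unique)
  have i: "Defs.join p A \<bullet> Defs.join v h = p \<bullet> v + A * h" by (simp add: inner_join)
  show "p \<bullet> v + A * h \<le> sqrt ((norm v)\<^sup>2 + h\<^sup>2) / sqrt g"
    using norm_cauchy_schwarz[of "Defs.join p A" "Defs.join v h"] unfolding i n1 n2 by simp
  assume A: "A > 0" and "p \<bullet> v + A * h = sqrt ((norm v)\<^sup>2 + h\<^sup>2) / sqrt g"
  then have "Defs.join p A \<bullet> Defs.join v h = norm (Defs.join p A) * norm (Defs.join v h)"
    unfolding i n1 n2 by simp
  then have "norm (Defs.join p A) *\<^sub>R Defs.join v h = norm (Defs.join v h) *\<^sub>R Defs.join p A"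
    by (rule norm_cauchy_schwarz_eq[THEN iffD1])
  then have e: "(1 / sqrt g) *\<^sub>R Defs.join v h = norm (Defs.join v h) *\<^sub>R Defs.join p A"
    unfolding n1 .
  define r where "r = sqrt g * norm (Defs.join v h)"
  have "Defs.join v h = r *\<^sub>R Defs.join p A"
    using arg_cong[OF e, of "\<lambda>t. sqrt g *\<^sub>R t"] assms(1) by (simp add: r_def)
  then have "h = r * A" "v = r *\<^sub>R p" by (auto simp: vec_eq_iff forall_2 forall_3)
  then show "v = (h / A) *\<^sub>R p" using A by simp
qed

lemma lpath_ge:
  assumes w: "w \<in> W"
  shows "travel w \<le> lpath gm gp (fst w) (snd w) z"
    and "lpath gm gp (fst w) (snd w) z = travel w \<Longrightarrow> z = crossing w"
    and "lpath gm gp (fst w) (snd w) (crossing w) = travel w"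
proof -
  have A: "(slow_lo w)\<^sup>2 = 1 / gm - (norm (slow_hor w))\<^sup>2" and B: "(slow_up w)\<^sup>2 = 1 / gp - (norm (slow_hor w))\<^sup>2"
    using slow_lo_sq[OF w] slow_up_sq[OF w] norm_slow_hor[OF w] by auto
  have e: "travel w = (slow_hor w \<bullet> (hor (fst w) - z) + slow_lo w * depth w) + (slow_hor w \<bullet> (z - hor (snd w)) + slow_up w * height w)" for z
    by (simp add: travel_def offset_def inner_diff_right)
  have l: "lpath gm gp (fst w) (snd w) z = sqrt ((norm (hor (fst w) - z))\<^sup>2 + (depth w)\<^sup>2) / sqrt gm + sqrt ((norm (z - hor (snd w)))\<^sup>2 + (height w)\<^sup>2) / sqrt gp" for z
    unfolding lpath_def norm_lift0_diff by (simp add: norm_minus_commute depth_def height_def)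
  note cA = cauchy_slowness[OF gm A, of "hor (fst w) - z" "depth w"] and cB = cauchy_slowness(1)[OF gp B, of "z - hor (snd w)" "height w"]
  show "travel w \<le> lpath gm gp (fst w) (snd w) z" unfolding l e[of z] using cA(1) cB by linarith
  show "z = crossing w" if "lpath gm gp (fst w) (snd w) z = travel w"
  proof -
    \<comment> \<open>Equality of the sums forces equality in the lower layer, whose equality case
      alone fixes z.\<close>
    have "slow_hor w \<bullet> (hor (fst w) - z) + slow_lo w * depth w = sqrt ((norm (hor (fst w) - z))\<^sup>2 + (depth w)\<^sup>2) / sqrt gm"
      using that cA(1) cB unfolding l e[of z] by linarith
    from cA(2)[OF slow_lo_pos[OF w] this] show ?thesis by (simp add: crossing_def algebra_simps)
  qed
  have a: "slow_lo w > 0" "slow_up w > 0" using slow_lo_pos slow_up_pos w by auto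
  have "lpath gm gp (fst w) (snd w) (crossing w) = depth w / (slow_lo w * gm) + height w / (slow_up w * gp)"
    unfolding lpath_def norm_saddle[OF w] using gm gp by (simp add: mult.assoc)
  also have "\<dots> = depth w / slow_lo w * ((norm (slow_hor w))\<^sup>2 + (slow_lo w)\<^sup>2) + height w / slow_up w * ((norm (slow_hor w))\<^sup>2 + (slow_up w)\<^sup>2)"
    unfolding A B by simp
  also have "\<dots> = travel w"
    unfolding travel_def slow_hor_offset[OF w] spread_saddle_def power2_norm_eq_inner using a by (simp add: power2_eq_square field_simps)
  finally show "lpath gm gp (fst w) (snd w) (crossing w) = travel w" .
qed

lemma lmin_eq: assumes w: "w \<in> W" shows "lmin gm gp (fst w) (snd w) = travel w"
  unfolding lmin_def
proof (rule antisym)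
  have "bdd_below (range (lpath gm gp (fst w) (snd w)))"
    by (rule bdd_belowI2[of _ "travel w"]) (rule lpath_ge(1)[OF w])
  from cINF_lower[OF this UNIV_I, of "crossing w"] show "(INF z. lpath gm gp (fst w) (snd w) z) \<le> travel w"
    unfolding lpath_ge(3)[OF w] .
  show "travel w \<le> (INF z. lpath gm gp (fst w) (snd w) z)"
    by (rule cINF_greatest) (use lpath_ge(1)[OF w] in auto)
qed

lemma zmin_eq: assumes w: "w \<in> W" shows "zmin gm gp (fst w) (snd w) = crossing w"
  unfolding zmin_def lmin_eq[OF w]
proof (rule the_equality)
  show "lpath gm gp (fst w) (snd w) (crossing w) = travel w" by (rule lpath_ge(3)[OF w])
  show "z = crossing w" if "lpath gm gp (fst w) (snd w) z = travel w" for z by (rule lpath_ge(2)[OF w that])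
qed

text \<open>The factors are the eigenvalues of the Hessian across and along
  \<open>slow_hor\<close>.\<close>

definition det_hess :: "(real^3) \<times> (real^3) \<Rightarrow> real" where
  "det_hess w = (slow_lo w * inverse (depth w) + slow_up w * inverse (height w)) * (gm * slow_lo w ^ 3 * inverse (depth w) + gp * slow_up w ^ 3 * inverse (height w))"

lemma det_hess_pos: "w \<in> W \<Longrightarrow> det_hess w > 0"
  using slow_lo_pos[of w] slow_up_pos[of w] hk_pos[of w] gm gp by (auto simp: det_hess_def intro!: mult_pos_pos add_pos_pos)

text \<open>Each layer contributes (A / h) (I - \<gamma> p p^T), because its displacement is
  parallel to p and its ray has length h / (A sqrt \<gamma>). The eigenvalue along p then simplifies
  by 1 - \<gamma> |p|^2 = \<gamma> A^2.\<close>

lemma det_Hmat: 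
  assumes w: "w \<in> W" shows "det (Hmat gm gp (fst w) (snd w)) = det_hess w"
proof -
  define A B h k p where "A = slow_lo w" "B = slow_up w" "h = depth w" "k = height w" "p = slow_hor w"
  note defs = A_B_h_k_p_def
  have pos: "A > 0" "B > 0" "h > 0" "k > 0" using slow_lo_pos slow_up_pos hk_pos w by (auto simp: defs)
  have A2: "A\<^sup>2 = 1 / gm - (norm p)\<^sup>2" and B2: "B\<^sup>2 = 1 / gp - (norm p)\<^sup>2"
    using slow_lo_sq[OF w] slow_up_sq[OF w] norm_slow_hor[OF w] by (auto simp: defs)
  have r: "sqrt ((norm (crossing w - hor (fst w)))\<^sup>2 + (fst w $ 3)\<^sup>2) = h / (A * sqrt gm)"
     and s: "sqrt ((norm (crossing w - hor (snd w)))\<^sup>2 + (snd w $ 3)\<^sup>2) = k / (B * sqrt gp)"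
    using norm_saddle[OF w] unfolding norm_lift0_diff defs by auto
  have c1: "crossing w - hor (fst w) = - ((h / A) *\<^sub>R p)" by (simp add: crossing_def defs)
  have c2: "crossing w - hor (snd w) = (k / B) *\<^sub>R p" by (simp add: crossing_upper[OF w] defs)
  have ne: "fst w $ 3 \<noteq> 0" "snd w $ 3 \<noteq> 0" using hk_pos[OF w] by (auto simp: depth_def height_def)
  have g: "sqrt gm > 0" "sqrt gp > 0" "sqrt gm * sqrt gm = gm" "sqrt gp * sqrt gp = gp" using gm gp by auto
  have one: "(d / (h / (A * t)) - (- ((h / A) *\<^sub>R p)) $ i * (- ((h / A) *\<^sub>R p)) $ j / (h / (A * t)) ^ 3) / t = d * (A / h) - (t * t) * (A / h) * p $ i * p $ j"
    if "t > 0" "A > 0" "h > 0" for d A h t :: real and i j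
    using that by (simp add: field_simps power3_eq_cube)
  have two: "(d / (h / (A * t)) - ((h / A) *\<^sub>R p) $ i * ((h / A) *\<^sub>R p) $ j / (h / (A * t)) ^ 3) / t = d * (A / h) - (t * t) * (A / h) * p $ i * p $ j"
    if "t > 0" "A > 0" "h > 0" for d A h t :: real and i j
    using that by (simp add: field_simps power3_eq_cube)
  have "Hmat gm gp (fst w) (snd w) $ i $ j = (if i = j then A / h + B / k else 0) - (gm * (A / h) + gp * (B / k)) * p $ i * p $ j" for i j
    unfolding Hmat_def zmin_eq[OF w] Hess_lpath[OF ne] r s unfolding c1 c2 unfolding two[OF g(2) pos(2) pos(4)] one[OF g(1) pos(1) pos(3)] g
    by (simp add: algebra_simps)
  from det_rank_one_update[OF this]
  have "det (Hmat gm gp (fst w) (snd w)) = (A / h + B / k) * (A / h + B / k - (gm * (A / h) + gp * (B / k)) * (norm p)\<^sup>2)" .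
  also have "A / h + B / k - (gm * (A / h) + gp * (B / k)) * (norm p)\<^sup>2 = (A / h) * (1 - gm * (norm p)\<^sup>2) + (B / k) * (1 - gp * (norm p)\<^sup>2)"
    by (simp add: algebra_simps)
  also have "1 - gm * (norm p)\<^sup>2 = gm * A\<^sup>2" unfolding A2 using gm by (simp add: algebra_simps)
  also have "1 - gp * (norm p)\<^sup>2 = gp * B\<^sup>2" unfolding B2 using gp by (simp add: algebra_simps)
  finally show ?thesis unfolding det_hess_def defs by (simp add: divide_inverse power2_eq_square power3_eq_cube algebra_simps)
qed

end

section \<open>Shifting the contour\<close>

lemma away_zero_lower_bound:
  assumes "open U" "continuous_on U g" "\<And>u. u \<in> U \<Longrightarrow> g u > (0::real)"
    and "\<And>u \<eta>. u \<in> U \<Longrightarrow> g u \<le> norm (f u \<eta>)"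
  shows "away_zero U f"
  unfolding away_zero_def
proof
  fix u assume u: "u \<in> U"
  have "away_zero U (\<lambda>u (\<eta>::real). g u)"
    by (rule away_zero_indep[OF assms(1,2)]) (use assms(3) in force)
  then obtain c where c: "c > 0" "\<forall>\<^sub>F v in nhds u. \<forall>\<eta>::real. c \<le> norm (g v)"
    using away_zeroE u by blast
  have "\<forall>\<^sub>F v in nhds u. v \<in> U" using \<open>open U\<close> u by (rule eventually_nhds_in_open)
  with c(2) have "\<forall>\<^sub>F v in nhds u. \<forall>\<eta>. c \<le> norm (f v \<eta>)"
  proof eventually_elim
    case (elim v)
    then show ?case using assms(3,4)[OF elim(2)] by (auto intro: order_trans)
  qed
  then show "\<exists>c>0. \<forall>\<^sub>F v in nhds u. \<forall>\<eta>. c \<le> norm (f v \<eta>)" using c(1) by blast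
qed

lemma Re_csqrt_ge: "Re z \<ge> 0 \<Longrightarrow> sqrt (Re z) \<le> Re (csqrt z)"
  by (simp add: complex_Re_le_cmod)

text \<open>The analytic continuation of \<open>|\<xi>|\<^sup>2 + c\<close> to \<open>\<xi> = \<eta> + \<sigma> p\<close> with complex \<open>\<sigma>\<close>.\<close>

definition cont_arg :: "real \<Rightarrow> real^2 \<Rightarrow> complex \<Rightarrow> real^2 \<Rightarrow> complex" where
  "cont_arg c p \<sigma> \<eta> = complex_of_real (\<eta> \<bullet> \<eta>) + complex_of_real c + 2 * \<sigma> * complex_of_real (p \<bullet> \<eta>) + \<sigma> * \<sigma> * complex_of_real (p \<bullet> p)"

text \<open>Real steps in \<sigma> are absorbed by translating \<eta>: the symmetry behind
  \<open>contour_shift\<close>.\<close>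

lemma cont_arg_shift: "cont_arg c p (\<sigma> + complex_of_real t) \<eta> = cont_arg c p \<sigma> (\<eta> + t *\<^sub>R p)"
  by (simp add: cont_arg_def inner_add_left inner_add_right inner_commute algebra_simps)

lemma Re_cont_arg: "Re (cont_arg c p \<sigma> \<eta>) = (norm (\<eta> + Re \<sigma> *\<^sub>R p))\<^sup>2 + (c - (Im \<sigma>)\<^sup>2 * (norm p)\<^sup>2)"
  unfolding power2_norm_eq_inner
  by (simp add: cont_arg_def inner_add_left inner_add_right inner_commute power2_eq_square algebra_simps)

definition cont_slow :: "real \<Rightarrow> real^2 \<Rightarrow> complex \<Rightarrow> real^2 \<Rightarrow> complex" where
  "cont_slow c p \<sigma> \<eta> = csqrt (cont_arg c p \<sigma> \<eta>)"

text \<open>Encoded by two half-plane conditions, from which openness and convexity are immediate;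
  \<open>strip_iff\<close> gives the symmetric form.\<close>

definition strip :: "real \<Rightarrow> real^2 \<Rightarrow> complex set" where
  "strip c p = {\<sigma>. (norm p *\<^sub>R \<i>) \<bullet> \<sigma> < sqrt c} \<inter> {\<sigma>. (- norm p *\<^sub>R \<i>) \<bullet> \<sigma> < sqrt c}"

lemma strip_iff: "\<sigma> \<in> strip c p \<longleftrightarrow> norm p * \<bar>Im \<sigma>\<bar> < sqrt c"
proof -
  have "norm p * \<bar>Im \<sigma>\<bar> = \<bar>norm p * Im \<sigma>\<bar>" by (simp add: abs_mult)
  then show ?thesis by (auto simp: strip_def inner_complex_def abs_less_iff)
qed

lemma open_strip: "open (strip c p)"
  unfolding strip_def by (intro open_Int open_halfspace_lt)

lemma convex_strip: "convex (strip c p)"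
  unfolding strip_def by (intro convex_Int convex_halfspace_lt)

text \<open>Thanks to d >= c a single strip, that of the layer with the smaller 1 / \<gamma>, serves
  both layers.\<close>

lemma strip_gap:
  assumes "\<sigma> \<in> strip c p" "c > 0" "c \<le> d"
  shows "d - (Im \<sigma>)\<^sup>2 * (norm p)\<^sup>2 > 0"
proof -
  have "(norm p * \<bar>Im \<sigma>\<bar>)\<^sup>2 < (sqrt c)\<^sup>2"
    using assms(1) unfolding strip_iff by (intro power_strict_mono) auto
  then show ?thesis using assms by (simp add: power_mult_distrib mult.commute)
qed

lemma moderate_cont_arg: "moderate n (strip c p) (cont_arg d p)"
proof -
  note U = open_strip[of c p]
  have 1: "moderate n (strip c p) (\<lambda>\<sigma> (\<eta>::real^2). \<eta>)" by (rule moderate_bounded_linear_param[OF U bounded_linear_ident])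
  have 2: "moderate n (strip c p) (\<lambda>\<sigma> (\<eta>::real^2). \<sigma>)" by (rule moderate_bounded_linear_var[OF U bounded_linear_ident])
  show ?thesis
    unfolding cont_arg_def[abs_def] by (intro moderate_add moderate_mult moderate_of_real moderate_inner moderate_const U 1 2)
qed

lemma Re_cont_arg_pos:
  assumes "\<sigma> \<in> strip c p" "c > 0" "c \<le> d" shows "Re (cont_arg d p \<sigma> \<eta>) > 0"
  using strip_gap[OF assms] unfolding Re_cont_arg by (intro add_nonneg_pos) auto

lemma moderate_cont_slow:
  assumes "c > 0" "c \<le> d" shows "moderate n (strip c p) (cont_slow d p)"
proof -
  have "away_zero (strip c p) (cont_arg d p)"
  proof (rule away_zero_lower_bound[OF open_strip])
    show "continuous_on (strip c p) (\<lambda>\<sigma>. d - (Im \<sigma>)\<^sup>2 * (norm p)\<^sup>2)" by (intro continuous_intros)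
    show "d - (Im \<sigma>)\<^sup>2 * (norm p)\<^sup>2 \<le> norm (cont_arg d p \<sigma> \<eta>)" for \<sigma> \<eta>
      using complex_Re_le_cmod[of "cont_arg d p \<sigma> \<eta>"] zero_le_power2[of "norm (\<eta> + Re \<sigma> *\<^sub>R p)"]
      unfolding Re_cont_arg by linarith
  qed (use strip_gap assms in auto)
  then show ?thesis
    unfolding cont_slow_def[abs_def] by (intro moderate_csqrt open_strip moderate_cont_arg) (use Re_cont_arg_pos assms in auto)
qed

lemma cont_slow_field_differentiable:
  assumes "\<sigma> \<in> strip c p" "c > 0" "c \<le> d"
  shows "(\<lambda>\<sigma>. cont_slow d p \<sigma> \<eta>) field_differentiable (at \<sigma>)"
proof -
  have nn: "cont_arg d p \<sigma> \<eta> \<notin> \<real>\<^sub>\<le>\<^sub>0"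
    using Re_cont_arg_pos[OF assms, of \<eta>] by (auto simp: complex_nonpos_Reals_iff)
  have "(\<lambda>\<sigma>. cont_arg d p \<sigma> \<eta>) field_differentiable (at \<sigma>)"
    unfolding cont_arg_def by (intro derivative_intros)
  from field_differentiable_compose[OF this field_differentiable_at_csqrt[OF nn]]
  show ?thesis unfolding cont_slow_def comp_def .
qed

text \<open>The first bound gives coercivity of the phase, the second keeps the denominator of the
  amplitude away from zero.\<close>

lemma Re_cont_slow_ge:
  assumes "\<sigma> \<in> strip c p" "c > 0" "c \<le> d"
  shows "norm (\<eta> + Re \<sigma> *\<^sub>R p) \<le> Re (cont_slow d p \<sigma> \<eta>)" "sqrt (d - (Im \<sigma>)\<^sup>2 * (norm p)\<^sup>2) \<le> Re (cont_slow d p \<sigma> \<eta>)" 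
proof -
  have g: "sqrt (Re (cont_arg d p \<sigma> \<eta>)) \<le> Re (cont_slow d p \<sigma> \<eta>)"
    unfolding cont_slow_def using Re_cont_arg_pos[OF assms, of \<eta>] by (intro Re_csqrt_ge) simp
  have "norm (\<eta> + Re \<sigma> *\<^sub>R p) \<le> sqrt (Re (cont_arg d p \<sigma> \<eta>))"
    unfolding Re_cont_arg using strip_gap[OF assms] by (intro real_le_rsqrt) simp
  with g show "norm (\<eta> + Re \<sigma> *\<^sub>R p) \<le> Re (cont_slow d p \<sigma> \<eta>)" by simp
  have "sqrt (d - (Im \<sigma>)\<^sup>2 * (norm p)\<^sup>2) \<le> sqrt (Re (cont_arg d p \<sigma> \<eta>))"
    by (simp add: Re_cont_arg)
  from order_trans[OF this g] show "sqrt (d - (Im \<sigma>)\<^sup>2 * (norm p)\<^sup>2) \<le> Re (cont_slow d p \<sigma> \<eta>)" .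
qed

lemma frechet_derivative_complex_linear:
  assumes "f field_differentiable (at (\<sigma>::complex))"
  shows "frechet_derivative f (at \<sigma>) v = v * frechet_derivative f (at \<sigma>) 1"
proof -
  obtain d where "(f has_field_derivative d) (at \<sigma>)" using assms unfolding field_differentiable_def by blast
  then have "(f has_derivative (*) d) (at \<sigma>)" by (simp add: has_field_derivative_def)
  from frechet_derivative_at[OF this] show ?thesis by (metis mult.commute mult_1_right)
qed

text \<open>The integral is holomorphic in \<open>\<sigma>\<close> and invariant under real translations of \<open>\<sigma>\<close>, hence
  constant; no vanishing of boundary terms has to be discussed.\<close>

lemma contour_shift:
  fixes \<Psi> f :: "complex \<Rightarrow> 'e::euclidean_space \<Rightarrow> complex" and p :: 'e
  assumes U: "open U" "convex U"
    and \<Psi>: "moderate (Suc 0) U \<Psi>" "coercive U \<Psi>" and f: "moderate (Suc 0) U f"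
    and hol: "\<And>\<sigma> \<eta>. \<sigma> \<in> U \<Longrightarrow> (\<lambda>\<sigma>. \<Psi> \<sigma> \<eta>) field_differentiable (at \<sigma>)"
      "\<And>\<sigma> \<eta>. \<sigma> \<in> U \<Longrightarrow> (\<lambda>\<sigma>. f \<sigma> \<eta>) field_differentiable (at \<sigma>)"
    and shift: "\<And>\<sigma> t \<eta>. \<sigma> \<in> U \<Longrightarrow> \<Psi> (\<sigma> + complex_of_real t) \<eta> = \<Psi> \<sigma> (\<eta> + t *\<^sub>R p)"
      "\<And>\<sigma> t \<eta>. \<sigma> \<in> U \<Longrightarrow> f (\<sigma> + complex_of_real t) \<eta> = f \<sigma> (\<eta> + t *\<^sub>R p)"
    and s: "s0 \<in> U" "s1 \<in> U"
  shows "(LINT \<eta>|lborel. exp (- \<Psi> s0 \<eta>) * f s0 \<eta>) = (LINT \<eta>|lborel. exp (- \<Psi> s1 \<eta>) * f s1 \<eta>)"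
proof -
  define J where "J \<sigma> = (LINT \<eta>|lborel. exp (- \<Psi> \<sigma> \<eta>) * f \<sigma> \<eta>)" for \<sigma>
  have "(J has_derivative (\<lambda>v. 0)) (at \<sigma>)" if \<sigma>: "\<sigma> \<in> U" for \<sigma>
  proof -
    define D where "D v = (LINT \<eta>|lborel. exp (- \<Psi> \<sigma> \<eta>) *
        (frechet_derivative (\<lambda>u. f u \<eta>) (at \<sigma>) v - f \<sigma> \<eta> * frechet_derivative (\<lambda>u. \<Psi> u \<eta>) (at \<sigma>) v))" for v
    have J: "(J has_derivative D) (at \<sigma>)"
      unfolding J_def[abs_def] D_def[abs_def] by (rule has_derivative_laplace[OF U(1) \<Psi> f \<sigma>])
    \<comment> \<open>Both derivatives under the integral are complex linear, so \<open>D\<close> is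
      too; it vanishes as soon as the derivative along real steps does.\<close>
    have Dv: "D v = v * D 1" for v
    proof -
      have "D v = (LINT \<eta>|lborel. v * (exp (- \<Psi> \<sigma> \<eta>) *
        (frechet_derivative (\<lambda>u. f u \<eta>) (at \<sigma>) 1 - f \<sigma> \<eta> * frechet_derivative (\<lambda>u. \<Psi> u \<eta>) (at \<sigma>) 1)))"
        unfolding D_def frechet_derivative_complex_linear[OF hol(1)[OF \<sigma>], of _ v] frechet_derivative_complex_linear[OF hol(2)[OF \<sigma>], of _ v]
        by (simp add: algebra_simps)
      then show ?thesis by (simp add: D_def)
    qed
    have const: "J (\<sigma> + complex_of_real t) = J \<sigma>" for t
    proof -
      have meas: "(\<lambda>\<eta>. exp (- \<Psi> \<sigma> \<eta>) * f \<sigma> \<eta>) \<in> borel_measurable borel"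
        using moderate_measurable[OF \<Psi>(1) \<sigma>] moderate_measurable[OF f \<sigma>] by simp
      have "J (\<sigma> + complex_of_real t) = (LINT \<eta>|lborel. exp (- \<Psi> \<sigma> (t *\<^sub>R p + \<eta>)) * f \<sigma> (t *\<^sub>R p + \<eta>))"
        unfolding J_def shift[OF \<sigma>] by (simp add: add.commute)
      also have "\<dots> = J \<sigma>" unfolding J_def by (rule lborel_integral_shift[OF meas])
      finally show ?thesis .
    qed
    have "((\<lambda>t. J (\<sigma> + complex_of_real t)) has_derivative (\<lambda>t. D (complex_of_real t))) (at 0)"
    proof -
      have "((\<lambda>t. \<sigma> + complex_of_real t) has_derivative complex_of_real) (at 0)"
        by (auto intro!: derivative_eq_intros)
      moreover have "(J has_derivative D) (at (\<sigma> + complex_of_real 0))" using J by simp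
      ultimately show ?thesis by (rule has_derivative_compose)
    qed
    then have "((\<lambda>t. J \<sigma>) has_derivative (\<lambda>t. D (complex_of_real t))) (at 0)" unfolding const .
    from has_derivative_unique[OF this has_derivative_const] have "D (complex_of_real 1) = 0" by (rule fun_cong)
    then have "D v = 0" for v unfolding Dv[of v] by simp
    then have "D = (\<lambda>v. 0)" by (rule ext)
    then show ?thesis using J by simp
  qed
  then have "\<exists>c. \<forall>x\<in>U. J x = c"
    by (intro has_derivative_zero_constant[OF U(2)]) (auto intro: has_derivative_at_withinI)
  then show ?thesis using s unfolding J_def by auto
qed

context two_layers
begin

text \<open>The strict bound \<open>slow_sq w < 1 / gp\<close> puts the saddle point inside the
  strip on which both square roots are holomorphic, so no branch point is met on the way.\<close>

lemma imaginary_unit_strip: assumes "w \<in> W" shows "\<i> \<in> strip (1 / gp) (slow_hor w)"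
proof -
  have "norm (slow_hor w) = sqrt (slow_sq w)" using norm_slow_hor[OF assms] by (simp add: real_sqrt_unique)
  then have "norm (slow_hor w) < sqrt (1 / gp)" using slow_sq(2)[OF assms] by simp
  then show ?thesis by (simp add: strip_iff)
qed

text \<open>The spectral integral is the case \<sigma> = 0 of a family of integrals over the planes
  \<eta> + \<sigma> p, and the saddle point lies on the member \<sigma> = \<i>.\<close>

lemma Phi_formula_shifted:
  assumes w: "w \<in> W" and \<tau>: "\<tau> > 0"
  shows "Phi_formula gm gp \<tau> (fst w) (snd w) = complex_of_real (\<tau> / (4 * pi\<^sup>2 * gm * gp)) *
     (LINT \<eta>|lborel. exp (- (complex_of_real \<tau> * (complex_of_real (depth w) * cont_slow (1 / gm) (slow_hor w) \<i> \<eta> + complex_of_real (height w) * cont_slow (1 / gp) (slow_hor w) \<i> \<eta>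
          - \<i> * (complex_of_real (offset w \<bullet> \<eta>) + \<i> * complex_of_real (offset w \<bullet> slow_hor w))))) *
        inverse (complex_of_real (1 / gm) * cont_slow (1 / gp) (slow_hor w) \<i> \<eta> + complex_of_real (1 / gp) * cont_slow (1 / gm) (slow_hor w) \<i> \<eta>))"
proof -
  define p X h k where "p = slow_hor w" "X = offset w" "h = depth w" "k = height w"
  note defs = p_X_h_k_def
  have hk: "h > 0" "k > 0" using hk_pos[OF w] by (auto simp: defs)
  define U where "U = strip (1 / gp) p"
  have c: "1 / gp > 0" "1 / gp \<le> 1 / gm" using gp inv_less by auto
  define \<Psi> where "\<Psi> \<sigma> \<eta> = complex_of_real \<tau> * (complex_of_real h * cont_slow (1 / gm) p \<sigma> \<eta> + complex_of_real k * cont_slow (1 / gp) p \<sigma> \<eta>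
          - \<i> * (complex_of_real (X \<bullet> \<eta>) + \<sigma> * complex_of_real (X \<bullet> p)))" for \<sigma> \<eta>
  define N where "N \<sigma> \<eta> = complex_of_real (1 / gm) * cont_slow (1 / gp) p \<sigma> \<eta> + complex_of_real (1 / gp) * cont_slow (1 / gm) p \<sigma> \<eta>" for \<sigma> \<eta>
  have oU: "open U" by (simp add: U_def open_strip)
  have mS: "moderate n U (cont_slow (1 / gm) p)" "moderate n U (cont_slow (1 / gp) p)" for n
    unfolding U_def by (intro moderate_cont_slow c order_refl)+
  have mv: "moderate n U (\<lambda>\<sigma> (\<eta>::real^2). \<sigma>)" "moderate n U (\<lambda>\<sigma> (\<eta>::real^2). \<eta>)" for n
    by (intro moderate_bounded_linear_var moderate_bounded_linear_param oU bounded_linear_ident)+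
  have m\<Psi>: "moderate n U \<Psi>" for n
    unfolding \<Psi>_def[abs_def] by (intro moderate_mult moderate_add moderate_diff moderate_const moderate_of_real moderate_inner oU mS mv)
  \<comment> \<open>Both roots have nonnegative real part, so their weighted sum cannot
    cancel.\<close>
  have Nge: "(1 / gm) * sqrt (1 / gp - (Im \<sigma>)\<^sup>2 * (norm p)\<^sup>2) \<le> Re (N \<sigma> \<eta>)" if "\<sigma> \<in> U" for \<sigma> \<eta>
  proof -
    have s: "\<sigma> \<in> strip (1 / gp) p" using that by (simp add: U_def)
    have 1: "sqrt (1 / gp - (Im \<sigma>)\<^sup>2 * (norm p)\<^sup>2) \<le> Re (cont_slow (1 / gp) p \<sigma> \<eta>)"
      by (rule Re_cont_slow_ge(2)[OF s c(1) order_refl])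
    have 2: "0 \<le> Re (cont_slow (1 / gm) p \<sigma> \<eta>)"
      using Re_cont_slow_ge(1)[OF s c, of \<eta>] norm_ge_zero order_trans by blast
    have "Re (N \<sigma> \<eta>) = (1 / gm) * Re (cont_slow (1 / gp) p \<sigma> \<eta>) + (1 / gp) * Re (cont_slow (1 / gm) p \<sigma> \<eta>)"
      by (simp add: N_def)
    moreover have "(1 / gm) * sqrt (1 / gp - (Im \<sigma>)\<^sup>2 * (norm p)\<^sup>2) \<le> (1 / gm) * Re (cont_slow (1 / gp) p \<sigma> \<eta>)"
      using 1 gm by (intro mult_left_mono) auto
    moreover have "0 \<le> (1 / gp) * Re (cont_slow (1 / gm) p \<sigma> \<eta>)" using 2 gp by simp
    ultimately show ?thesis by linarith
  qed
  have gap: "1 / gp - (Im \<sigma>)\<^sup>2 * (norm p)\<^sup>2 > 0" if "\<sigma> \<in> U" for \<sigma>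
    using strip_gap[of \<sigma> "1 / gp" p "1 / gp"] that c by (simp add: U_def)
  have azN: "away_zero U N"
  proof (rule away_zero_lower_bound[OF oU])
    show "continuous_on U (\<lambda>\<sigma>. (1 / gm) * sqrt (1 / gp - (Im \<sigma>)\<^sup>2 * (norm p)\<^sup>2))" by (intro continuous_intros)
    show "(1 / gm) * sqrt (1 / gp - (Im \<sigma>)\<^sup>2 * (norm p)\<^sup>2) > 0" if "\<sigma> \<in> U" for \<sigma> using gap[OF that] gm by simp
    show "(1 / gm) * sqrt (1 / gp - (Im \<sigma>)\<^sup>2 * (norm p)\<^sup>2) \<le> cmod (N \<sigma> \<eta>)" if "\<sigma> \<in> U" for \<sigma> \<eta>
      using Nge[OF that, of \<eta>] complex_Re_le_cmod[of "N \<sigma> \<eta>"] by linarith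
  qed
  have mN: "moderate n U N" for n
    unfolding N_def[abs_def] by (intro moderate_mult moderate_add moderate_const oU mS)
  have mf: "moderate n U (\<lambda>\<sigma> \<eta>. inverse (N \<sigma> \<eta>))" for n by (intro moderate_inverse oU mN azN)
  have co: "coercive U \<Psi>"
    unfolding coercive_def
  proof
    fix s assume s: "s \<in> U"
    \<comment> \<open>Absorbs the cost of the shift: |Re \<sigma>| |p| lost in the bound by |\<eta>
      + Re \<sigma> p|, and |Im \<sigma>| |X . p| in the linear term, where |\<sigma>| <= |s| + 1
      near s.\<close>
    define C where "C = \<tau> * (h * norm p + \<bar>X \<bullet> p\<bar>) * (norm s + 1)"
    have ev: "\<forall>\<^sub>F \<sigma> in nhds s. \<sigma> \<in> U" using oU s by (rule eventually_nhds_in_open)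
    have "\<forall>\<^sub>F \<sigma> in nhds s. dist \<sigma> s < 1" by (rule eventually_nhds_metric[THEN iffD2]) (auto intro!: exI[of _ 1])
    with ev have "\<forall>\<^sub>F \<sigma> in nhds s. \<forall>\<eta>. Re (\<Psi> \<sigma> \<eta>) \<ge> (\<tau> * h) * norm \<eta> - C"
    proof eventually_elim
      case (elim \<sigma>)
      have st: "\<sigma> \<in> strip (1 / gp) p" using elim by (simp add: U_def)
      have n: "norm \<sigma> \<le> norm s + 1" using elim(2) norm_triangle_sub[of \<sigma> s] by (simp add: dist_norm)
      have r: "\<bar>Re \<sigma>\<bar> \<le> norm s + 1" "\<bar>Im \<sigma>\<bar> \<le> norm s + 1"
        using n abs_Re_le_cmod[of \<sigma>] abs_Im_le_cmod[of \<sigma>] by auto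
      show ?case
      proof
        fix \<eta>
        have 1: "norm \<eta> - (norm s + 1) * norm p \<le> Re (cont_slow (1 / gm) p \<sigma> \<eta>)"
        proof -
          have "norm \<eta> - \<bar>Re \<sigma>\<bar> * norm p \<le> norm (\<eta> + Re \<sigma> *\<^sub>R p)"
            using norm_diff_ineq[of \<eta> "Re \<sigma> *\<^sub>R p"] by simp
          moreover have "\<bar>Re \<sigma>\<bar> * norm p \<le> (norm s + 1) * norm p" using r by (intro mult_right_mono) auto
          ultimately show ?thesis using Re_cont_slow_ge(1)[OF st c, of \<eta>] by linarith
        qed
        have 2: "0 \<le> Re (cont_slow (1 / gp) p \<sigma> \<eta>)"
          using Re_cont_slow_ge(1)[OF st c(1) order_refl, of \<eta>] norm_ge_zero order_trans by blast
        have 3: "- ((norm s + 1) * \<bar>X \<bullet> p\<bar>) \<le> Im \<sigma> * (X \<bullet> p)"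
        proof -
          have "\<bar>Im \<sigma> * (X \<bullet> p)\<bar> \<le> (norm s + 1) * \<bar>X \<bullet> p\<bar>" unfolding abs_mult using r by (intro mult_right_mono) auto
          then show ?thesis by linarith
        qed
        have "Re (\<Psi> \<sigma> \<eta>) = \<tau> * (h * Re (cont_slow (1 / gm) p \<sigma> \<eta>) + k * Re (cont_slow (1 / gp) p \<sigma> \<eta>) + Im \<sigma> * (X \<bullet> p))"
          by (simp add: \<Psi>_def)
        moreover have "h * (norm \<eta> - (norm s + 1) * norm p) \<le> h * Re (cont_slow (1 / gm) p \<sigma> \<eta>)"
          using 1 hk by (intro mult_left_mono) auto
        moreover have "0 \<le> k * Re (cont_slow (1 / gp) p \<sigma> \<eta>)" using 2 hk by simp
        ultimately have "\<tau> * (h * (norm \<eta> - (norm s + 1) * norm p) - (norm s + 1) * \<bar>X \<bullet> p\<bar>) \<le> Re (\<Psi> \<sigma> \<eta>)"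
          using 3 \<tau> by (auto intro!: mult_left_mono)
        then show "Re (\<Psi> \<sigma> \<eta>) \<ge> (\<tau> * h) * norm \<eta> - C" by (simp add: C_def algebra_simps)
      qed
    qed
    then show "\<exists>c>0. \<exists>C. \<forall>\<^sub>F v in nhds s. \<forall>\<eta>. c * norm \<eta> - C \<le> Re (\<Psi> v \<eta>)"
      using \<tau> hk by (intro exI[of _ "\<tau> * h"] conjI exI[of _ C]) auto
  qed
  have fd: "(\<lambda>\<sigma>. cont_slow (1 / gm) p \<sigma> \<eta>) field_differentiable (at \<sigma>)" "(\<lambda>\<sigma>. cont_slow (1 / gp) p \<sigma> \<eta>) field_differentiable (at \<sigma>)" if "\<sigma> \<in> U" for \<sigma> \<eta>
    using that c unfolding U_def by (auto intro: cont_slow_field_differentiable)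
  have "(LINT \<eta>|lborel. exp (- \<Psi> 0 \<eta>) * inverse (N 0 \<eta>)) = (LINT \<eta>|lborel. exp (- \<Psi> \<i> \<eta>) * inverse (N \<i> \<eta>))"
  proof (rule contour_shift[OF oU _ m\<Psi> co mf, where p = p])
    show "convex U" by (simp add: U_def convex_strip)
    show "(\<lambda>\<sigma>. \<Psi> \<sigma> \<eta>) field_differentiable at \<sigma>" if "\<sigma> \<in> U" for \<sigma> \<eta>
      unfolding \<Psi>_def using fd[OF that] by (intro derivative_intros)
    show "(\<lambda>\<sigma>. inverse (N \<sigma> \<eta>)) field_differentiable at \<sigma>" if "\<sigma> \<in> U" for \<sigma> \<eta>
      using away_zero_nonzero[OF azN that] fd[OF that] unfolding N_def by (intro derivative_intros) auto
    show "\<Psi> (\<sigma> + complex_of_real t) \<eta> = \<Psi> \<sigma> (\<eta> + t *\<^sub>R p)" for \<sigma> t \<eta>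
      by (simp add: \<Psi>_def cont_slow_def cont_arg_shift inner_add_right algebra_simps)
    show "inverse (N (\<sigma> + complex_of_real t) \<eta>) = inverse (N \<sigma> (\<eta> + t *\<^sub>R p))" for \<sigma> t \<eta>
      by (simp add: N_def cont_slow_def cont_arg_shift)
    show "0 \<in> U" using c by (simp add: U_def strip_iff)
    show "\<i> \<in> U" using imaginary_unit_strip[OF w] by (simp add: U_def defs)
  qed
  moreover have "(LINT \<eta>|lborel. exp (- \<Psi> 0 \<eta>) * inverse (N 0 \<eta>)) = 
    (LINT \<xi>|lborel. exp (\<i> * complex_of_real (\<tau> * (\<xi> \<bullet> (hor (fst w) - hor (snd w))))) *
        complex_of_real (exp (- (\<tau> * (- fst w $ 3 * vslow gm \<xi> + snd w $ 3 * vslow gp \<xi>))) / (vslow gp \<xi> / gm + vslow gm \<xi> / gp)))"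
  proof (intro Bochner_Integration.integral_cong refl)
    fix \<eta> :: "real^2"
    \<comment> \<open>At \<sigma> = 0 the continued roots are the real functions
      \<open>vslow\<close>, and the spectral integral reappears.\<close>
    have cS0: "cont_slow (1 / g) p 0 \<eta> = complex_of_real (vslow g \<eta>)" if "g > 0" for g
      using that by (simp add: cont_slow_def cont_arg_def vslow_def power2_norm_eq_inner of_real_add[symmetric] del: of_real_add)
    have "- \<Psi> 0 \<eta> = \<i> * complex_of_real (\<tau> * (\<eta> \<bullet> X)) + complex_of_real (- (\<tau> * (h * vslow gm \<eta> + k * vslow gp \<eta>)))"
      unfolding \<Psi>_def cS0[OF gm] cS0[OF gp] by (simp add: inner_commute algebra_simps)
    then have "exp (- \<Psi> 0 \<eta>) = exp (\<i> * complex_of_real (\<tau> * (\<eta> \<bullet> X))) * complex_of_real (exp (- (\<tau> * (h * vslow gm \<eta> + k * vslow gp \<eta>))))"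
      by (simp only: exp_add exp_of_real)
    moreover have "inverse (N 0 \<eta>) = complex_of_real (1 / (vslow gp \<eta> / gm + vslow gm \<eta> / gp))"
      unfolding N_def cS0[OF gm] cS0[OF gp] by (simp add: inverse_eq_divide)
    ultimately show "exp (- \<Psi> 0 \<eta>) * inverse (N 0 \<eta>) = exp (\<i> * complex_of_real (\<tau> * (\<eta> \<bullet> (hor (fst w) - hor (snd w))))) *
        complex_of_real (exp (- (\<tau> * (- fst w $ 3 * vslow gm \<eta> + snd w $ 3 * vslow gp \<eta>))) / (vslow gp \<eta> / gm + vslow gm \<eta> / gp))"
      by (simp add: defs offset_def depth_def height_def)
  qed
  moreover have "fst w $ 3 < 0" "snd w $ 3 > 0" using w by (auto simp: W_def lower_half_def upper_half_def)
  ultimately show ?thesis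
    using Phi_formula_spectral[OF gm gp, of "fst w" "snd w" \<tau>] \<tau> unfolding \<Psi>_def N_def defs by simp
qed

end

section \<open>The rescaled integral\<close>

text \<open>The vertical slowness at the complex point \<i> p + \<epsilon> \<eta>, with A its value
  at the saddle point; the link with \<open>cont_slow\<close> is
  \<open>cont_slow_scaled\<close>.\<close>

definition saddle_slow :: "real \<Rightarrow> real^2 \<Rightarrow> real \<Rightarrow> real^2 \<Rightarrow> complex" where
  "saddle_slow A p \<epsilon> \<eta> = csqrt (complex_of_real (A * A + \<epsilon> * \<epsilon> * (\<eta> \<bullet> \<eta>)) + \<i> * complex_of_real (2 * \<epsilon> * (p \<bullet> \<eta>)))"

text \<open>The phase of one layer on the shifted plane, without its value and its linear part at the saddle
  point and divided by \<open>\<epsilon>\<^sup>2\<close> (see \<open>saddle_rem_identity\<close>), in a form that is smooth at \<open>\<epsilon> = 0\<close>.\<close>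

definition saddle_rem :: "real \<Rightarrow> real^2 \<Rightarrow> real \<Rightarrow> real^2 \<Rightarrow> complex" where
  "saddle_rem A p \<epsilon> \<eta> = complex_of_real (inverse A * (1 / 2) * (\<eta> \<bullet> \<eta>)) -
     (complex_of_real (\<epsilon> * (\<eta> \<bullet> \<eta>)) + \<i> * complex_of_real (2 * (p \<bullet> \<eta>)))\<^sup>2 * complex_of_real (inverse A * (1 / 2)) *
       (inverse (saddle_slow A p \<epsilon> \<eta> + complex_of_real A))\<^sup>2"

lemma saddle_slow_sq: "(saddle_slow A p \<epsilon> \<eta>)\<^sup>2 = complex_of_real (A * A + \<epsilon> * \<epsilon> * (\<eta> \<bullet> \<eta>)) + \<i> * complex_of_real (2 * \<epsilon> * (p \<bullet> \<eta>))"
  by (simp add: saddle_slow_def)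

lemma Re_saddle_slow: "sqrt (A * A + \<epsilon> * \<epsilon> * (\<eta> \<bullet> \<eta>)) \<le> Re (saddle_slow A p \<epsilon> \<eta>)"
proof -
  have "A * A + \<epsilon> * \<epsilon> * (\<eta> \<bullet> \<eta>) \<ge> 0" by (simp add: zero_le_mult_iff)
  then show ?thesis
    unfolding saddle_slow_def
    using Re_csqrt_ge[of "complex_of_real (A * A + \<epsilon> * \<epsilon> * (\<eta> \<bullet> \<eta>)) + \<i> * complex_of_real (2 * \<epsilon> * (p \<bullet> \<eta>))"] by simp
qed

lemma Re_saddle_slow_ge: "A > 0 \<Longrightarrow> A \<le> Re (saddle_slow A p \<epsilon> \<eta>)"
proof -
  assume "A > 0"
  then have "A \<le> sqrt (A * A + \<epsilon> * \<epsilon> * (\<eta> \<bullet> \<eta>))"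
    by (intro real_le_rsqrt) (simp add: power2_eq_square zero_le_mult_iff)
  with Re_saddle_slow show ?thesis by (rule order_trans[rotated])
qed

text \<open>From S^2 - A^2 = \<epsilon> (\<epsilon> |\<eta>|^2 + 2 \<i> p . \<eta>) the quotient (S
  - A) / \<epsilon> equals the bracket divided by S + A, which is regular at \<epsilon> = 0. The
  remainder after the linear term is (\<epsilon>^2 |\<eta>|^2 - (S - A)^2) / (2 A).\<close>

lemma saddle_rem_identity:
  assumes A: "A > 0"
  shows "complex_of_real (\<epsilon> * \<epsilon>) * saddle_rem A p \<epsilon> \<eta> = saddle_slow A p \<epsilon> \<eta> - complex_of_real A - \<i> * complex_of_real (\<epsilon> * (p \<bullet> \<eta>) / A)"
proof -
  define S a where "S = saddle_slow A p \<epsilon> \<eta>" "a = complex_of_real A"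
  define e n P where "e = complex_of_real \<epsilon>" "n = complex_of_real (\<eta> \<bullet> \<eta>)" "P = complex_of_real (p \<bullet> \<eta>)"
  note defs = S_a_def e_n_P_def
  have a0: "a \<noteq> 0" using A by (simp add: defs)
  have "Re (S + a) > 0" using Re_saddle_slow_ge[OF A, of p \<epsilon> \<eta>] A by (simp add: defs)
  then have Sa: "S + a \<noteq> 0" by (metis zero_complex.sel(1) order_less_irrefl)
  have "S\<^sup>2 = a * a + e * e * n + \<i> * (2 * e * P)" using saddle_slow_sq[of A p \<epsilon> \<eta>] by (simp add: defs)
  then have z: "e * (e * n + \<i> * (2 * P)) = (S - a) * (S + a)" by (simp add: power2_eq_square algebra_simps)
  have "complex_of_real (\<epsilon> * \<epsilon>) * saddle_rem A p \<epsilon> \<eta> = e * e * (inverse a * (1 / 2) * n) - (e * (e * n + \<i> * (2 * P)))\<^sup>2 * (inverse a * (1 / 2)) * (inverse (S + a))\<^sup>2"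
    by (simp add: saddle_rem_def defs power2_eq_square algebra_simps)
  also have "\<dots> = e * e * (inverse a * (1 / 2) * n) - (S - a)\<^sup>2 * (inverse a * (1 / 2)) * ((S + a) * inverse (S + a))\<^sup>2"
    unfolding z by (simp add: power2_eq_square mult_ac)
  also have "(S + a) * inverse (S + a) = 1" using Sa by simp
  also have "e * e * (inverse a * (1 / 2) * n) - (S - a)\<^sup>2 * (inverse a * (1 / 2)) * 1\<^sup>2 = (e * e * n - (S - a)\<^sup>2) / (2 * a)"
    using a0 by (simp add: field_simps)
  also have "e * e * n - (S - a)\<^sup>2 = 2 * a * (S - a) - \<i> * (2 * e * P)"
    using z by (simp add: power2_eq_square algebra_simps)
  also have "(2 * a * (S - a) - \<i> * (2 * e * P)) / (2 * a) = S - a - \<i> * (e * P / a)"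
    using a0 by (simp add: field_simps)
  finally show ?thesis by (simp add: defs)
qed

lemma saddle_slow_zero: "A > 0 \<Longrightarrow> saddle_slow A p 0 \<eta> = complex_of_real A"
  by (simp add: saddle_slow_def del: of_real_mult)

lemma saddle_rem_zero:
  assumes "A > 0"
  shows "saddle_rem A p 0 \<eta> = complex_of_real ((\<eta> \<bullet> \<eta>) / (2 * A) + (p \<bullet> \<eta>)\<^sup>2 / (2 * A ^ 3))"
  using assms unfolding saddle_rem_def saddle_slow_zero[OF assms]
  by (simp add: power_mult_distrib power2_eq_square power3_eq_cube field_simps)

text \<open>Here \<epsilon>^2 times the real part is Re S - A, at least s - A = \<epsilon>^2
  |\<eta>|^2 / (s + A) with s = sqrt (A^2 + \<epsilon>^2 |\<eta>|^2) <= A + |\<epsilon>| |\<eta>|.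
  The bound is uniform as \<epsilon> tends to 0: quadratic while |\<epsilon> \<eta>| is small,
  linear beyond.\<close>

lemma Re_saddle_rem:
  assumes A: "A > 0"
  shows "(norm \<eta>)\<^sup>2 / (2 * A + \<bar>\<epsilon>\<bar> * norm \<eta>) \<le> Re (saddle_rem A p \<epsilon> \<eta>)"
proof (cases "\<epsilon> = 0")
  case True
  then show ?thesis using A by (simp add: saddle_rem_zero[OF A] power2_norm_eq_inner)
next
  case False
  define s where "s = sqrt (A * A + \<epsilon> * \<epsilon> * (\<eta> \<bullet> \<eta>))"
  have nn: "\<epsilon> * \<epsilon> * (\<eta> \<bullet> \<eta>) \<ge> 0" by (simp add: zero_le_mult_iff)
  have s2: "s\<^sup>2 = A * A + \<epsilon> * \<epsilon> * (\<eta> \<bullet> \<eta>)" using nn by (simp add: s_def)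
  have s0: "s \<ge> 0" by (simp add: s_def)
  have sle: "s \<le> A + \<bar>\<epsilon>\<bar> * norm \<eta>"
  proof -
    have "A * A + \<epsilon> * \<epsilon> * (\<eta> \<bullet> \<eta>) = A\<^sup>2 + (\<bar>\<epsilon>\<bar> * norm \<eta>)\<^sup>2"
      unfolding power_mult_distrib power2_norm_eq_inner by (simp add: power2_eq_square)
    also have "\<dots> \<le> (A + \<bar>\<epsilon>\<bar> * norm \<eta>)\<^sup>2" using A by (simp add: power2_sum)
    finally show ?thesis unfolding s_def using A by (intro real_le_lsqrt) auto
  qed
  have "Re (complex_of_real (\<epsilon> * \<epsilon>) * saddle_rem A p \<epsilon> \<eta>) = Re (saddle_slow A p \<epsilon> \<eta>) - A"
    unfolding saddle_rem_identity[OF A] by simp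
  then have r: "\<epsilon> * \<epsilon> * Re (saddle_rem A p \<epsilon> \<eta>) = Re (saddle_slow A p \<epsilon> \<eta>) - A" by simp
  have "\<epsilon> * \<epsilon> * ((norm \<eta>)\<^sup>2 / (2 * A + \<bar>\<epsilon>\<bar> * norm \<eta>)) = (s\<^sup>2 - A * A) / (2 * A + \<bar>\<epsilon>\<bar> * norm \<eta>)"
    by (simp add: s2 power2_norm_eq_inner)
  also have "\<dots> \<le> (s\<^sup>2 - A * A) / (s + A)"
    using sle s0 A nn s2 by (intro divide_left_mono mult_pos_pos) auto
  also have "\<dots> = s - A" using s0 A by (simp add: field_simps power2_eq_square)
  also have "\<dots> \<le> \<epsilon> * \<epsilon> * Re (saddle_rem A p \<epsilon> \<eta>)" unfolding r s_def using Re_saddle_slow by simp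
  finally have "\<epsilon> * \<epsilon> * ((norm \<eta>)\<^sup>2 / (2 * A + \<bar>\<epsilon>\<bar> * norm \<eta>)) \<le> \<epsilon> * \<epsilon> * Re (saddle_rem A p \<epsilon> \<eta>)" .
  moreover have "0 < \<epsilon> * \<epsilon>" using False not_real_square_gt_zero by blast
  ultimately show ?thesis by (rule mult_left_le_imp_le)
qed

text \<open>Trades the sharp bound for one whose constants are uniform in |\<epsilon>| <= E and A <=
  a, as \<open>coercive\<close> demands.\<close>

lemma Re_saddle_rem_linear:
  assumes A: "A > 0" "A \<le> a" and E: "\<bar>\<epsilon>\<bar> \<le> E" "E > 0"
  shows "norm \<eta> / E - 2 * a / E\<^sup>2 \<le> Re (saddle_rem A p \<epsilon> \<eta>)" "0 \<le> Re (saddle_rem A p \<epsilon> \<eta>)"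
proof -
  define t where "t = norm \<eta>"
  have t: "t \<ge> 0" by (simp add: t_def)
  have d: "2 * a + E * t > 0" using A E t by (intro add_pos_nonneg) auto
  \<comment> \<open>The linear quotient of t^2 by 2 a + E t; the remainder 4 a^2 / E^2 of the
    division is nonnegative, so the quotient lies below the fraction.\<close>
  have "(t / E - 2 * a / E\<^sup>2) * (2 * a + E * t) = t\<^sup>2 - 4 * a\<^sup>2 / E\<^sup>2"
    using E by (simp add: field_simps power2_eq_square)
  also have "\<dots> \<le> t\<^sup>2" by simp
  finally have "t / E - 2 * a / E\<^sup>2 \<le> t\<^sup>2 / (2 * a + E * t)" using d by (simp add: pos_le_divide_eq)
  also have "\<dots> \<le> t\<^sup>2 / (2 * A + \<bar>\<epsilon>\<bar> * t)"
    using A E t d by (intro divide_left_mono add_mono mult_mono mult_pos_pos add_pos_nonneg) auto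
  also have "\<dots> \<le> Re (saddle_rem A p \<epsilon> \<eta>)" unfolding t_def by (rule Re_saddle_rem[OF A(1)])
  finally show "norm \<eta> / E - 2 * a / E\<^sup>2 \<le> Re (saddle_rem A p \<epsilon> \<eta>)" by (simp add: t_def)
  have "0 \<le> (norm \<eta>)\<^sup>2 / (2 * A + \<bar>\<epsilon>\<bar> * norm \<eta>)" using A by simp
  then show "0 \<le> Re (saddle_rem A p \<epsilon> \<eta>)" using Re_saddle_rem[OF A(1)] by (rule order_trans)
qed

text \<open>Only \<epsilon>^2 and \<epsilon> \<eta> occur, and these survive a common change of
  sign.\<close>

lemma saddle_slow_even: "saddle_slow A p (- \<epsilon>) (- \<eta>) = saddle_slow A p \<epsilon> \<eta>"
  by (simp add: saddle_slow_def)

lemma saddle_rem_even: "saddle_rem A p (- \<epsilon>) (- \<eta>) = saddle_rem A p \<epsilon> \<eta>"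
proof -
  have "(complex_of_real (- \<epsilon> * ((- \<eta>) \<bullet> (- \<eta>))) + \<i> * complex_of_real (2 * (p \<bullet> (- \<eta>))))\<^sup>2 =
     (- (complex_of_real (\<epsilon> * (\<eta> \<bullet> \<eta>)) + \<i> * complex_of_real (2 * (p \<bullet> \<eta>))))\<^sup>2" by simp
  then show ?thesis unfolding saddle_rem_def saddle_slow_even by (simp only: power2_minus inner_minus_left inner_minus_right minus_minus)
qed

lemma cont_slow_scaled:
  assumes "A\<^sup>2 = c - (norm p)\<^sup>2"
  shows "cont_slow c p \<i> (\<epsilon> *\<^sub>R \<eta>) = saddle_slow A p \<epsilon> \<eta>"
proof -
  have "c = A * A + p \<bullet> p" using assms unfolding power2_norm_eq_inner by (simp add: power2_eq_square)
  then have "cont_arg c p \<i> (\<epsilon> *\<^sub>R \<eta>) = complex_of_real (A * A + \<epsilon> * \<epsilon> * (\<eta> \<bullet> \<eta>)) + \<i> * complex_of_real (2 * \<epsilon> * (p \<bullet> \<eta>))"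
    by (simp add: cont_arg_def algebra_simps)
  then show ?thesis by (simp add: cont_slow_def saddle_slow_def)
qed

text \<open>The Jacobian \<epsilon>^2 equals 1 / \<tau> and cancels the factor \<tau> in front of
  the spectral integral.\<close>

lemma lborel_integral_scale2:
  fixes f :: "real^2 \<Rightarrow> complex"
  assumes [measurable]: "f \<in> borel_measurable borel" and \<epsilon>: "\<epsilon> > 0"
  shows "(LINT z|lborel. f z) = complex_of_real (\<epsilon>\<^sup>2) * (LINT z|lborel. f (\<epsilon> *\<^sub>R z))"
proof -
  have "(LINT z|lborel. f z) = (LINT z|density (distr lborel borel (\<lambda>x::real^2. 0 + \<epsilon> *\<^sub>R x)) (\<lambda>_. ennreal (\<bar>\<epsilon>\<bar> ^ DIM(real^2))). f z)"
    using lborel_affine[of \<epsilon> "0::real^2"] \<epsilon> by simp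
  also have "\<dots> = (LINT z|distr lborel borel (\<lambda>x::real^2. \<epsilon> *\<^sub>R x). \<epsilon>\<^sup>2 *\<^sub>R f z)"
    using \<epsilon> by (subst integral_density) auto
  also have "\<dots> = (LINT z|lborel. \<epsilon>\<^sup>2 *\<^sub>R f (\<epsilon> *\<^sub>R z))"
    by (subst integral_distr) auto
  finally show ?thesis by (simp add: scaleR_conv_of_real)
qed

section \<open>The rescaled integral: smoothness up to \<epsilon> = 0 and its value there\<close>

context two_layers
begin

definition phase :: "real \<times> ((real^3) \<times> (real^3)) \<Rightarrow> real^2 \<Rightarrow> complex" where
  "phase u \<eta> = complex_of_real (depth (snd u)) * saddle_rem (slow_lo (snd u)) (slow_hor (snd u)) (fst u) \<eta> +
     complex_of_real (height (snd u)) * saddle_rem (slow_up (snd u)) (slow_hor (snd u)) (fst u) \<eta>"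

definition amp_denom :: "real \<times> ((real^3) \<times> (real^3)) \<Rightarrow> real^2 \<Rightarrow> complex" where
  "amp_denom u \<eta> = complex_of_real (1 / gm) * saddle_slow (slow_up (snd u)) (slow_hor (snd u)) (fst u) \<eta> + complex_of_real (1 / gp) * saddle_slow (slow_lo (snd u)) (slow_hor (snd u)) (fst u) \<eta>"

definition osc_int :: "real \<times> ((real^3) \<times> (real^3)) \<Rightarrow> complex" where
  "osc_int u = (LINT \<eta>|lborel. exp (- phase u \<eta>) * inverse (amp_denom u \<eta>))"

definition V :: "(real \<times> ((real^3) \<times> (real^3))) set" where "V = UNIV \<times> W"

lemma open_V: "open V" unfolding V_def by (intro open_Times open_UNIV open_W)

lemma V_snd: "u \<in> V \<Longrightarrow> snd u \<in> W" by (auto simp: V_def)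

lemma moderate_V_lift: "moderate n W f \<Longrightarrow> moderate n V (\<lambda>u. f (snd u))"
  by (rule moderate_compose_linear[OF open_W open_V bounded_linear_snd V_snd])

lemma moderate_V:
  "moderate n V (\<lambda>u (\<eta>::'e::euclidean_space). fst u)" "moderate n V (\<lambda>u (\<eta>::'e). depth (snd u))" "moderate n V (\<lambda>u (\<eta>::'e). height (snd u))"
  "moderate n V (\<lambda>u (\<eta>::'e). slow_lo (snd u))" "moderate n V (\<lambda>u (\<eta>::'e). slow_up (snd u))"
  "moderate n V (\<lambda>u (\<eta>::'e). inverse (slow_lo (snd u)))" "moderate n V (\<lambda>u (\<eta>::'e). inverse (slow_up (snd u)))"
  "moderate n V (\<lambda>u (\<eta>::'e). slow_hor (snd u))" "moderate n V (\<lambda>u (\<eta>::'e). \<eta>)"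
  by (rule moderate_bounded_linear_var[OF open_V bounded_linear_fst] moderate_V_lift[OF moderate_W(1)] moderate_V_lift[OF moderate_W(2)]
      moderate_V_lift[OF moderate_slow_lo(1)] moderate_V_lift[OF moderate_slow_lo(2)] moderate_V_lift[OF moderate_slow_lo(3)] moderate_V_lift[OF moderate_slow_lo(4)]
      moderate_V_lift[OF moderate_slow_hor] moderate_bounded_linear_param[OF open_V bounded_linear_ident])+

lemma continuous_on_slow_lo: "continuous_on V (\<lambda>u. slow_lo (snd u))" "continuous_on V (\<lambda>u. slow_up (snd u))"
proof -
  have c: "continuous_on W slow_lo" "continuous_on W slow_up"
    by (rule continuous_on_moderate_indep[where 'e = real, OF moderate_slow_lo(1)[of 0]] continuous_on_moderate_indep[where 'e = real, OF moderate_slow_lo(2)[of 0]])+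
  have s: "continuous_on V snd" "snd ` V \<subseteq> W" by (auto simp: V_def intro: continuous_on_snd)
  show "continuous_on V (\<lambda>u. slow_lo (snd u))" "continuous_on V (\<lambda>u. slow_up (snd u))"
    by (rule continuous_on_compose2[OF c(1) s] continuous_on_compose2[OF c(2) s])+
qed

text \<open>Stated for a generic vertical slowness and used once per layer. The argument of the root
  has real part at least A^2, positive and free of \<eta>.\<close>

lemma moderate_saddle_slow_aux:
  fixes A :: "real \<times> ((real^3) \<times> (real^3)) \<Rightarrow> real"
  assumes A: "\<And>n. moderate n V (\<lambda>u (\<eta>::real^2). A u)" and iA: "\<And>n. moderate n V (\<lambda>u (\<eta>::real^2). inverse (A u))"
    and cA: "continuous_on V A" and pos: "\<And>u. u \<in> V \<Longrightarrow> A u > 0"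
  shows "moderate n V (\<lambda>u \<eta>. saddle_slow (A u) (slow_hor (snd u)) (fst u) \<eta>)" "moderate n V (\<lambda>u \<eta>. saddle_rem (A u) (slow_hor (snd u)) (fst u) \<eta>)"
proof -
  define g where "g u \<eta> = complex_of_real (A u * A u + fst u * fst u * (\<eta> \<bullet> \<eta>)) + \<i> * complex_of_real (2 * fst u * (slow_hor (snd u) \<bullet> \<eta>))" for u and \<eta> :: "real^2"
  have g: "moderate n V g"
    unfolding g_def[abs_def]
    by (intro moderate_add moderate_mult moderate_of_real moderate_inner moderate_const open_V A moderate_V)
  have Reg: "A u * A u \<le> Re (g u \<eta>)" for u \<eta> by (simp add: g_def zero_le_mult_iff)
  have pos2: "Re (g u \<eta>) > 0" if "u \<in> V" for u \<eta>
    using Reg[of u \<eta>] mult_pos_pos[OF pos[OF that] pos[OF that]] by linarith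
  have "away_zero V g"
  proof (rule away_zero_lower_bound[OF open_V])
    show "continuous_on V (\<lambda>u. A u * A u)" using cA by (intro continuous_intros)
    show "A u * A u > 0" if "u \<in> V" for u using pos[OF that] by simp
    show "A u * A u \<le> cmod (g u \<eta>)" for u \<eta> using Reg[of u \<eta>] complex_Re_le_cmod order_trans by blast
  qed
  then show t: "moderate n V (\<lambda>u \<eta>. saddle_slow (A u) (slow_hor (snd u)) (fst u) \<eta>)"
    unfolding saddle_slow_def g_def[symmetric] by (intro moderate_csqrt open_V g pos2)
  \<comment> \<open>The denominator S + A in \<open>saddle_rem\<close> has real part at least A,
    which does not involve \<eta>.\<close>
  have az: "away_zero V (\<lambda>u \<eta>. saddle_slow (A u) (slow_hor (snd u)) (fst u) \<eta> + complex_of_real (A u))"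
  proof (rule away_zero_lower_bound[OF open_V cA pos])
    fix u and \<eta> :: "real^2" assume u: "u \<in> V"
    have "A u \<le> Re (saddle_slow (A u) (slow_hor (snd u)) (fst u) \<eta> + complex_of_real (A u))"
      using Re_saddle_slow_ge[OF pos[OF u], of "slow_hor (snd u)" "fst u" \<eta>] pos[OF u] by simp
    then show "A u \<le> cmod (saddle_slow (A u) (slow_hor (snd u)) (fst u) \<eta> + complex_of_real (A u))"
      using complex_Re_le_cmod order_trans by blast
  qed auto
  show "moderate n V (\<lambda>u \<eta>. saddle_rem (A u) (slow_hor (snd u)) (fst u) \<eta>)"
    unfolding saddle_rem_def
    by (intro moderate_add moderate_diff moderate_mult moderate_power moderate_inverse moderate_of_real moderate_inner moderate_const
        open_V A iA t az moderate_V)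
qed

lemma slow_lo_pos_V: "u \<in> V \<Longrightarrow> slow_lo (snd u) > 0" "u \<in> V \<Longrightarrow> slow_up (snd u) > 0"
  using slow_lo_pos slow_up_pos V_snd by auto

lemmas moderate_lo_slow = moderate_saddle_slow_aux[OF moderate_V(4) moderate_V(6) continuous_on_slow_lo(1) slow_lo_pos_V(1)]
lemmas moderate_up_slow = moderate_saddle_slow_aux[OF moderate_V(5) moderate_V(7) continuous_on_slow_lo(2) slow_lo_pos_V(2)]

lemma moderate_phase: "moderate n V phase"
  unfolding phase_def[abs_def] by (intro moderate_add moderate_mult moderate_of_real open_V moderate_V moderate_lo_slow moderate_up_slow)

lemma moderate_amp_denom: "moderate n V amp_denom"
  unfolding amp_denom_def[abs_def] by (intro moderate_add moderate_mult moderate_const open_V moderate_V moderate_lo_slow moderate_up_slow)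

lemma away_zero_amp_denom: "away_zero V amp_denom"
proof (rule away_zero_lower_bound[OF open_V])
  show "continuous_on V (\<lambda>u. slow_lo (snd u) / gp)" using gp by (intro continuous_intros continuous_on_slow_lo) auto
  show "slow_lo (snd u) / gp > 0" if "u \<in> V" for u using slow_lo_pos_V[OF that] gp by simp
  fix u and \<eta> :: "real^2" assume u: "u \<in> V"
  have "Re (amp_denom u \<eta>) = Re (saddle_slow (slow_up (snd u)) (slow_hor (snd u)) (fst u) \<eta>) / gm + Re (saddle_slow (slow_lo (snd u)) (slow_hor (snd u)) (fst u) \<eta>) / gp"
    by (simp add: amp_denom_def)
  moreover have "0 \<le> Re (saddle_slow (slow_up (snd u)) (slow_hor (snd u)) (fst u) \<eta>) / gm"
    using Re_saddle_slow_ge[OF slow_lo_pos_V(2)[OF u], of "slow_hor (snd u)" "fst u" \<eta>] slow_lo_pos_V(2)[OF u] gm by simp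
  moreover have "slow_lo (snd u) / gp \<le> Re (saddle_slow (slow_lo (snd u)) (slow_hor (snd u)) (fst u) \<eta>) / gp"
    using Re_saddle_slow_ge[OF slow_lo_pos_V(1)[OF u], of "slow_hor (snd u)" "fst u" \<eta>] gp by (intro divide_right_mono) auto
  ultimately show "slow_lo (snd u) / gp \<le> cmod (amp_denom u \<eta>)" using complex_Re_le_cmod[of "amp_denom u \<eta>"] by linarith
qed

lemma coercive_phase: "coercive V phase"
  unfolding coercive_def
proof
  fix u0 assume u0: "u0 \<in> V"
  \<comment> \<open>Local bounds: \<open>h0\<close> from below for the depth, \<open>E\<close> from
    above for |\<epsilon>|, \<open>a\<close> from above for \<open>slow_lo\<close>. The lower layer
    alone supplies the growth; from the upper one nonnegativity is enough.\<close>
  define h0 E a where "h0 = depth (snd u0) / 2" "E = \<bar>fst u0\<bar> + 1" "a = sqrt (1 / gm)"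
  have h0: "h0 > 0" and E: "E > 0" using hk_pos(1)[OF V_snd[OF u0]] by (auto simp: h0_E_a_def)
  have 1: "\<forall>\<^sub>F u in nhds u0. u \<in> V" using open_V u0 by (rule eventually_nhds_in_open)
  have "isCont (\<lambda>u. depth (snd u)) u0" by (intro linear_continuous_at bounded_linear_compose[OF depth_linear bounded_linear_snd])
  then have "((\<lambda>u. depth (snd u)) \<longlongrightarrow> depth (snd u0)) (nhds u0)"
    by (simp add: continuous_at tendsto_at_iff_tendsto_nhds[of "\<lambda>u. depth (snd u)" u0])
  then have 2: "\<forall>\<^sub>F u in nhds u0. h0 < depth (snd u)"
    by (rule order_tendstoD) (use h0 in \<open>simp add: h0_E_a_def\<close>)
  have "isCont (\<lambda>u. \<bar>fst u\<bar>) u0" by (intro continuous_intros)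
  then have "((\<lambda>u. \<bar>fst u\<bar>) \<longlongrightarrow> \<bar>fst u0\<bar>) (nhds u0)"
    by (simp add: continuous_at tendsto_at_iff_tendsto_nhds[of "\<lambda>u. \<bar>fst u\<bar>" u0])
  then have 3: "\<forall>\<^sub>F u in nhds u0. \<bar>fst u\<bar> < E"
    by (rule order_tendstoD) (simp add: h0_E_a_def)
  from 1 2 3 have "\<forall>\<^sub>F u in nhds u0. \<forall>\<eta>. Re (phase u \<eta>) \<ge> (h0 / E) * norm \<eta> - h0 * (2 * a / E\<^sup>2)"
  proof eventually_elim
    case (elim u)
    have Aa: "slow_lo (snd u) \<le> a" unfolding slow_lo_def h0_E_a_def using slow_sq(1)[OF V_snd[OF elim(1)]] by simp
    show ?case
    proof
      fix \<eta>
      have A: "norm \<eta> / E - 2 * a / E\<^sup>2 \<le> Re (saddle_rem (slow_lo (snd u)) (slow_hor (snd u)) (fst u) \<eta>)" "0 \<le> Re (saddle_rem (slow_lo (snd u)) (slow_hor (snd u)) (fst u) \<eta>)"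
        using Re_saddle_rem_linear[OF slow_lo_pos_V(1)[OF elim(1)] Aa _ E] elim(3) by auto
      have B: "0 \<le> Re (saddle_rem (slow_up (snd u)) (slow_hor (snd u)) (fst u) \<eta>)"
        using Re_saddle_rem_linear(2)[OF slow_lo_pos_V(2)[OF elim(1)] order_refl _ E] elim(3) by auto
      have "h0 * (norm \<eta> / E - 2 * a / E\<^sup>2) \<le> h0 * Re (saddle_rem (slow_lo (snd u)) (slow_hor (snd u)) (fst u) \<eta>)"
        using A(1) h0 by (intro mult_left_mono) auto
      also have "\<dots> \<le> depth (snd u) * Re (saddle_rem (slow_lo (snd u)) (slow_hor (snd u)) (fst u) \<eta>)"
        using A(2) elim(2) by (intro mult_right_mono) auto
      also have "\<dots> \<le> Re (phase u \<eta>)"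
        using B hk_pos(2)[OF V_snd[OF elim(1)]] by (simp add: phase_def)
      finally show "Re (phase u \<eta>) \<ge> (h0 / E) * norm \<eta> - h0 * (2 * a / E\<^sup>2)" by (simp add: right_diff_distrib)
    qed
  qed
  then show "\<exists>c>0. \<exists>C. \<forall>\<^sub>F v in nhds u0. \<forall>\<eta>. c * norm \<eta> - C \<le> Re (phase v \<eta>)"
    using h0 E by (intro exI[of _ "h0 / E"] conjI exI[of _ "h0 * (2 * a / E\<^sup>2)"]) auto
qed

lemma Ck_on_osc_int: "Ck_on n osc_int V"
  unfolding osc_int_def[abs_def]
  by (rule Ck_on_laplace[OF open_V moderate_phase coercive_phase]) (intro moderate_inverse open_V moderate_amp_denom away_zero_amp_denom)

text \<open>Substituting - \<eta> for \<eta> absorbs the sign of \<epsilon>.\<close>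

lemma osc_int_even: "osc_int (- \<epsilon>, w) = osc_int (\<epsilon>, w)"
proof -
  have "osc_int (- \<epsilon>, w) = (LINT \<eta>|lborel. exp (- phase (- \<epsilon>, w) (- \<eta>)) * inverse (amp_denom (- \<epsilon>, w) (- \<eta>)))"
    unfolding osc_int_def by (rule lborel_integral_minus[symmetric])
  also have "\<dots> = osc_int (\<epsilon>, w)"
    unfolding osc_int_def by (simp add: phase_def amp_denom_def saddle_rem_even saddle_slow_even)
  finally show ?thesis .
qed

text \<open>At the saddle point the phase equals the travel time, and its linear part vanishes
  because offset = (h / A + k / B) p. What is left is \<epsilon>^2 \<open>phase\<close>, and \<tau>
  \<epsilon>^2 = 1.\<close>

lemma Phi_formula_osc_int:
  assumes w: "w \<in> W" and \<epsilon>: "\<epsilon> > 0" and \<tau>: "\<tau> = 1 / \<epsilon>\<^sup>2"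
  shows "Phi_formula gm gp \<tau> (fst w) (snd w) = complex_of_real (exp (- (\<tau> * travel w)) / (4 * pi\<^sup>2 * gm * gp)) * osc_int (\<epsilon>, w)"
proof -
  define A B p h k X where "A = slow_lo w" "B = slow_up w" "p = slow_hor w" "h = depth w" "k = height w" "X = offset w"
  note defs = A_B_p_h_k_X_def
  have pos: "A > 0" "B > 0" using slow_lo_pos[OF w] slow_up_pos[OF w] by (auto simp: defs)
  have A: "A\<^sup>2 = 1 / gm - (norm p)\<^sup>2" and B: "B\<^sup>2 = 1 / gp - (norm p)\<^sup>2"
    using slow_lo_sq[OF w] slow_up_sq[OF w] norm_slow_hor[OF w] by (auto simp: defs)
  have \<tau>0: "\<tau> > 0" "\<tau> * (\<epsilon> * \<epsilon>) = 1" using \<epsilon> by (auto simp: \<tau> power2_eq_square)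
  define F where "F \<eta> = exp (- (complex_of_real \<tau> * (complex_of_real h * cont_slow (1 / gm) p \<i> \<eta> + complex_of_real k * cont_slow (1 / gp) p \<i> \<eta>
          - \<i> * (complex_of_real (X \<bullet> \<eta>) + \<i> * complex_of_real (X \<bullet> p))))) *
        inverse (complex_of_real (1 / gm) * cont_slow (1 / gp) p \<i> \<eta> + complex_of_real (1 / gp) * cont_slow (1 / gm) p \<i> \<eta>)" for \<eta>
  have meas: "F \<in> borel_measurable borel"
  proof -
    have s: "\<i> \<in> strip (1 / gp) p" using imaginary_unit_strip[OF w] by (simp add: defs)
    have c: "1 / gp > 0" "1 / gp \<le> 1 / gm" using gp inv_less by auto
    note [measurable] = moderate_measurable[OF moderate_cont_slow[OF c(1) c(2), of 0 p] s] moderate_measurable[OF moderate_cont_slow[OF c(1) order_refl, of 0 p] s]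
    show ?thesis unfolding F_def by measurable
  qed
  have e: "F (\<epsilon> *\<^sub>R \<eta>) = complex_of_real (exp (- (\<tau> * travel w))) * (exp (- phase (\<epsilon>, w) \<eta>) * inverse (amp_denom (\<epsilon>, w) \<eta>))" for \<eta>
  proof -
    define SA SB rA rB where "SA = saddle_slow A p \<epsilon> \<eta>" "SB = saddle_slow B p \<epsilon> \<eta>" "rA = saddle_rem A p \<epsilon> \<eta>" "rB = saddle_rem B p \<epsilon> \<eta>"
    note sd = SA_SB_rA_rB_def
    have rA: "SA = complex_of_real (\<epsilon> * \<epsilon>) * rA + complex_of_real A + \<i> * complex_of_real (\<epsilon> * (p \<bullet> \<eta>) / A)"
      using saddle_rem_identity[OF pos(1), of \<epsilon> p \<eta>] by (simp add: sd)
    have rB: "SB = complex_of_real (\<epsilon> * \<epsilon>) * rB + complex_of_real B + \<i> * complex_of_real (\<epsilon> * (p \<bullet> \<eta>) / B)"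
      using saddle_rem_identity[OF pos(2), of \<epsilon> p \<eta>] by (simp add: sd)
    have Xp: "X = (h / A + k / B) *\<^sub>R p" using slow_hor_offset[OF w] by (simp add: defs spread_saddle_def)
    have 1: "complex_of_real h * SA + complex_of_real k * SB - \<i> * (complex_of_real (X \<bullet> (\<epsilon> *\<^sub>R \<eta>)) + \<i> * complex_of_real (X \<bullet> p)) =
       complex_of_real (travel w) + complex_of_real (\<epsilon> * \<epsilon>) * (complex_of_real h * rA + complex_of_real k * rB)"
    proof -
      have "X \<bullet> (\<epsilon> *\<^sub>R \<eta>) = h * (\<epsilon> * (p \<bullet> \<eta>) / A) + k * (\<epsilon> * (p \<bullet> \<eta>) / B)" unfolding Xp by (simp add: algebra_simps)
      moreover have "travel w = X \<bullet> p + A * h + B * k" by (simp add: travel_def defs inner_commute)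
      ultimately show ?thesis unfolding rA rB by (simp add: algebra_simps)
    qed
    have "complex_of_real \<tau> * (complex_of_real h * SA + complex_of_real k * SB - \<i> * (complex_of_real (X \<bullet> (\<epsilon> *\<^sub>R \<eta>)) + \<i> * complex_of_real (X \<bullet> p))) =
       complex_of_real (\<tau> * travel w) + complex_of_real (\<tau> * (\<epsilon> * \<epsilon>)) * (complex_of_real h * rA + complex_of_real k * rB)"
      unfolding 1 by (simp add: algebra_simps)
    also have "\<dots> = complex_of_real (\<tau> * travel w) + phase (\<epsilon>, w) \<eta>"
      unfolding \<tau>0(2) by (simp add: phase_def sd defs)
    finally show ?thesis
      unfolding F_def cont_slow_scaled[OF A] cont_slow_scaled[OF B] sd[symmetric]
      by (simp add: amp_denom_def defs[symmetric] sd[symmetric] exp_add exp_minus exp_diff exp_of_real[symmetric] field_simps)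
  qed
  have "(LINT \<eta>|lborel. F \<eta>) = complex_of_real (\<epsilon>\<^sup>2) * (LINT \<eta>|lborel. F (\<epsilon> *\<^sub>R \<eta>))"
    by (rule lborel_integral_scale2[OF meas \<epsilon>])
  also have "\<dots> = complex_of_real (\<epsilon>\<^sup>2) * (complex_of_real (exp (- (\<tau> * travel w))) * osc_int (\<epsilon>, w))"
    unfolding e osc_int_def by simp
  finally have F: "(LINT \<eta>|lborel. F \<eta>) = complex_of_real (\<epsilon>\<^sup>2) * (complex_of_real (exp (- (\<tau> * travel w))) * osc_int (\<epsilon>, w))" .
  have "Phi_formula gm gp \<tau> (fst w) (snd w) = complex_of_real (\<tau> / (4 * pi\<^sup>2 * gm * gp)) * (LINT \<eta>|lborel. F \<eta>)"
    unfolding Phi_formula_shifted[OF w \<tau>0(1)] F_def defs ..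
  also have "\<dots> = complex_of_real (\<tau> / (4 * pi\<^sup>2 * gm * gp) * (\<epsilon>\<^sup>2 * exp (- (\<tau> * travel w)))) * osc_int (\<epsilon>, w)"
    unfolding F by simp
  also have "\<tau> / (4 * pi\<^sup>2 * gm * gp) * (\<epsilon>\<^sup>2 * exp (- (\<tau> * travel w))) = (\<tau> * (\<epsilon> * \<epsilon>)) * exp (- (\<tau> * travel w)) / (4 * pi\<^sup>2 * gm * gp)"
    by (simp add: power2_eq_square)
  finally show ?thesis unfolding \<tau>0(2) by simp
qed

text \<open>At \<epsilon> = 0 the phase is a pure quadratic form with axes across and along p, and
  the amplitude is constant in \<eta>.\<close>

lemma osc_int_zero:
  assumes w: "w \<in> W"
  shows "osc_int (0, w) = complex_of_real (2 * pi / (sqrt ((depth w / slow_lo w + height w / slow_up w) * (depth w / (gm * slow_lo w ^ 3) + height w / (gp * slow_up w ^ 3))) * (slow_up w / gm + slow_lo w / gp)))"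
proof -
  define A B p h k where "A = slow_lo w" "B = slow_up w" "p = slow_hor w" "h = depth w" "k = height w"
  note defs = A_B_p_h_k_def
  have pos: "A > 0" "B > 0" "h > 0" "k > 0" using slow_lo_pos[OF w] slow_up_pos[OF w] hk_pos[OF w] by (auto simp: defs)
  have A: "A\<^sup>2 + (norm p)\<^sup>2 = 1 / gm" and B: "B\<^sup>2 + (norm p)\<^sup>2 = 1 / gp"
    using slow_lo_sq[OF w] slow_up_sq[OF w] norm_slow_hor[OF w] by (auto simp: defs)
  define \<alpha> \<beta> where "\<alpha> = (h / A + k / B) / 2" "\<beta> = (h / A ^ 3 + k / B ^ 3) / 2"
  have ab: "\<alpha> > 0" "\<beta> > 0" using pos by (auto simp: \<alpha>_\<beta>_def intro!: add_pos_pos)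
  have phase: "phase (0, w) \<eta> = complex_of_real (\<alpha> * (norm \<eta>)\<^sup>2 + \<beta> * (p \<bullet> \<eta>)\<^sup>2)" for \<eta>
    unfolding phase_def by (simp add: defs[symmetric] saddle_rem_zero pos \<alpha>_\<beta>_def power2_norm_eq_inner add_divide_distrib algebra_simps)
  have amp_denom: "amp_denom (0, w) \<eta> = complex_of_real (B / gm + A / gp)" for \<eta>
    unfolding amp_denom_def by (simp add: defs[symmetric] saddle_slow_zero pos)
  have "osc_int (0, w) = (LINT \<eta>|lborel. complex_of_real (1 / (B / gm + A / gp)) * complex_of_real (exp (- (\<alpha> * (norm \<eta>)\<^sup>2 + \<beta> * (p \<bullet> \<eta>)\<^sup>2))))"
    unfolding osc_int_def phase amp_denom by (simp add: exp_of_real[symmetric] inverse_eq_divide)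
  also have "\<dots> = complex_of_real (1 / (B / gm + A / gp)) * complex_of_real (pi / sqrt (\<alpha> * (\<alpha> + \<beta> * (norm p)\<^sup>2)))"
    unfolding integral_mult_right_zero by (subst integral_anisotropic_gaussian) (use ab in auto)
  also have "\<dots> = complex_of_real (1 / (B / gm + A / gp) * (pi / sqrt (\<alpha> * (\<alpha> + \<beta> * (norm p)\<^sup>2))))" by simp
  \<comment> \<open>A^2 + |p|^2 = 1 / gm and its upper analogue make \<alpha> + \<beta> |p|^2 a
    plain sum over the layers.\<close>
  also have "\<alpha> * (\<alpha> + \<beta> * (norm p)\<^sup>2) = ((h / A + k / B) * (h / (gm * A ^ 3) + k / (gp * B ^ 3))) / 2\<^sup>2"
  proof -
    have "h / A + h / A ^ 3 * (norm p)\<^sup>2 = h / A ^ 3 * (A\<^sup>2 + (norm p)\<^sup>2)"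
      using pos by (simp add: field_simps power2_eq_square power3_eq_cube)
    moreover have "k / B + k / B ^ 3 * (norm p)\<^sup>2 = k / B ^ 3 * (B\<^sup>2 + (norm p)\<^sup>2)"
      using pos by (simp add: field_simps power2_eq_square power3_eq_cube)
    moreover have "\<alpha> + \<beta> * (norm p)\<^sup>2 = ((h / A + h / A ^ 3 * (norm p)\<^sup>2) + (k / B + k / B ^ 3 * (norm p)\<^sup>2)) / 2"
      by (simp add: \<alpha>_\<beta>_def algebra_simps add_divide_distrib)
    ultimately have e: "\<alpha> + \<beta> * (norm p)\<^sup>2 = (h / (gm * A ^ 3) + k / (gp * B ^ 3)) / 2"
      unfolding A B by (simp add: mult.commute)
    show ?thesis unfolding e unfolding \<alpha>_\<beta>_def(1) by (simp add: power2_eq_square)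
  qed
  also have "sqrt (((h / A + k / B) * (h / (gm * A ^ 3) + k / (gp * B ^ 3))) / 2\<^sup>2) = sqrt ((h / A + k / B) * (h / (gm * A ^ 3) + k / (gp * B ^ 3))) / 2"
    unfolding real_sqrt_divide by simp
  finally show ?thesis unfolding defs by (simp add: mult.commute)
qed

end

section \<open>Expansion in the square root of the wavelength\<close>

lemma Ck_on_SucD: "Ck_on (Suc n) f U \<Longrightarrow> Ck_on n (\<lambda>x. frechet_derivative f (at x) v) U"
  by simp

lemma Ck_on_has_derivative:
  "Ck_on (Suc n) f U \<Longrightarrow> u \<in> U \<Longrightarrow> (f has_derivative frechet_derivative f (at u)) (at u)"
  using frechet_derivative_works[of f "at u"] by simp

text \<open>Used at \<epsilon> = 0 for the coefficients and at \<epsilon> = 1 / sqrt \<tau> for the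
  continuity of the remainders.\<close>

lemma Ck_on_section:
  fixes f :: "real \<times> 'w::euclidean_space \<Rightarrow> 'b::real_normed_vector"
  assumes "open W" "Ck_on n f (UNIV \<times> W)"
  shows "Ck_on n (\<lambda>w. f (c, w)) W"
  using assms(2)
proof (induction n arbitrary: f)
  case 0
  then have "continuous_on (UNIV \<times> W) f" by simp
  then have "continuous_on W (\<lambda>w. f (c, w))"
    by (rule continuous_on_compose2) (auto intro!: continuous_intros)
  then show ?case by simp
next
  case (Suc n)
  show ?case
  proof (rule Ck_on_SucI[OF \<open>open W\<close>])
    show "((\<lambda>w. f (c, w)) has_derivative (\<lambda>v. frechet_derivative f (at (c, w)) (0, v))) (at w)" if "w \<in> W" for w
    proof (rule has_derivative_compose[of "\<lambda>w. (c, w)"])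
      show "(Pair c has_derivative Pair 0) (at w)" by (auto intro!: derivative_eq_intros)
      show "(f has_derivative frechet_derivative f (at (c, w))) (at (c, w))"
        by (rule Ck_on_has_derivative[OF Suc.prems]) (use that in auto)
    qed
    show "Ck_on n (\<lambda>w. frechet_derivative f (at (c, w)) (0, v)) W" for v
      by (rule Suc.IH[OF Ck_on_SucD[OF Suc.prems]])
  qed
qed

definition edir :: "(real \<times> 'w::real_normed_vector \<Rightarrow> 'b::real_normed_vector) \<Rightarrow> real \<times> 'w \<Rightarrow> 'b" where
  "edir g u = frechet_derivative g (at u) (1, 0)"

definition eflip :: "real \<times> 'w \<Rightarrow> real \<times> 'w" where "eflip u = (- fst u, snd u)"

lemma eflip_linear: "bounded_linear (eflip :: real \<times> 'w::real_normed_vector \<Rightarrow> _)"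
  unfolding eflip_def by (intro bounded_linear_Pair bounded_linear_minus bounded_linear_fst bounded_linear_snd)

text \<open>Differentiates the relation between G and its reflection on both sides; as it holds on
  an open set, uniqueness of the derivative applies.\<close>

lemma frechet_derivative_parity:
  fixes G :: "real \<times> 'w::euclidean_space \<Rightarrow> 'b::real_normed_vector"
  assumes W: "open W" and G: "Ck_on (Suc 0) G (UNIV \<times> W)"
    and par: "\<And>u. u \<in> UNIV \<times> W \<Longrightarrow> G (eflip u) = c *\<^sub>R G u" and u: "u \<in> UNIV \<times> W"
  shows "frechet_derivative G (at (eflip u)) (eflip v) = c *\<^sub>R frechet_derivative G (at u) v"
proof -
  have fu: "eflip u \<in> UNIV \<times> W" using u by (auto simp: eflip_def)
  have o: "open (UNIV \<times> W)" using W by (intro open_Times open_UNIV)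
  have 1: "((\<lambda>u. G (eflip u)) has_derivative (\<lambda>v. frechet_derivative G (at (eflip u)) (eflip v))) (at u)"
    by (rule has_derivative_compose[OF bounded_linear_imp_has_derivative[OF eflip_linear] Ck_on_has_derivative[OF G fu]])
  have "((\<lambda>u. c *\<^sub>R G u) has_derivative (\<lambda>v. c *\<^sub>R frechet_derivative G (at u) v)) (at u)"
    by (rule has_derivative_scaleR_right[OF Ck_on_has_derivative[OF G u]])
  then have "((\<lambda>u. G (eflip u)) has_derivative (\<lambda>v. c *\<^sub>R frechet_derivative G (at u) v)) (at u)"
    by (rule has_derivative_transform_within_open[OF _ o u]) (simp add: par)
  from has_derivative_unique[OF 1 this] show ?thesis by (rule fun_cong)
qed

lemma Ck_on_edir_funpow:
  assumes "\<And>n. Ck_on n g U" shows "Ck_on n ((edir ^^ i) g) U"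
  using assms by (induction i arbitrary: n) (auto simp: edir_def[abs_def] simp del: Ck_on.simps intro: Ck_on_SucD)

text \<open>Taylor's formula in \<epsilon> with integral remainder of even order; the remainder is
  controlled by one \<epsilon>-derivative, which is bounded on the compact set [0, 1] x K.\<close>

lemma even_taylor_bound:
  fixes g :: "real \<times> 'w::euclidean_space \<Rightarrow> 'b::banach"
  assumes W: "open W" and g: "\<And>n. Ck_on n g (UNIV \<times> W)"
    and even: "\<And>\<epsilon> w. w \<in> W \<Longrightarrow> g (- \<epsilon>, w) = g (\<epsilon>, w)" and K: "compact K" "K \<subseteq> W"
  obtains C where "C > 0"
    "\<And>w \<epsilon>. w \<in> K \<Longrightarrow> 0 \<le> \<epsilon> \<Longrightarrow> \<epsilon> \<le> 1 \<Longrightarrow>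
      norm (g (\<epsilon>, w) - (\<Sum>j=0..N. \<epsilon> ^ (2 * j) *\<^sub>R ((1 / fact (2 * j)) *\<^sub>R (edir ^^ (2 * j)) g (0, w)))) \<le> C * \<epsilon> ^ (2 * (N + 1))"
proof -
  define G where "G i = (edir ^^ i) g" for i
  have GS: "G (Suc i) = edir (G i)" for i by (simp add: G_def)
  have CG: "Ck_on n (G i) (UNIV \<times> W)" for n i unfolding G_def by (rule Ck_on_edir_funpow[OF g])
  have par: "G i (eflip u) = (- 1) ^ i *\<^sub>R G i u" if "u \<in> UNIV \<times> W" for i u
    using that
  proof (induction i arbitrary: u)
    case 0
    then show ?case using even[of "snd u" "fst u"] by (auto simp: G_def eflip_def)
  next
    case (Suc i)
    \<comment> \<open>Differentiating along (1, 0) = eflip (-1, 0) costs one sign, so the parity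
      alternates with the order.\<close>
    have "eflip (- 1, 0) = (1::real, 0::'w)" by (simp add: eflip_def)
    then have "G (Suc i) (eflip u) = frechet_derivative (G i) (at (eflip u)) (eflip (- 1, 0))"
      by (simp only: GS edir_def)
    also have "\<dots> = (- 1) ^ i *\<^sub>R frechet_derivative (G i) (at u) (- 1, 0)"
      by (rule frechet_derivative_parity[OF W CG Suc.IH Suc.prems])
    also have "frechet_derivative (G i) (at u) (- 1, 0) = - frechet_derivative (G i) (at u) (1, 0)"
      using linear_neg[OF has_derivative_linear[OF Ck_on_has_derivative[OF CG[of "Suc 0"] Suc.prems]], of i "(1, 0)"] by simp
    finally show ?case by (simp add: GS edir_def)
  qed
  \<comment> \<open>Only even powers of \<open>\<epsilon> = 1 / sqrt \<tau>\<close> survive, that is, integer powers of \<open>1 / \<tau>\<close>.\<close>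
  have odd: "G i (0, w) = 0" if "odd i" "w \<in> W" for i w
  proof -
    have "G i (0, w) = - G i (0, w)" using par[of "(0, w)" i] that by (simp add: eflip_def)
    then have "(2::real) *\<^sub>R G i (0, w) = 0" by (simp add: scaleR_2 eq_neg_iff_add_eq_0)
    then show ?thesis by simp
  qed
  have dG: "((\<lambda>t. G i (t, w)) has_vector_derivative G (Suc i) (t, w)) (at t within S)" if w: "w \<in> W" for i w t S
  proof -
    have 1: "((\<lambda>t. (t, w)) has_derivative (\<lambda>s. (s, 0))) (at t within S)" by (auto intro!: derivative_eq_intros)
    have 2: "(G i has_derivative frechet_derivative (G i) (at (t, w))) (at (t, w))"
      by (rule Ck_on_has_derivative[OF CG]) (use w in auto)
    have 3: "frechet_derivative (G i) (at (t, w)) (s, 0) = s *\<^sub>R G (Suc i) (t, w)" for s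
      using linear_scale[OF has_derivative_linear[OF 2], of s "(1, 0)"] by (simp add: GS edir_def)
    show ?thesis unfolding has_vector_derivative_def using has_derivative_compose[OF 1 2] unfolding 3 .
  qed
  \<comment> \<open>The Taylor polynomial has degree 2 N + 1, and its top term is odd and vanishes:
    the sum ends at \<epsilon>^(2 N) while the remainder is already of order \<epsilon>^(2 N +
    2).\<close>
  define p where "p = 2 * (N + 1)"
  have cp: "continuous_on (UNIV \<times> W) (G p)" using CG[of 0 p] by simp
  have "compact ({0..1::real} \<times> K)" using K by (intro compact_Times) auto
  then have "bounded (G p ` ({0..1} \<times> K))"
    using K by (intro compact_imp_bounded compact_continuous_image continuous_on_subset[OF cp]) auto
  then obtain M where M: "M > 0" "\<And>u. u \<in> {0..1} \<times> K \<Longrightarrow> norm (G p u) \<le> M"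
    unfolding bounded_pos by auto
  show ?thesis
  proof (rule that[OF M(1)])
    fix w and \<epsilon> :: real assume w: "w \<in> K" and \<epsilon>: "0 \<le> \<epsilon>" "\<epsilon> \<le> 1"
    have wW: "w \<in> W" using w K by auto
    have "((\<lambda>x. ((\<epsilon> - x) ^ (p - 1) / fact (p - 1)) *\<^sub>R G p (x, w)) has_integral
        G 0 (\<epsilon>, w) - (\<Sum>i<p. ((\<epsilon> - 0) ^ i / fact i) *\<^sub>R G i (0, w))) {0..\<epsilon>}"
      by (rule Taylor_has_integral[where Df = "\<lambda>i t. G i (t, w)" and f = "\<lambda>t. G 0 (t, w)"])
        (use \<epsilon> dG[OF wW] in \<open>auto simp: p_def\<close>)
    then have I: "((\<lambda>x. ((\<epsilon> - x) ^ (p - 1) / fact (p - 1)) *\<^sub>R G p (x, w)) has_integral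
        G 0 (\<epsilon>, w) - (\<Sum>i<p. ((\<epsilon> - 0) ^ i / fact i) *\<^sub>R G i (0, w))) (cbox 0 \<epsilon>)" by simp
    have "norm (G 0 (\<epsilon>, w) - (\<Sum>i<p. ((\<epsilon> - 0) ^ i / fact i) *\<^sub>R G i (0, w))) \<le> (\<epsilon> ^ (p - 1) * M) * measure lborel (cbox 0 \<epsilon>)"
    proof (rule has_integral_bound[OF _ I])
      show "0 \<le> \<epsilon> ^ (p - 1) * M" using \<epsilon> M by simp
      fix x assume x: "x \<in> cbox 0 \<epsilon>"
      have "norm (((\<epsilon> - x) ^ (p - 1) / fact (p - 1)) *\<^sub>R G p (x, w)) = (\<epsilon> - x) ^ (p - 1) / fact (p - 1) * norm (G p (x, w))"
        using x by simp
      also have "\<dots> \<le> \<epsilon> ^ (p - 1) * M"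
      proof (intro mult_mono)
        have "(\<epsilon> - x) ^ (p - 1) / fact (p - 1) \<le> (\<epsilon> - x) ^ (p - 1) / 1"
          using x by (intro divide_left_mono) (auto simp: fact_ge_1)
        also have "\<dots> \<le> \<epsilon> ^ (p - 1)" using x by (auto intro: power_mono)
        finally show "(\<epsilon> - x) ^ (p - 1) / fact (p - 1) \<le> \<epsilon> ^ (p - 1)" .
        show "norm (G p (x, w)) \<le> M" by (rule M(2)) (use x \<epsilon> w in auto)
      qed (use \<epsilon> in auto)
      finally show "norm (((\<epsilon> - x) ^ (p - 1) / fact (p - 1)) *\<^sub>R G p (x, w)) \<le> \<epsilon> ^ (p - 1) * M" .
    qed
    also have "(\<epsilon> ^ (p - 1) * M) * measure lborel (cbox 0 \<epsilon>) = M * \<epsilon> ^ p"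
      using \<epsilon> by (simp add: p_def)
    finally have B: "norm (G 0 (\<epsilon>, w) - (\<Sum>i<p. ((\<epsilon> - 0) ^ i / fact i) *\<^sub>R G i (0, w))) \<le> M * \<epsilon> ^ p" .
    have "(\<Sum>i<2 * m. ((\<epsilon> - 0) ^ i / fact i) *\<^sub>R G i (0, w)) = (\<Sum>j<m. \<epsilon> ^ (2 * j) *\<^sub>R ((1 / fact (2 * j)) *\<^sub>R G (2 * j) (0, w)))" for m
      by (induction m) (simp_all add: odd[OF _ wW])
    from this[of "N + 1"] have "(\<Sum>i<p. ((\<epsilon> - 0) ^ i / fact i) *\<^sub>R G i (0, w)) = (\<Sum>j=0..N. \<epsilon> ^ (2 * j) *\<^sub>R ((1 / fact (2 * j)) *\<^sub>R G (2 * j) (0, w)))"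
      unfolding p_def by (simp only: atLeast0AtMost lessThan_Suc_atMost Suc_eq_plus1[symmetric])
    then show "norm (g (\<epsilon>, w) - (\<Sum>j=0..N. \<epsilon> ^ (2 * j) *\<^sub>R ((1 / fact (2 * j)) *\<^sub>R (edir ^^ (2 * j)) g (0, w)))) \<le> M * \<epsilon> ^ (2 * (N + 1))"
      using B unfolding p_def[symmetric] G_def by simp
  qed
qed

lemma Ck_on_scaleR_const:
  fixes f :: "'a::euclidean_space \<Rightarrow> 'b::real_normed_vector"
  assumes "open U" "Ck_on n f U" shows "Ck_on n (\<lambda>u. c *\<^sub>R f u) U"
  using assms moderate_scaleR[OF assms(1) moderate_const[OF assms(1)], of n "\<lambda>u (\<eta>::real). f u" c]
  by (simp only: moderate_iff_Ck_on)

lemma join_eq_axis: "Defs.join p t = (p $ 1) *\<^sub>R axis 1 1 + (p $ 2) *\<^sub>R axis 2 1 + t *\<^sub>R axis 3 1"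
  by (simp add: vec_eq_iff forall_3 axis_def)

section \<open>Amplitudes of \<open>Phi\<close> and of its gradient\<close>

context two_layers
begin

text \<open>The gradient of \<open>travel\<close> in x; the minus sign is there because the depth is
  minus the third coordinate.\<close>

definition slow_vec :: "(real^3) \<times> (real^3) \<Rightarrow> real^3" where "slow_vec w = Defs.join (slow_hor w) (- slow_lo w)"

definition osc_int_grad :: "real \<times> ((real^3) \<times> (real^3)) \<Rightarrow> real^3" where
  "osc_int_grad u = (\<Sum>b\<in>Basis. Re (frechet_derivative osc_int (at u) (0, (b, 0))) *\<^sub>R b)"

text \<open>2 sqrt det / pi is the ratio of the exact constant 1 / (4 pi^2 gm gp) in
  \<open>Phi_eq\<close> to the prefactor 1 / (8 pi gp gm sqrt det) of the theorem.\<close>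

definition ampl0 :: "real \<times> ((real^3) \<times> (real^3)) \<Rightarrow> real" where
  "ampl0 u = (2 / pi * sqrt (det_hess (snd u))) * Re (osc_int u)"

text \<open>Differentiating exp (- \<tau> travel) osc in x gives - \<tau> exp (- \<tau> travel) (osc
  slow_vec - \<epsilon>^2 grad osc), since 1 / \<tau> = \<epsilon>^2; dividing by - \<tau> / sqrt gm
  leaves the factor sqrt gm.\<close>

definition ampl1 :: "real \<times> ((real^3) \<times> (real^3)) \<Rightarrow> real^3" where
  "ampl1 u = (2 / pi * sqrt (det_hess (snd u))) *\<^sub>R ((Re (osc_int u) * sqrt gm) *\<^sub>R slow_vec (snd u) - (sqrt gm * (fst u * fst u)) *\<^sub>R osc_int_grad u)"

lemma moderate_det_hess: "moderate n W (\<lambda>w (\<eta>::real). sqrt (det_hess w))"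
proof -
  have ih: "moderate n W (\<lambda>w (\<eta>::real). inverse (depth w))" "moderate n W (\<lambda>w (\<eta>::real). inverse (height w))" for n
    by (rule moderate_inverse[OF open_W moderate_W(1)] moderate_inverse[OF open_W moderate_W(2)];
      rule away_zero_indep[OF open_W]; use hk_pos in \<open>force intro: linear_continuous_on depth_linear height_linear\<close>)+
  have d: "moderate n W (\<lambda>w (\<eta>::real). det_hess w)" for n
    unfolding det_hess_def by (intro moderate_mult moderate_add moderate_power moderate_const open_W moderate_slow_lo ih)
  show ?thesis
    by (intro moderate_sqrt open_W d det_hess_pos away_zero_indep[OF open_W continuous_on_moderate_indep[OF d]] less_imp_neq[THEN not_sym])
qed

lemma moderate_slow_vec: "moderate n W (\<lambda>w (\<eta>::real). slow_vec w)"
proof -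
  have "moderate n W (\<lambda>w (\<eta>::real). slow_hor w $ i)" for i
    using moderate_inner[OF open_W moderate_slow_hor moderate_const[OF open_W], of n "axis i 1"] by (simp add: inner_axis)
  then show ?thesis
    unfolding slow_vec_def join_eq_axis by (intro moderate_add moderate_scaleR moderate_const moderate_minus open_W moderate_slow_lo)
qed

lemma moderate_osc_int: "moderate n V (\<lambda>u (\<eta>::real). Re (osc_int u))"
  by (rule moderate_bounded_linear[OF open_V bounded_linear_Re]) (simp only: moderate_iff_Ck_on[OF open_V] Ck_on_osc_int)

lemma moderate_osc_int_grad: "moderate n V (\<lambda>u (\<eta>::real). osc_int_grad u)"
proof -
  have "moderate n V (\<lambda>u (\<eta>::real). frechet_derivative osc_int (at u) v)" for v
    unfolding moderate_iff_Ck_on[OF open_V] by (rule Ck_on_SucD[OF Ck_on_osc_int])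
  then show ?thesis
    unfolding osc_int_grad_def by (intro moderate_sum moderate_scaleR moderate_const moderate_bounded_linear[OF open_V bounded_linear_Re] open_V finite_Basis)
qed

lemma Ck_on_J: "Ck_on n ampl0 V" "Ck_on n ampl1 V"
proof -
  have "moderate n V (\<lambda>u (\<eta>::real). ampl0 u)"
    unfolding ampl0_def by (intro moderate_mult moderate_const open_V moderate_V_lift[OF moderate_det_hess] moderate_osc_int)
  then show "Ck_on n ampl0 V" by (simp only: moderate_iff_Ck_on[OF open_V])
  have "moderate n V (\<lambda>u (\<eta>::real). ampl1 u)"
    unfolding ampl1_def by (intro moderate_mult moderate_scaleR moderate_diff moderate_const open_V moderate_V_lift[OF moderate_det_hess]
        moderate_V_lift[OF moderate_slow_vec] moderate_osc_int moderate_osc_int_grad moderate_V(1))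
  then show "Ck_on n ampl1 V" by (simp only: moderate_iff_Ck_on[OF open_V])
qed

text \<open>\<open>eflip\<close> fixes the directions (0, v), so derivatives in the end points keep
  the parity of \<open>osc_int\<close>; the factor \<epsilon>^2 is even.\<close>

lemma J_even: "w \<in> W \<Longrightarrow> ampl0 (- \<epsilon>, w) = ampl0 (\<epsilon>, w)" "w \<in> W \<Longrightarrow> ampl1 (- \<epsilon>, w) = ampl1 (\<epsilon>, w)"
proof -
  assume w: "w \<in> W"
  have "frechet_derivative osc_int (at (eflip (\<epsilon>, w))) (eflip (0, v)) = 1 *\<^sub>R frechet_derivative osc_int (at (\<epsilon>, w)) (0, v)" for v
    by (rule frechet_derivative_parity[OF open_W Ck_on_osc_int[unfolded V_def]]) (use w in \<open>auto simp: eflip_def osc_int_even\<close>)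
  then have "osc_int_grad (- \<epsilon>, w) = osc_int_grad (\<epsilon>, w)" by (simp add: osc_int_grad_def eflip_def)
  then show "ampl1 (- \<epsilon>, w) = ampl1 (\<epsilon>, w)" by (simp add: ampl1_def osc_int_even)
qed (simp add: ampl0_def osc_int_even)

lemma Phi_eq:
  assumes w: "w \<in> W" and \<tau>: "\<tau> > 0"
  shows "Phi gm gp \<tau> (fst w) (snd w) = exp (- (\<tau> * travel w)) / (4 * pi\<^sup>2 * gm * gp) * Re (osc_int (1 / sqrt \<tau>, w))"
proof -
  have "\<tau> = 1 / (1 / sqrt \<tau>)\<^sup>2" using \<tau> by (simp add: power_divide)
  from Phi_formula_osc_int[OF w _ this] show ?thesis using \<tau> by (simp add: Phi_def)
qed

lemma Phi_expansion_value:
  assumes w: "w \<in> W" and \<tau>: "\<tau> > 0"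
  shows "Phi gm gp \<tau> (fst w) (snd w) =
    exp (- \<tau> * lmin gm gp (fst w) (snd w)) / (8 * pi * gp * gm * sqrt (det (Hmat gm gp (fst w) (snd w)))) * ampl0 (1 / sqrt \<tau>, w)"
  unfolding Phi_eq[OF assms] lmin_eq[OF w] det_Hmat[OF w] ampl0_def
  using det_hess_pos[OF w] gm gp by (simp add: field_simps power2_eq_square)

lemma Phi_gradient:
  assumes w: "w \<in> W" and \<tau>: "\<tau> > 0"
  shows "GDERIV (\<lambda>u. Phi gm gp \<tau> u (snd w)) (fst w) :>
    (exp (- \<tau> * lmin gm gp (fst w) (snd w)) / (8 * pi * gp * gm * sqrt (det (Hmat gm gp (fst w) (snd w)))) * (- \<tau> / sqrt gm)) *\<^sub>R ampl1 (1 / sqrt \<tau>, w)"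
proof -
  define x y \<epsilon> c where "x = fst w" "y = snd w" "\<epsilon> = 1 / sqrt \<tau>" "c = 1 / (4 * pi\<^sup>2 * gm * gp)"
  note defs = x_y_\<epsilon>_c_def
  have wxy: "w = (x, y)" by (simp add: defs)
  have ee: "\<tau> * (\<epsilon> * \<epsilon>) = 1" using \<tau> by (simp add: defs)
  have uV: "(\<epsilon>, w) \<in> V" using w by (simp add: V_def)
  have dL: "((\<lambda>u. travel (u, y)) has_derivative (\<lambda>v. slow_hor w \<bullet> offset (v, 0) + slow_lo w * depth (v, 0) + slow_up w * height (v, 0))) (at x)"
    by (rule has_derivative_compose[of "\<lambda>u. (u, y)" "\<lambda>v. (v, 0)"]) (use travel_has_derivative[OF w] wxy in \<open>auto intro!: derivative_eq_intros\<close>)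
  have nvv: "slow_hor w \<bullet> offset (v, 0) + slow_lo w * depth (v, 0) + slow_up w * height (v, 0) = v \<bullet> slow_vec w" for v
    by (simp add: offset_def depth_def height_def slow_vec_def inner_join hor_def inner_commute[of v] inner_real2)
  define E where "E = frechet_derivative osc_int (at (\<epsilon>, w))"
  have E: "(osc_int has_derivative E) (at (\<epsilon>, w))" unfolding E_def by (rule Ck_on_has_derivative[OF Ck_on_osc_int uV])
  have dI: "((\<lambda>u. Re (osc_int (\<epsilon>, (u, y)))) has_derivative (\<lambda>v. Re (E (0, (v, 0))))) (at x)"
    by (rule bounded_linear.has_derivative[OF bounded_linear_Re has_derivative_compose[of "\<lambda>u. (\<epsilon>, (u, y))" "\<lambda>v. (0, (v, 0))"]])
      (use E wxy in \<open>auto intro!: derivative_eq_intros\<close>)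
  have DE: "Re (E (0, (v, 0))) = v \<bullet> osc_int_grad (\<epsilon>, w)" for v
  proof -
    have lin: "linear (\<lambda>v. E (0, (v, 0)))"
    proof -
      have "linear (\<lambda>v::real^3. (0::real, (v, 0::real^3)))" by (rule linearI) auto
      from linear_compose[OF this has_derivative_linear[OF E]] show ?thesis by (simp add: comp_def)
    qed
    have "E (0, (v, 0)) = E (0, ((\<Sum>b\<in>Basis. (v \<bullet> b) *\<^sub>R b), 0))" by (simp only: euclidean_representation)
    also have "\<dots> = (\<Sum>b\<in>Basis. (v \<bullet> b) *\<^sub>R E (0, (b, 0)))"
      using linear_sum[OF lin, of "\<lambda>b. (v \<bullet> b) *\<^sub>R b" Basis] by (simp add: linear_scale[OF lin])
    finally have "Re (E (0, (v, 0))) = (\<Sum>b\<in>Basis. (v \<bullet> b) * Re (E (0, (b, 0))))" by simp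
    then show ?thesis by (simp add: osc_int_grad_def E_def inner_sum_right mult.commute)
  qed
  have dexp: "((\<lambda>u. exp (- (\<tau> * travel (u, y)))) has_derivative (\<lambda>v. exp (- (\<tau> * travel w)) * (- (\<tau> * (v \<bullet> slow_vec w))))) (at x)"
  proof -
    have "((\<lambda>u. - (\<tau> * travel (u, y))) has_derivative (\<lambda>v. - (\<tau> * (v \<bullet> slow_vec w)))) (at x)"
      using dL unfolding nvv by (intro has_derivative_minus has_derivative_mult_right)
    moreover have "(exp has_derivative (*) (exp (- (\<tau> * travel w)))) (at (- (\<tau> * travel (x, y))))"
      using DERIV_exp[of "- (\<tau> * travel w)"] by (simp add: has_field_derivative_def wxy)
    ultimately show ?thesis by (rule has_derivative_compose)
  qed
  define R where "R = Re (osc_int (\<epsilon>, w))"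
  have "((\<lambda>u. c * (exp (- (\<tau> * travel (u, y))) * Re (osc_int (\<epsilon>, (u, y))))) has_derivative
     (\<lambda>v. c * (exp (- (\<tau> * travel (x, y))) * Re (E (0, (v, 0))) + exp (- (\<tau> * travel w)) * (- (\<tau> * (v \<bullet> slow_vec w))) * Re (osc_int (\<epsilon>, (x, y)))))) (at x)"
    by (rule has_derivative_mult_right[OF has_derivative_mult[OF dexp dI]])
  then have 1: "((\<lambda>u. c * (exp (- (\<tau> * travel (u, y))) * Re (osc_int (\<epsilon>, (u, y))))) has_derivative
     (\<lambda>v. v \<bullet> ((c * exp (- (\<tau> * travel w))) *\<^sub>R (osc_int_grad (\<epsilon>, w) - (\<tau> * R) *\<^sub>R slow_vec w)))) (at x)"
    unfolding DE by (rule has_derivative_eq_rhs) (simp add: fun_eq_iff R_def wxy[symmetric] inner_diff_right algebra_simps)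
  have ol: "open lower_half" unfolding lower_half_def by (intro open_Collect_less continuous_intros)
  have xl: "x \<in> lower_half" and yu: "y \<in> upper_half" using w by (auto simp: W_def defs)
  have "((\<lambda>u. Phi gm gp \<tau> u y) has_derivative (\<lambda>v. v \<bullet> ((c * exp (- (\<tau> * travel w))) *\<^sub>R (osc_int_grad (\<epsilon>, w) - (\<tau> * R) *\<^sub>R slow_vec w)))) (at x)"
  \<comment> \<open>For fixed y the exact formula \<open>Phi_eq\<close> holds on the whole open
    lower half space, so it may be differentiated at x.\<close>
  proof (rule has_derivative_transform_within_open[OF 1 ol xl])
    fix u assume "u \<in> lower_half"
    then have "(u, y) \<in> W" using yu by (simp add: W_def)
    from Phi_eq[OF this \<tau>] show "c * (exp (- (\<tau> * travel (u, y))) * Re (osc_int (\<epsilon>, (u, y)))) = Phi gm gp \<tau> u y"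
      by (simp add: defs(3,4))
  qed
  moreover have "(c * exp (- (\<tau> * travel w))) *\<^sub>R (osc_int_grad (\<epsilon>, w) - (\<tau> * R) *\<^sub>R slow_vec w) =
    (exp (- \<tau> * lmin gm gp x y) / (8 * pi * gp * gm * sqrt (det (Hmat gm gp x y))) * (- \<tau> / sqrt gm)) *\<^sub>R ampl1 (\<epsilon>, w)"
  proof -
    define s e where "s = sqrt (det_hess w)" "e = exp (- (\<tau> * travel w))"
    have s: "s > 0" using det_hess_pos[OF w] by (simp add: s_e_def)
    have g: "sqrt gm > 0" "gm \<noteq> 0" "gp \<noteq> 0" using gm gp by auto
    \<comment> \<open>The full scalar in front of the bracket of \<open>ampl1\<close>: sqrt det
      cancels in it, and \<tau> \<epsilon>^2 = 1 removes \<tau> from the gradient term.\<close>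
    define d where "d = e / (8 * pi * gp * gm * s) * (- \<tau> / sqrt gm) * (2 / pi * s)"
    have 1: "d * (R * sqrt gm) = - (c * e * (\<tau> * R))"
      using s g by (simp add: d_def defs(4) field_simps power2_eq_square)
    have "d * (sqrt gm * (\<epsilon> * \<epsilon>)) = - (c * e * (\<tau> * (\<epsilon> * \<epsilon>)))"
      using s g by (simp add: d_def defs(4) field_simps power2_eq_square)
    then have 2: "d * (sqrt gm * (\<epsilon> * \<epsilon>)) = - (c * e)" unfolding ee by simp
    have l: "exp (- \<tau> * lmin gm gp x y) = e" "det (Hmat gm gp x y) = det_hess w"
      using lmin_eq[OF w] det_Hmat[OF w] by (auto simp: defs s_e_def)
    have "(exp (- \<tau> * lmin gm gp x y) / (8 * pi * gp * gm * sqrt (det (Hmat gm gp x y))) * (- \<tau> / sqrt gm)) *\<^sub>R ampl1 (\<epsilon>, w) =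
       (d * (R * sqrt gm)) *\<^sub>R slow_vec w - (d * (sqrt gm * (\<epsilon> * \<epsilon>))) *\<^sub>R osc_int_grad (\<epsilon>, w)"
      unfolding l by (simp add: ampl1_def R_def[symmetric] s_e_def(1)[symmetric] d_def scaleR_diff_right mult_ac)
    also have "\<dots> = (c * e) *\<^sub>R (osc_int_grad (\<epsilon>, w) - (\<tau> * R) *\<^sub>R slow_vec w)"
      unfolding 1 2 by (simp add: scaleR_diff_right)
    finally show ?thesis by (simp add: s_e_def)
  qed
  ultimately show ?thesis unfolding gderiv_def defs(1-3) by simp
qed

lemma vec_saddle:
  assumes w: "w \<in> W"
  shows "fst w - lift0 (crossing w) = (depth w / slow_lo w) *\<^sub>R slow_vec w"
  using slow_lo_pos[OF w] by (simp add: vec_eq_iff forall_3 slow_vec_def crossing_def depth_def)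

text \<open>Both sides equal 4 A^2 B^2 sqrt gm sqrt gp / (h k N), where N is the denominator of the
  amplitude at the saddle point.\<close>

lemma ampl0_zero:
  assumes w: "w \<in> W"
  defines "z \<equiv> lift0 (zmin gm gp (fst w) (snd w))"
  shows "ampl0 (0, w) = E0 gm gp (fst w - z) / (norm (fst w - z) * norm (z - snd w))"
proof -
  define A B h k q g G where "A = slow_lo w" "B = slow_up w" "h = depth w" "k = height w" "q = slow_sq w" "g = sqrt gm" "G = sqrt gp"
  note defs = A_B_h_k_q_g_G_def
  have pos: "A > 0" "B > 0" "h > 0" "k > 0" "g > 0" "G > 0" using slow_lo_pos[OF w] slow_up_pos[OF w] hk_pos[OF w] gm gp by (auto simp: defs)
  have gg: "gm = g * g" "gp = G * G" using gm gp by (auto simp: defs)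
  have B2: "B\<^sup>2 = 1 / gp - q" using slow_up_sq[OF w] by (simp add: defs)
  have z: "z = lift0 (crossing w)" by (simp add: z_def zmin_eq[OF w])
  have n1: "norm (fst w - z) = h / (A * g)" and n2: "norm (z - snd w) = k / (B * G)"
    using norm_saddle[OF w] by (auto simp: z defs norm_minus_commute)
  have v3: "\<bar>(fst w - z) $ 3\<bar> = h" using hk_pos[OF w] by (simp add: z defs depth_def)
  have hv: "hor (fst w - z) = (h / A) *\<^sub>R slow_hor w" by (simp add: z hor_diff crossing_def defs)
  have n3: "(norm (hor (fst w - z)))\<^sup>2 = h\<^sup>2 / A\<^sup>2 * q"
    using norm_slow_hor[OF w] by (simp add: hv power_mult_distrib power_divide defs)
  have a: "(a0 gm gp)\<^sup>2 = gm / gp" using gm gp by (simp add: a0_def)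
  \<comment> \<open>By the length of the lower ray the radicand is (h / A)^2 (1 / gp - q), and 1 /
    gp - q = B^2.\<close>
  have sq: "sqrt ((a0 gm gp)\<^sup>2 * (norm (fst w - z))\<^sup>2 - (norm (hor (fst w - z)))\<^sup>2) = h * B / A"
  proof (rule real_sqrt_unique)
    have "(h * B / A)\<^sup>2 = h\<^sup>2 / A\<^sup>2 * B\<^sup>2" by (simp add: power_mult_distrib power_divide)
    also have "\<dots> = (a0 gm gp)\<^sup>2 * (norm (fst w - z))\<^sup>2 - (norm (hor (fst w - z)))\<^sup>2"
      unfolding a n1 n3 B2 using pos by (simp add: gg power_divide power_mult_distrib right_diff_distrib power2_eq_square)
    finally show "(h * B / A)\<^sup>2 = (a0 gm gp)\<^sup>2 * (norm (fst w - z))\<^sup>2 - (norm (hor (fst w - z)))\<^sup>2" .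
  qed (use pos in auto)
  define N where "N = B / gm + A / gp"
  have N: "N > 0" using pos gm gp by (auto simp: N_def intro!: add_pos_pos)
  have "E0 gm gp (fst w - z) = 4 * g * h * (h * B / A) / (h / (A * g) * (h * B / A + gm / gp * h))"
    unfolding E0_def sq unfolding n1 v3 a defs(6)[symmetric] by simp
  also have "h * B / A + gm / gp * h = gm * h / A * N" using pos gm by (simp add: N_def field_simps)
  also have "4 * g * h * (h * B / A) / (h / (A * g) * (gm * h / A * N)) = 4 * A * B / N"
    using pos N by (simp add: gg field_simps)
  finally have E: "E0 gm gp (fst w - z) / (norm (fst w - z) * norm (z - snd w)) = 4 * A\<^sup>2 * B\<^sup>2 * g * G / (h * k * N)"
    unfolding n1 n2 using pos N by (simp add: field_simps power2_eq_square)
  define d where "d = det_hess w"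
  have d: "d > 0" using det_hess_pos[OF w] by (simp add: d_def)
  \<comment> \<open>Passage from the quadratic form in the slowness to the Hessian in z': h / A + k
    / B is (A / h + B / k) h k / (A B), the cubic factor is treated likewise, and the extra factors
    form a perfect square.\<close>
  have "(h / A + k / B) * (h / (gm * A ^ 3) + k / (gp * B ^ 3)) = d * (h * k / (A\<^sup>2 * B\<^sup>2 * g * G))\<^sup>2"
  proof -
    have 1: "h / A + k / B = (A * inverse h + B * inverse k) * (h * k / (A * B))"
      using pos by (simp add: field_simps)
    have 2: "h / (gm * A ^ 3) + k / (gp * B ^ 3) = (gm * A ^ 3 * inverse h + gp * B ^ 3 * inverse k) * (h * k / (gm * A ^ 3 * gp * B ^ 3))"
      using pos gm gp by (simp add: field_simps)
    have 3: "h * k / (A * B) * (h * k / (gm * A ^ 3 * gp * B ^ 3)) = (h * k / (A\<^sup>2 * B\<^sup>2 * g * G))\<^sup>2"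
      using pos by (simp add: gg power2_eq_square power3_eq_cube)
    show ?thesis unfolding 1 2 3[symmetric] d_def det_hess_def defs(1-4)[symmetric] by (simp only: mult_ac)
  qed
  then have "sqrt ((h / A + k / B) * (h / (gm * A ^ 3) + k / (gp * B ^ 3))) = sqrt d * (h * k / (A\<^sup>2 * B\<^sup>2 * g * G))"
    using pos by (simp add: real_sqrt_mult)
  then have "osc_int (0, w) = complex_of_real (2 * pi / (sqrt d * (h * k / (A\<^sup>2 * B\<^sup>2 * g * G)) * N))"
    unfolding osc_int_zero[OF w] defs(1-4)[symmetric] N_def by simp
  then have "ampl0 (0, w) = 2 / pi * sqrt d * (2 * pi / (sqrt d * (h * k / (A\<^sup>2 * B\<^sup>2 * g * G)) * N))"
    by (simp add: ampl0_def d_def del: of_real_mult of_real_divide)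
  also have "\<dots> = 4 * A\<^sup>2 * B\<^sup>2 * g * G / (h * k * N)"
    using pos d N by (simp add: field_simps)
  finally show ?thesis unfolding E .
qed

text \<open>At \<epsilon> = 0 the gradient term drops out, and sqrt gm \<open>slow_vec\<close> is
  the unit vector along the lower ray, since (p, A) has length 1 / sqrt gm.\<close>

lemma ampl1_zero:
  assumes w: "w \<in> W"
  defines "z \<equiv> lift0 (zmin gm gp (fst w) (snd w))"
  shows "ampl1 (0, w) = ampl0 (0, w) *\<^sub>R ((1 / norm (fst w - z)) *\<^sub>R (fst w - z))"
proof -
  have z: "z = lift0 (crossing w)" by (simp add: z_def zmin_eq[OF w])
  have n1: "norm (fst w - z) = depth w / (slow_lo w * sqrt gm)"
    using norm_saddle(1)[OF w] by (simp add: z norm_minus_commute)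
  have "(1 / norm (fst w - z)) *\<^sub>R (fst w - z) = sqrt gm *\<^sub>R slow_vec w"
    unfolding n1 unfolding z vec_saddle[OF w] using slow_lo_pos[OF w] hk_pos(1)[OF w] by simp
  then show ?thesis by (simp add: ampl1_def ampl0_def)
qed

end

section \<open>The expansion, uniformly on the compact set of end points\<close>

theorem proposition1p4:
  fixes gm gp :: real and D B :: "(real^3) set" and b :: "real^3" and \<rho> :: real
  assumes "0 < gm" and "gm < gp"
    and "open D" and "bounded D" and "C2_boundary D" and "closure D \<subseteq> lower_half"
    and "0 < \<rho>" and "B = ball b \<rho>" and "closure B \<subseteq> upper_half"
  shows
    "\<exists>(\<Phi>0 :: nat \<Rightarrow> real^3 \<Rightarrow> real^3 \<Rightarrow> real) (\<Phi>1 :: nat \<Rightarrow> real^3 \<Rightarrow> real^3 \<Rightarrow> real^3).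
       (\<forall>j. smooth_on (closure D \<times> closure B) (\<lambda>(x, y). \<Phi>0 j x y)) \<and>
       (\<forall>j. smooth_on (closure D \<times> closure B) (\<lambda>(x, y). \<Phi>1 j x y)) \<and>
       (\<forall>N. \<exists>(Q0 :: real \<Rightarrow> real^3 \<Rightarrow> real^3 \<Rightarrow> real) (Q1 :: real \<Rightarrow> real^3 \<Rightarrow> real^3 \<Rightarrow> real^3).
          (\<forall>x\<in>closure D. \<forall>y\<in>closure B. \<forall>\<tau>\<ge>1.
             Phi gm gp \<tau> x y =
               exp (- \<tau> * lmin gm gp x y) / (8 * pi * gp * gm * sqrt (det (Hmat gm gp x y))) *
               ((\<Sum>j=0..N. \<Phi>0 j x y / \<tau> ^ j) + Q0 \<tau> x y)) \<and>
          (\<forall>x\<in>closure D. \<forall>y\<in>closure B. \<forall>\<tau>\<ge>1.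
             GDERIV (\<lambda>u. Phi gm gp \<tau> u y) x :>
               (exp (- \<tau> * lmin gm gp x y) / (8 * pi * gp * gm * sqrt (det (Hmat gm gp x y))) *
                (- \<tau> / sqrt gm)) *\<^sub>R
               ((\<Sum>j=0..N. (1 / \<tau> ^ j) *\<^sub>R \<Phi>1 j x y) + Q1 \<tau> x y)) \<and>
          (\<forall>\<tau>\<ge>1. continuous_on (closure D \<times> closure B) (\<lambda>(x, y). Q0 \<tau> x y)) \<and>
          (\<forall>\<tau>\<ge>1. continuous_on (closure D \<times> closure B) (\<lambda>(x, y). Q1 \<tau> x y)) \<and>
          (\<exists>C>0. \<forall>x\<in>closure D. \<forall>y\<in>closure B. \<forall>\<tau>\<ge>1.
             \<bar>Q0 \<tau> x y\<bar> + norm (Q1 \<tau> x y) \<le> C / \<tau> ^ (N + 1))) \<and>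
       (\<forall>x\<in>closure D. \<forall>y\<in>closure B.
          \<Phi>0 0 x y =
            E0 gm gp (x - lift0 (zmin gm gp x y)) /
            (norm (x - lift0 (zmin gm gp x y)) * norm (lift0 (zmin gm gp x y) - y))) \<and>
       (\<forall>x\<in>closure D. \<forall>y\<in>closure B.
          \<Phi>1 0 x y =
            \<Phi>0 0 x y *\<^sub>R
            ((1 / norm (x - lift0 (zmin gm gp x y))) *\<^sub>R (x - lift0 (zmin gm gp x y))))"
proof -
  interpret two_layers gm gp using assms(1,2) by unfold_locales
  \<comment> \<open>Compactness of \<open>K\<close> makes the Taylor remainder uniform in the end
    points; \<open>W\<close> is the open neighbourhood on which the coefficients are smooth.\<close>
  define K where "K = closure D \<times> closure B"
  have K: "compact K" "K \<subseteq> W"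
    using assms(4,6,8,9) by (auto simp: K_def W_def compact_closure intro!: compact_Times)
  \<comment> \<open>The even Taylor coefficients in \<epsilon> at 0; they do not involve N, as the
    order of the quantifiers demands.\<close>
  define a0' where "a0' j w = (1 / fact (2 * j)) *\<^sub>R (edir ^^ (2 * j)) ampl0 (0, w)" for j w
  define a1' where "a1' j w = (1 / fact (2 * j)) *\<^sub>R (edir ^^ (2 * j)) ampl1 (0, w)" for j w
  have C0: "Ck_on n (a0' j) W" for n j
    unfolding a0'_def[abs_def] using Ck_on_J(1)
    by (intro Ck_on_scaleR_const open_W Ck_on_section Ck_on_edir_funpow) (simp add: V_def)
  have C1: "Ck_on n (a1' j) W" for n j
    unfolding a1'_def[abs_def] using Ck_on_J(2)
    by (intro Ck_on_scaleR_const open_W Ck_on_section Ck_on_edir_funpow) (simp add: V_def)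
  have inW: "(x, y) \<in> W" if "x \<in> closure D" "y \<in> closure B" for x y using that K(2) by (auto simp: K_def)
  have cJ: "continuous_on K (\<lambda>w. ampl0 (\<epsilon>, w))" "continuous_on K (\<lambda>w. ampl1 (\<epsilon>, w))" for \<epsilon>
    using Ck_on_section[OF open_W Ck_on_J(1)[of 0, unfolded V_def], of \<epsilon>] Ck_on_section[OF open_W Ck_on_J(2)[of 0, unfolded V_def], of \<epsilon>] K(2)
    by (auto intro: continuous_on_subset)
  have ca: "continuous_on K (a0' j)" "continuous_on K (a1' j)" for j
    using C0[of 0 j] C1[of 0 j] K(2) by (auto intro: continuous_on_subset)
  show ?thesis
  proof (intro exI[of _ "\<lambda>j x y. a0' j (x, y)"] exI[of _ "\<lambda>j x y. a1' j (x, y)"] conjI allI)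
    show "smooth_on (closure D \<times> closure B) (\<lambda>(x, y). a0' j (x, y))" for j
      unfolding smooth_on_def K_def[symmetric] using C0 open_W K by (intro exI[of _ W] exI[of _ "a0' j"]) auto
    show "smooth_on (closure D \<times> closure B) (\<lambda>(x, y). a1' j (x, y))" for j
      unfolding smooth_on_def K_def[symmetric] using C1 open_W K by (intro exI[of _ W] exI[of _ "a1' j"]) auto
    show "\<forall>x\<in>closure D. \<forall>y\<in>closure B. a0' 0 (x, y) = E0 gm gp (x - lift0 (zmin gm gp x y)) /
            (norm (x - lift0 (zmin gm gp x y)) * norm (lift0 (zmin gm gp x y) - y))"
      using ampl0_zero[OF inW] by (simp add: a0'_def)
    show "\<forall>x\<in>closure D. \<forall>y\<in>closure B. a1' 0 (x, y) = a0' 0 (x, y) *\<^sub>R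
            ((1 / norm (x - lift0 (zmin gm gp x y))) *\<^sub>R (x - lift0 (zmin gm gp x y)))"
      using ampl1_zero[OF inW] by (simp add: a0'_def a1'_def)
    fix N
    obtain M0 where M0: "M0 > 0" "\<And>w \<epsilon>. w \<in> K \<Longrightarrow> 0 \<le> \<epsilon> \<Longrightarrow> \<epsilon> \<le> 1 \<Longrightarrow>
        norm (ampl0 (\<epsilon>, w) - (\<Sum>j=0..N. \<epsilon> ^ (2 * j) *\<^sub>R a0' j w)) \<le> M0 * \<epsilon> ^ (2 * (N + 1))"
      using even_taylor_bound[OF open_W Ck_on_J(1)[unfolded V_def] J_even(1) K, of N] unfolding a0'_def by blast
    obtain M1 where M1: "M1 > 0" "\<And>w \<epsilon>. w \<in> K \<Longrightarrow> 0 \<le> \<epsilon> \<Longrightarrow> \<epsilon> \<le> 1 \<Longrightarrow>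
        norm (ampl1 (\<epsilon>, w) - (\<Sum>j=0..N. \<epsilon> ^ (2 * j) *\<^sub>R a1' j w)) \<le> M1 * \<epsilon> ^ (2 * (N + 1))"
      using even_taylor_bound[OF open_W Ck_on_J(2)[unfolded V_def] J_even(2) K, of N] unfolding a1'_def by blast
    \<comment> \<open>As differences, \<open>Q0\<close> and \<open>Q1\<close> make both expansions
      hold by construction. For \<tau> >= 1 the value 1 / sqrt \<tau> lies in [0, 1], the range
      covered by \<open>even_taylor_bound\<close>.\<close>
    define Q0 where "Q0 \<tau> x y = ampl0 (1 / sqrt \<tau>, (x, y)) - (\<Sum>j=0..N. a0' j (x, y) / \<tau> ^ j)" for \<tau> x y
    define Q1 where "Q1 \<tau> x y = ampl1 (1 / sqrt \<tau>, (x, y)) - (\<Sum>j=0..N. (1 / \<tau> ^ j) *\<^sub>R a1' j (x, y))" for \<tau> x y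
    have pw: "(1 / sqrt \<tau>) ^ (2 * j) = 1 / \<tau> ^ j" if "\<tau> \<ge> 1" for \<tau> :: real and j
      using that by (simp add: power_mult power_divide)
    show "\<exists>(Q0 :: real \<Rightarrow> real^3 \<Rightarrow> real^3 \<Rightarrow> real) (Q1 :: real \<Rightarrow> real^3 \<Rightarrow> real^3 \<Rightarrow> real^3).
          (\<forall>x\<in>closure D. \<forall>y\<in>closure B. \<forall>\<tau>\<ge>1.
             Phi gm gp \<tau> x y =
               exp (- \<tau> * lmin gm gp x y) / (8 * pi * gp * gm * sqrt (det (Hmat gm gp x y))) *
               ((\<Sum>j=0..N. a0' j (x, y) / \<tau> ^ j) + Q0 \<tau> x y)) \<and>
          (\<forall>x\<in>closure D. \<forall>y\<in>closure B. \<forall>\<tau>\<ge>1.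
             GDERIV (\<lambda>u. Phi gm gp \<tau> u y) x :>
               (exp (- \<tau> * lmin gm gp x y) / (8 * pi * gp * gm * sqrt (det (Hmat gm gp x y))) *
                (- \<tau> / sqrt gm)) *\<^sub>R
               ((\<Sum>j=0..N. (1 / \<tau> ^ j) *\<^sub>R a1' j (x, y)) + Q1 \<tau> x y)) \<and>
          (\<forall>\<tau>\<ge>1. continuous_on (closure D \<times> closure B) (\<lambda>(x, y). Q0 \<tau> x y)) \<and>
          (\<forall>\<tau>\<ge>1. continuous_on (closure D \<times> closure B) (\<lambda>(x, y). Q1 \<tau> x y)) \<and>
          (\<exists>C>0. \<forall>x\<in>closure D. \<forall>y\<in>closure B. \<forall>\<tau>\<ge>1.
             \<bar>Q0 \<tau> x y\<bar> + norm (Q1 \<tau> x y) \<le> C / \<tau> ^ (N + 1))"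
    proof (intro exI[of _ Q0] exI[of _ Q1] conjI ballI allI impI)
      fix x y and \<tau> :: real assume xy: "x \<in> closure D" "y \<in> closure B" and \<tau>: "\<tau> \<ge> 1"
      show "Phi gm gp \<tau> x y = exp (- \<tau> * lmin gm gp x y) / (8 * pi * gp * gm * sqrt (det (Hmat gm gp x y))) *
               ((\<Sum>j=0..N. a0' j (x, y) / \<tau> ^ j) + Q0 \<tau> x y)"
        using Phi_expansion_value[OF inW[OF xy], of \<tau>] \<tau> by (simp add: Q0_def)
      show "GDERIV (\<lambda>u. Phi gm gp \<tau> u y) x :>
               (exp (- \<tau> * lmin gm gp x y) / (8 * pi * gp * gm * sqrt (det (Hmat gm gp x y))) *
                (- \<tau> / sqrt gm)) *\<^sub>R ((\<Sum>j=0..N. (1 / \<tau> ^ j) *\<^sub>R a1' j (x, y)) + Q1 \<tau> x y)"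
        using Phi_gradient[OF inW[OF xy], of \<tau>] \<tau> by (simp add: Q1_def)
    next
      fix \<tau> :: real assume \<tau>: "\<tau> \<ge> 1"
      have "continuous_on K (\<lambda>w. ampl0 (1 / sqrt \<tau>, w) - (\<Sum>j=0..N. a0' j w / \<tau> ^ j))"
        using \<tau> by (intro continuous_intros cJ ca) auto
      then show "continuous_on (closure D \<times> closure B) (\<lambda>(x, y). Q0 \<tau> x y)"
        by (simp add: Q0_def K_def case_prod_unfold)
      have "continuous_on K (\<lambda>w. ampl1 (1 / sqrt \<tau>, w) - (\<Sum>j=0..N. (1 / \<tau> ^ j) *\<^sub>R a1' j w))"
        by (intro continuous_intros cJ ca)
      then show "continuous_on (closure D \<times> closure B) (\<lambda>(x, y). Q1 \<tau> x y)"
        by (simp add: Q1_def K_def case_prod_unfold)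
    next
      have "\<bar>Q0 \<tau> x y\<bar> + norm (Q1 \<tau> x y) \<le> (M0 + M1) / \<tau> ^ (N + 1)"
        if xy: "x \<in> closure D" "y \<in> closure B" and \<tau>: "\<tau> \<ge> 1" for x y \<tau>
      proof -
        have w: "(x, y) \<in> K" using xy by (simp add: K_def)
        have \<epsilon>: "0 \<le> 1 / sqrt \<tau>" "1 / sqrt \<tau> \<le> 1" using \<tau> by (auto simp: real_sqrt_ge_1_iff)
        have "\<bar>Q0 \<tau> x y\<bar> \<le> M0 * (1 / \<tau> ^ (N + 1))"
          using M0(2)[OF w \<epsilon>] unfolding pw[OF \<tau>] by (simp add: Q0_def)
        moreover have "norm (Q1 \<tau> x y) \<le> M1 * (1 / \<tau> ^ (N + 1))"
          using M1(2)[OF w \<epsilon>] unfolding pw[OF \<tau>] by (simp add: Q1_def)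
        ultimately show ?thesis by (simp add: add_divide_distrib)
      qed
      then show "\<exists>C>0. \<forall>x\<in>closure D. \<forall>y\<in>closure B. \<forall>\<tau>\<ge>1. \<bar>Q0 \<tau> x y\<bar> + norm (Q1 \<tau> x y) \<le> C / \<tau> ^ (N + 1)"
        using M0(1) M1(1) by (intro exI[of _ "M0 + M1"]) auto
    qed
  qed
qed

end
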